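(* For every signature $L$ and every query $Q$ over the finite $L$-structures which is decidable in nondeterministic logarithmic space, there is a quantifier-free interpretation $\gamma:\Gamma_6\to(L,S)$ such that for every sufficiently large finite $L$-structure $A$, every successor expansion $(A,S)$ of $A$, and every breadth-first traversal $<$ of the 6-pointed graph $(A,S)^\gamma$: $A\in Q$ if and only if $((A,S)^\gamma,<)\models\psi$, where $\psi$ is the sentence described in the context.
   Context: Graphs are finite and undirected. A linear order $<$ of the vertex set of a graph, listing vertices $v_1<\dots<v_n$, is a breadth-first traversal (BFT) if for each $i\ge2$, whenever some $v_j$ with $j<i$ has a neighbour outside $\{v_1,\dots,v_{i-1}\}$, $v_i$ is adjacent to $v_{j^*}$ for the least such $j^*$ (a visiting order of breadth-first search). Equivalently: for all $u<v<w$, $uEw$ implies some $x<v$ with $x\le u$ has $xEv$. $\Gamma_6$ is the signature with a binary relation symbol $E$ and six constants $x_1,y_1,z_1,x_2,y_2,z_2$. The sentence $\psi$ of $\Gamma_6\cup\{<\}$: writing $p(u)$ for the $<$-least neighbour of $u$, say $v,w$ lie in a common quasi-level if $(p(w)<v\le w)\vee(p(v)<w\le v)$ (a clause involving $p(u)$ is false if $u$ has no neighbour); $\psi$ asserts that all six constants lie in one connected component (expressed as: no vertex $w$ without a $<$-smaller neighbour satisfies $c<w\le c'$ for constants $c<c'$), that if $x_1<x_2$ then $y_2,z_2$ lie in a common quasi-level, and that if $x_2<x_1$ then $y_1,z_1$ lie in a common quasi-level. A query over finite $L$-structures is an isomorphism-closed class; it is decidable in nondeterministic logarithmic space if a nondeterministic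 logspace Turing machine, given the standard encoding of $(A,<)$ for a finite $L$-structure $A$ and any linear order $<$ of its domain, accepts iff $A$ is in the query. A successor expansion of a finite $L$-structure $A$ is $(A,\min,\max,S)$ where $S$ is the successor function of some linear order of the domain with endpoints $\min,\max$; $(L,S)$ is $L$ plus constants $\min,\max$ and unary function symbol $S$. A $k$-ary interpretation $\gamma:\Gamma_6\to K$ consists of a $K$-formula $\partial^\gamma(\bar x)$ in a $k$-tuple of variables, a $K$-formula $E^\gamma(\bar x,\bar y)$, and for each constant a definition by cases (cases $K$-formulas, values $k$-tuples of $K$-terms); it is quantifier-free if these formulas are. For a $K$-structure $B$, $B^\gamma$ has domain $\{\bar b\in B^k:B\models\partial^\gamma(\bar b)\}$ with $E$ and the constants interpreted by their translations. *)

theory Defs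
  imports Complex_Main
begin

text \<open>A (finite) signature L is given by the list of arities of its relation symbols
  (relation symbol i, for i < length rels), the number of its constant symbols
  (constant i, for i < ncsts) and the list of arities of its function symbols.\<close>

type_synonym sig = "nat list \<times> nat \<times> nat list"

definition rels :: "sig \<Rightarrow> nat list" where "rels L = fst L"
definition ncsts :: "sig \<Rightarrow> nat" where "ncsts L = fst (snd L)"
definition funs :: "sig \<Rightarrow> nat list" where "funs L = snd (snd L)"

text \<open>A finite structure with universe {0..<size}.  Every finite structure is isomorphic
  to one of this form, and queries are isomorphism closed.\<close>

record struc =
  size :: nat
  rel :: "nat \<Rightarrow> nat list \<Rightarrow> bool"
  cst :: "nat \<Rightarrow> nat"
  fn :: "nat \<Rightarrow> nat list \<Rightarrow> nat"

definition is_struc :: "sig \<Rightarrow> struc \<Rightarrow> bool" where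
  "is_struc L A \<longleftrightarrow> size A \<ge> 1
     \<and> (\<forall>i < ncsts L. cst A i < size A)
     \<and> (\<forall>f < length (funs L). \<forall>xs. length xs = funs L ! f \<and> (\<forall>x\<in>set xs. x < size A)
           \<longrightarrow> fn A f xs < size A)"

definition iso :: "sig \<Rightarrow> struc \<Rightarrow> struc \<Rightarrow> bool" where
  "iso L A B \<longleftrightarrow> size A = size B \<and>
    (\<exists>h. bij_betw h {0..<size A} {0..<size B}
      \<and> (\<forall>r < length (rels L). \<forall>xs. length xs = rels L ! r \<and> (\<forall>x\<in>set xs. x < size A)
            \<longrightarrow> (rel A r xs \<longleftrightarrow> rel B r (map h xs)))
      \<and> (\<forall>i < ncsts L. h (cst A i) = cst B i)
      \<and> (\<forall>f < length (funs L). \<forall>xs. length xs = funs L ! f \<and> (\<forall>x\<in>set xs. x < size A)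
            \<longrightarrow> h (fn A f xs) = fn B f (map h xs)))"

definition is_query :: "sig \<Rightarrow> (struc \<Rightarrow> bool) \<Rightarrow> bool" where
  "is_query L Q \<longleftrightarrow> (\<forall>A B. is_struc L A \<and> is_struc L B \<and> iso L A B \<and> Q A \<longrightarrow> Q B)"

text \<open>A linear order of the universe {0..<n}, listed from least to greatest element.\<close>

definition is_order :: "struc \<Rightarrow> nat list \<Rightarrow> bool" where
  "is_order A os \<longleftrightarrow> distinct os \<and> set os = {0..<size A}"

text \<open>Alphabet {0,1,2} (2 is a separator).  Elements are represented by their rank in
  the order.  The encoding lists: the size n in unary, then for every relation symbol the
  characteristic bit string over all tuples in lexicographic order, then each constant
  as the binary representation of its rank, then for every function symbol the binary
  ranks of its values on all tuples in lexicographic order.\<close>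

fun tuples :: "nat \<Rightarrow> nat \<Rightarrow> nat list list" where
  "tuples n 0 = [[]]"
| "tuples n (Suc k) = concat (map (\<lambda>a. map (Cons a) (tuples n k)) [0..<n])"

definition bitlen :: "nat \<Rightarrow> nat" where
  "bitlen n = (LEAST w. w \<ge> 1 \<and> n \<le> 2 ^ w)"

definition bin :: "nat \<Rightarrow> nat \<Rightarrow> nat list" where
  "bin w x = map (\<lambda>i. (x div 2 ^ (w - 1 - i)) mod 2) [0..<w]"

definition rank :: "nat list \<Rightarrow> nat \<Rightarrow> nat" where
  "rank os x = (THE i. i < length os \<and> os ! i = x)"

definition enc :: "sig \<Rightarrow> struc \<Rightarrow> nat list \<Rightarrow> nat list" where
  "enc L A os =
    (let n = size A; w = bitlen n in
     replicate n 1 @ [2]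
     @ concat (map (\<lambda>r. map (\<lambda>t. if rel A r (map (\<lambda>a. os ! a) t) then 1 else 0)
                             (tuples n (rels L ! r)) @ [2]) [0..<length (rels L)])
     @ concat (map (\<lambda>i. bin w (rank os (cst A i)) @ [2]) [0..<ncsts L])
     @ concat (map (\<lambda>f. concat (map (\<lambda>t. bin w (rank os (fn A f (map (\<lambda>a. os ! a) t))))
                                   (tuples n (funs L ! f))) @ [2]) [0..<length (funs L)]))"

text \<open>A nondeterministic Turing machine with a two-way read-only input tape (with
  endmarkers 3 and 4) and one work tape (blank 0).  A transition
  (q, a, b, q', b', di, dj) means: in state q reading a on the input tape and b on the
  work tape, go to state q', write b', move the input head by di and the work head by
  dj (moves in {-1,0,1}).\<close>

record ntm =
  delta :: "(nat \<times> nat \<times> nat \<times> nat \<times> nat \<times> int \<times> int) set"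
  start :: nat
  accept :: nat

type_synonym config = "nat \<times> int \<times> int \<times> (int \<Rightarrow> nat)"

definition inp :: "nat list \<Rightarrow> int \<Rightarrow> nat" where
  "inp w i = (if i \<le> 0 then 3 else if i > int (length w) then 4 else w ! (nat i - 1))"

definition step :: "ntm \<Rightarrow> nat list \<Rightarrow> config \<Rightarrow> config \<Rightarrow> bool" where
  "step M w c c' \<longleftrightarrow> (case c of (q, i, j, t) \<Rightarrow> case c' of (q', i', j', t') \<Rightarrow>
     (\<exists>b' di dj. (q, inp w i, t j, q', b', di, dj) \<in> delta M
        \<and> di \<in> {-1, 0, 1} \<and> dj \<in> {-1, 0, 1}
        \<and> i' = i + di \<and> 0 \<le> i' \<and> i' \<le> int (length w) + 1
        \<and> j' = j + dj \<and> 0 \<le> j'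
        \<and> t' = t(j := b')))"

definition space :: "nat \<Rightarrow> nat \<Rightarrow> int" where
  "space c m = \<lceil>real c * log 2 (real m + 2)\<rceil>"

definition step_bounded :: "ntm \<Rightarrow> nat \<Rightarrow> nat list \<Rightarrow> config \<Rightarrow> config \<Rightarrow> bool" where
  "step_bounded M c w cf cf' \<longleftrightarrow> step M w cf cf' \<and> fst (snd (snd cf')) \<le> space c (length w)"

definition accepts :: "ntm \<Rightarrow> nat \<Rightarrow> nat list \<Rightarrow> bool" where
  "accepts M c w \<longleftrightarrow> (\<exists>cf. (step_bounded M c w)\<^sup>*\<^sup>* (start M, 0, 0, \<lambda>_. 0) cf
                             \<and> fst cf = accept M)"

definition NL_query :: "sig \<Rightarrow> (struc \<Rightarrow> bool) \<Rightarrow> bool" where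
  "NL_query L Q \<longleftrightarrow> (\<exists>M c. finite (delta M) \<and>
     (\<forall>A os. is_struc L A \<and> is_order A os \<longrightarrow> (accepts M c (enc L A os) \<longleftrightarrow> Q A)))"

text \<open>Successor function of the order os; the maximum is mapped to itself.\<close>

definition succ :: "nat list \<Rightarrow> nat \<Rightarrow> nat" where
  "succ os x = (case filter (\<lambda>i. os ! i = x) [0..<length os - 1] of
                  [] \<Rightarrow> x | i # _ \<Rightarrow> os ! Suc i)"

datatype tm = TVar nat | TCst nat | TMin | TMax | TFun nat "tm list" | TSucc tm

datatype fm = FTrue | FEq tm tm | FRel nat "tm list" | FNeg fm | FConj fm fm | FDisj fm fm

fun wf_tm :: "sig \<Rightarrow> nat \<Rightarrow> tm \<Rightarrow> bool" where
  "wf_tm L m (TVar i) = (i < m)"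
| "wf_tm L m (TCst i) = (i < ncsts L)"
| "wf_tm L m TMin = True"
| "wf_tm L m TMax = True"
| "wf_tm L m (TFun f ts) = (f < length (funs L) \<and> length ts = funs L ! f \<and> (\<forall>t\<in>set ts. wf_tm L m t))"
| "wf_tm L m (TSucc t) = wf_tm L m t"

fun wf_fm :: "sig \<Rightarrow> nat \<Rightarrow> fm \<Rightarrow> bool" where
  "wf_fm L m FTrue = True"
| "wf_fm L m (FEq s t) = (wf_tm L m s \<and> wf_tm L m t)"
| "wf_fm L m (FRel r ts) = (r < length (rels L) \<and> length ts = rels L ! r \<and> (\<forall>t\<in>set ts. wf_tm L m t))"
| "wf_fm L m (FNeg p) = wf_fm L m p"
| "wf_fm L m (FConj p q) = (wf_fm L m p \<and> wf_fm L m q)"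
| "wf_fm L m (FDisj p q) = (wf_fm L m p \<and> wf_fm L m q)"

fun ev :: "struc \<Rightarrow> nat list \<Rightarrow> (nat \<Rightarrow> nat) \<Rightarrow> tm \<Rightarrow> nat" where
  "ev A os v (TVar i) = v i"
| "ev A os v (TCst i) = cst A i"
| "ev A os v TMin = hd os"
| "ev A os v TMax = last os"
| "ev A os v (TFun f ts) = fn A f (map (ev A os v) ts)"
| "ev A os v (TSucc t) = succ os (ev A os v t)"

fun holds :: "struc \<Rightarrow> nat list \<Rightarrow> (nat \<Rightarrow> nat) \<Rightarrow> fm \<Rightarrow> bool" where
  "holds A os v FTrue = True"
| "holds A os v (FEq s t) = (ev A os v s = ev A os v t)"
| "holds A os v (FRel r ts) = rel A r (map (ev A os v) ts)"
| "holds A os v (FNeg p) = (\<not> holds A os v p)"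
| "holds A os v (FConj p q) = (holds A os v p \<and> holds A os v q)"
| "holds A os v (FDisj p q) = (holds A os v p \<or> holds A os v q)"

text \<open>Constants of \<Gamma>6 are numbered x1=0, y1=1, z1=2, x2=3, y2=4, z2=5.
  idom has variables 0..<k; iedge has variables 0..<k (for x) and k..<2k (for y);
  each constant is defined by a list of cases (closed qf formula, k-tuple of closed terms).\<close>

record interp =
  idim :: nat
  idom :: fm
  iedge :: fm
  icst :: "nat \<Rightarrow> (fm \<times> tm list) list"

definition qf_interp :: "sig \<Rightarrow> interp \<Rightarrow> bool" where
  "qf_interp L g \<longleftrightarrow> wf_fm L (idim g) (idom g) \<and> wf_fm L (2 * idim g) (iedge g)
     \<and> (\<forall>c < 6. \<forall>(p, ts) \<in> set (icst g c). wf_fm L 0 p \<and> length ts = idim g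
                                          \<and> (\<forall>t\<in>set ts. wf_tm L 0 t))"

definition ival :: "nat list \<Rightarrow> nat \<Rightarrow> nat" where
  "ival xs i = xs ! i"

definition idomain :: "interp \<Rightarrow> struc \<Rightarrow> nat list \<Rightarrow> nat list set" where
  "idomain g A os = {xs. length xs = idim g \<and> (\<forall>x\<in>set xs. x < size A)
                         \<and> holds A os (ival xs) (idom g)}"

definition iE :: "interp \<Rightarrow> struc \<Rightarrow> nat list \<Rightarrow> nat list \<Rightarrow> nat list \<Rightarrow> bool" where
  "iE g A os xs ys \<longleftrightarrow> holds A os (ival (xs @ ys)) (iedge g)"

text \<open>The case of constant c that holds (well defined when exactly one case holds).\<close>

definition cases_holding :: "interp \<Rightarrow> struc \<Rightarrow> nat list \<Rightarrow> nat \<Rightarrow> (fm \<times> tm list) list" where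
  "cases_holding g A os c = filter (\<lambda>(p, ts). holds A os (\<lambda>_. 0) p) (icst g c)"

definition iconst :: "interp \<Rightarrow> struc \<Rightarrow> nat list \<Rightarrow> nat \<Rightarrow> nat list" where
  "iconst g A os c = map (ev A os (\<lambda>_. 0)) (snd (hd (cases_holding g A os c)))"

definition interp_graph_ok :: "interp \<Rightarrow> struc \<Rightarrow> nat list \<Rightarrow> bool" where
  "interp_graph_ok g A os \<longleftrightarrow>
     (\<forall>c < 6. length (cases_holding g A os c) = 1 \<and> iconst g A os c \<in> idomain g A os)
     \<and> (\<forall>u\<in>idomain g A os. \<forall>w\<in>idomain g A os. iE g A os u w \<longleftrightarrow> iE g A os w u)
     \<and> (\<forall>u\<in>idomain g A os. \<not> iE g A os u u)"

definition bft :: "'v set \<Rightarrow> ('v \<Rightarrow> 'v \<Rightarrow> bool) \<Rightarrow> 'v list \<Rightarrow> bool" where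
  "bft V E vs \<longleftrightarrow> distinct vs \<and> set vs = V \<and>
     (\<forall>i < length vs. i \<ge> 1 \<longrightarrow>
        (\<forall>j < i. (\<exists>y\<in>V. E (vs ! j) y \<and> y \<notin> set (take i vs))
                \<and> (\<forall>j' < j. \<not> (\<exists>y\<in>V. E (vs ! j') y \<and> y \<notin> set (take i vs)))
                \<longrightarrow> E (vs ! i) (vs ! j)))"

definition olt :: "'v list \<Rightarrow> 'v \<Rightarrow> 'v \<Rightarrow> bool" where
  "olt vs u w \<longleftrightarrow> (\<exists>i j. i < j \<and> j < length vs \<and> vs ! i = u \<and> vs ! j = w)"

definition ole :: "'v list \<Rightarrow> 'v \<Rightarrow> 'v \<Rightarrow> bool" where
  "ole vs u w \<longleftrightarrow> olt vs u w \<or> (u = w \<and> u \<in> set vs)"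

definition is_p :: "'v list \<Rightarrow> ('v \<Rightarrow> 'v \<Rightarrow> bool) \<Rightarrow> 'v \<Rightarrow> 'v \<Rightarrow> bool" where
  "is_p vs E u p \<longleftrightarrow> p \<in> set vs \<and> E u p \<and> (\<forall>q\<in>set vs. E u q \<longrightarrow> ole vs p q)"

definition quasi_level :: "'v list \<Rightarrow> ('v \<Rightarrow> 'v \<Rightarrow> bool) \<Rightarrow> 'v \<Rightarrow> 'v \<Rightarrow> bool" where
  "quasi_level vs E v w \<longleftrightarrow>
     (\<exists>p. is_p vs E w p \<and> olt vs p v \<and> ole vs v w)
   \<or> (\<exists>p. is_p vs E v p \<and> olt vs p w \<and> ole vs w v)"

text \<open>((V,E,c),<) \<Turnstile> \<psi>, with c 0..5 = x1,y1,z1,x2,y2,z2.\<close>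

definition psi :: "'v list \<Rightarrow> ('v \<Rightarrow> 'v \<Rightarrow> bool) \<Rightarrow> (nat \<Rightarrow> 'v) \<Rightarrow> bool" where
  "psi vs E c \<longleftrightarrow>
     (\<forall>a < 6. \<forall>b < 6. olt vs (c a) (c b) \<longrightarrow>
        \<not> (\<exists>w\<in>set vs. \<not> (\<exists>x\<in>set vs. olt vs x w \<and> E x w)
                       \<and> olt vs (c a) w \<and> ole vs w (c b)))
   \<and> (olt vs (c 0) (c 3) \<longrightarrow> quasi_level vs E (c 4) (c 5))
   \<and> (olt vs (c 3) (c 0) \<longrightarrow> quasi_level vs E (c 1) (c 2))"

end

theory Submission
  imports Defs
begin

text \<open>Let C be the graph of configurations of a nondeterministic logspace computation and R its
  step relation.  Layer it by a clock: (t + 1, c) is joined to (t, c') if c = c' or R c c', and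
  every (1, c) is joined to every (0, c').  If s is the initial and g the final configuration
  and T the last time, then y = (1, s) has distance T - 1 from x = (T, s), while z = (1, g) has
  distance T - 1 if g is reachable from s, and T + 1 otherwise.  A breadth-first
  traversal lists vertices by distance from its first vertex; y and z lie in a common
  quasi-level if their distances agree, but not if they differ by two.  Since a traversal may
  start anywhere, two copies of the graph are joined by an edge between their vertices x: the
  traversal enters the copy it does not start in through x, and psi looks at that copy.

  It remains to make R quantifier-free definable from a successor.  Call a predicate
  on numbers below n^K definable if it holds iff some run of a quantifier-free step relation on
  tuples leads from a quantifier-free set of initial tuples to a quantifier-free set of final ones.
  Definable predicates are closed under conjunction, disjunction, bounded existential
  quantification and transitive closure.  Hence the graphs of addition, multiplication and
  exponentiation are definable, then the letters of the input word, then the step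
  relation of the machine, and finally acceptance.\<close>

section \<open>Breadth-first traversals and distance\<close>

text \<open>A quantifier-free formula over a successor can neither compare positions nor add nor
  name a bit of a number, so all of this has to be computed inside the interpreted graph; hence
  definability is tied to runs and not to formulas. Runs are nondeterministic and give no direct
  closure under complement. All arithmetic is therefore phrased positively, through graphs of
  functions whose intermediate values are guessed, and negation is applied only to quantifier-free
  conditions. Guesses are bounded, so every intermediate number must fit below n^K; this is why K is
  picked only after polynomial bounds for the machine are known. The distances T - 1 and T + 1 skip
  T because each edge changes the level by exactly one. The gap of two is what makes quasi-levels
  decisive: a vertex only one level further than y could have its parent before y and still share a
  quasi-level with it.\<close>

locale bft_levels =
  fixes V :: "'v set" and E :: "'v \<Rightarrow> 'v \<Rightarrow> bool" and vs :: "'v list" and D :: "'v \<Rightarrow> nat"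
  assumes bft: "bft V E vs"
    and sym: "\<lbrakk>u \<in> V; v \<in> V; E u v\<rbrakk> \<Longrightarrow> E v u"
    and root: "v \<in> V \<Longrightarrow> D v = 0 \<longleftrightarrow> v = vs ! 0"
    and lipschitz: "\<lbrakk>u \<in> V; v \<in> V; E u v\<rbrakk> \<Longrightarrow> D v \<le> Suc (D u)"
    and parent: "\<lbrakk>v \<in> V; 0 < D v\<rbrakk> \<Longrightarrow> \<exists>u\<in>V. E u v \<and> D v = Suc (D u)"
begin

lemma dist_vs: "distinct vs" and set_vs: "set vs = V"
  using bft unfolding bft_def by auto

text \<open>Outer induction on the position, inner induction on \<open>D u\<close>. If
  \<open>u\<close> were missing, its closer neighbour \<open>u'\<close> at position \<open>k\<close>
  would still have an unvisited neighbour, so \<open>vs ! i\<close> hangs off some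
  \<open>vs ! j\<close> with \<open>j \<le> k\<close>. Then \<open>D u' < D (vs ! j)\<close>, and
  the outer hypothesis puts \<open>u'\<close> before \<open>j\<close>, a contradiction.\<close>

lemma closer_visited:
  assumes "i < length vs" "u \<in> V" "D u < D (vs ! i)"
  shows "u \<in> set (take i vs)"
  using assms
proof (induction i arbitrary: u rule: less_induct)
  case (less i)
  have iV: "vs ! i \<in> V" using less.prems set_vs nth_mem by blast
  have i0: "i \<ge> 1"
  proof (rule ccontr)
    assume "\<not> 1 \<le> i"
    then have "i = 0" by simp
    then have "D (vs ! i) = 0" using root[OF iV] by simp
    then show False using less.prems by simp
  qed
  from less.prems(2,3) show ?case
  proof (induction "D u" arbitrary: u)
    case 0
    then have "u = vs ! 0" using root[of u] by simp
    moreover have "vs ! 0 = take i vs ! 0" using i0 by simp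
    moreover have "0 < length (take i vs)" using i0 less.prems(1) by auto
    ultimately show ?case by (metis nth_mem)
  next
    case (Suc d)
    then obtain u' where u': "u' \<in> V" "E u' u" "D u = Suc (D u')"
      using parent[of u] by auto
    then have "u' \<in> set (take i vs)" using Suc by auto
    then obtain k where k: "k < i" "vs ! k = u'"
      by (auto simp: in_set_conv_nth)
    show ?case
    proof (rule ccontr)
      assume nu: "u \<notin> set (take i vs)"
      define C where "C j \<longleftrightarrow> (\<exists>y\<in>V. E (vs ! j) y \<and> y \<notin> set (take i vs))" for j
      have "C k" unfolding C_def using k u' nu Suc.prems by blast
      define j where "j = (LEAST j. C j)"
      have Cj: "C j" unfolding j_def by (rule LeastI[of C k]) (rule \<open>C k\<close>)
      have jk: "j \<le> k" unfolding j_def by (rule Least_le[of C k]) (rule \<open>C k\<close>)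
      have jmin: "\<forall>j'<j. \<not> C j'" unfolding j_def using not_less_Least by blast
      have ji: "j < i" using jk k by simp
      have E: "E (vs ! i) (vs ! j)"
        using bft less.prems(1) i0 ji Cj jmin unfolding bft_def C_def by blast
      have jV: "vs ! j \<in> V" using ji less.prems(1) set_vs nth_mem by (metis less_trans)
      have "D (vs ! i) \<le> Suc (D (vs ! j))"
        using lipschitz[OF jV iV] sym[OF iV jV E] by blast
      then have "D u' < D (vs ! j)" using u' Suc.prems by simp
      then have "u' \<in> set (take j vs)"
        using less.IH[OF ji] u'(1) ji less.prems(1) by simp
      then obtain l where "l < j" "vs ! l = u'" by (auto simp: in_set_conv_nth)
      moreover have "l < length vs" "k < length vs" using \<open>l < j\<close> ji k less.prems(1) by auto
      ultimately show False
        using dist_vs jk k nth_eq_iff_index_eq by fastforce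
    qed
  qed
qed

lemma olt_if_closer:
  assumes "u \<in> V" "v \<in> V" "D u < D v" shows "olt vs u v"
proof -
  obtain i where i: "i < length vs" "vs ! i = v"
    using assms(2) set_vs by (metis in_set_conv_nth)
  then have "u \<in> set (take i vs)" using closer_visited assms by blast
  then obtain j where "j < i" "vs ! j = u" by (auto simp: in_set_conv_nth)
  then show ?thesis unfolding olt_def using i by blast
qed

lemma olt_asym: "olt vs u v \<Longrightarrow> \<not> olt vs v u"
  unfolding olt_def using dist_vs nth_eq_iff_index_eq
  by (metis less_trans not_less_iff_gr_or_eq)

lemma olt_irrefl: "\<not> olt vs u u"
  using olt_asym by blast

lemma olt_V: "olt vs u v \<Longrightarrow> u \<in> V \<and> v \<in> V"
  unfolding olt_def using set_vs nth_mem by (metis less_trans)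

lemma olt_total: "u \<in> V \<Longrightarrow> v \<in> V \<Longrightarrow> u = v \<or> olt vs u v \<or> olt vs v u"
  unfolding olt_def using set_vs by (metis in_set_conv_nth nat_neq_iff)

lemma olt_imp_le: "olt vs u v \<Longrightarrow> D u \<le> D v"
  using olt_if_closer olt_asym olt_V by (meson not_le_imp_less)

lemma ole_imp_le: "ole vs u v \<Longrightarrow> D u \<le> D v"
  unfolding ole_def using olt_imp_le by auto

text \<open>Some neighbour is one level closer and the least neighbour is not later than it, hence
  not deeper; on the other side an edge cannot skip a level.\<close>

lemma is_p_D:
  assumes "v \<in> V" "0 < D v" "is_p vs E v p" shows "D v = Suc (D p)"
proof -
  obtain q where q: "q \<in> V" "E q v" "D v = Suc (D q)" using parent assms by blast
  then have "D p \<le> D q" using assms sym[of q v] ole_imp_le set_vs unfolding is_p_def by blast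
  moreover have "D v \<le> Suc (D p)"
    using assms lipschitz[of p v] sym[of v p] set_vs unfolding is_p_def by blast
  ultimately show ?thesis using q by simp
qed

lemma ex_is_p:
  assumes "v \<in> V" "0 < D v" shows "\<exists>p. is_p vs E v p"
proof -
  obtain q where q: "q \<in> V" "E q v" using parent assms by blast
  define C where "C i \<longleftrightarrow> i < length vs \<and> E v (vs ! i)" for i
  obtain k where "C k" unfolding C_def using q sym[of q v] assms set_vs by (metis in_set_conv_nth)
  define i where "i = (LEAST i. C i)"
  have Ci: "C i" unfolding i_def by (rule LeastI[of C k]) (rule \<open>C k\<close>)
  have "ole vs (vs ! i) u" if u: "u \<in> set vs" "E v u" for u
  proof -
    obtain j where j: "j < length vs" "vs ! j = u" using u by (metis in_set_conv_nth)
    then have "i \<le> j" unfolding i_def using u by (intro Least_le) (simp add: C_def)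
    then show ?thesis unfolding ole_def olt_def using j u by (metis le_neq_implies_less)
  qed
  then have "is_p vs E v (vs ! i)" using Ci unfolding is_p_def C_def by simp
  then show ?thesis by blast
qed

text \<open>Least neighbours lie exactly one level closer. On a common level both of them precede
  both vertices. If \<open>z\<close> is two levels further, its least neighbour is still one level
  beyond \<open>y\<close> and so comes after \<open>y\<close>, while \<open>z\<close> itself cannot
  come before \<open>y\<close>.\<close>

lemma quasi_level_iff:
  assumes "y \<in> V" "z \<in> V" "0 < D y" "D z = D y \<or> D z = D y + 2"
  shows "quasi_level vs E y z \<longleftrightarrow> D y = D z"
proof
  assume eq: "D y = D z"
  obtain p q where p: "is_p vs E z p" "is_p vs E y q" using ex_is_p assms eq by metis
  then have "D z = Suc (D p)" "D y = Suc (D q)" using is_p_D assms eq by auto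
  then have "olt vs p y" "olt vs q z"
    using olt_if_closer assms eq p set_vs unfolding is_p_def by auto
  then show "quasi_level vs E y z"
    using p olt_total[OF assms(1,2)] unfolding quasi_level_def ole_def
    using assms(2) set_vs by blast
next
  assume "quasi_level vs E y z"
  then consider p where "is_p vs E z p" "olt vs p y" | "ole vs z y"
    unfolding quasi_level_def by blast
  then show "D y = D z"
  proof cases
    case 1
    then have "D z = Suc (D p)" "D p \<le> D y" using is_p_D olt_imp_le assms by auto
    then show ?thesis using assms(4) by auto
  next
    case 2
    then show ?thesis using ole_imp_le assms(4) by fastforce
  qed
qed

text \<open>Every vertex but the first has a neighbour closer to the root, hence earlier, and the
  first vertex has nothing before it. This is how the clause of \<open>psi\<close> about a common
  component is met.\<close>

lemma no_restart:
  assumes "olt vs a w" shows "\<exists>x\<in>set vs. olt vs x w \<and> E x w"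
proof -
  have wV: "w \<in> V" using olt_V assms by blast
  have "w \<noteq> vs ! 0"
  proof
    assume "w = vs ! 0"
    then have "D w = 0" using root[OF wV] by simp
    then have "D a = 0" using olt_imp_le[OF assms] by simp
    then have "a = vs ! 0" using root[of a] olt_V[OF assms] by simp
    then show False using assms \<open>w = vs ! 0\<close> olt_irrefl by simp
  qed
  then have "0 < D w" using root[OF wV] by simp
  then obtain u where "u \<in> V" "E u w" "D w = Suc (D u)" using parent wV by blast
  then show ?thesis using olt_if_closer[of u w] wV set_vs by auto
qed

lemma psi_iff:
  "psi vs E c \<longleftrightarrow> (olt vs (c 0) (c 3) \<longrightarrow> quasi_level vs E (c 4) (c 5))
                \<and> (olt vs (c 3) (c 0) \<longrightarrow> quasi_level vs E (c 1) (c 2))"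
proof -
  have "\<not> (\<exists>w\<in>set vs. \<not> (\<exists>x\<in>set vs. olt vs x w \<and> E x w) \<and> olt vs a w \<and> ole vs w b)" for a b
    using no_restart[of a] by metis
  then show ?thesis unfolding psi_def by simp
qed

end

section \<open>Distance in a graph\<close>

definition gdist :: "('h \<Rightarrow> 'h \<Rightarrow> bool) \<Rightarrow> 'h \<Rightarrow> 'h \<Rightarrow> nat" where
  "gdist H u v = (LEAST n. (H ^^ n) u v)"

lemma gdist_relpowp: "H\<^sup>*\<^sup>* u v \<Longrightarrow> (H ^^ gdist H u v) u v"
  unfolding gdist_def by (metis LeastI rtranclp_imp_relpowp)

lemma gdist_le: "(H ^^ n) u v \<Longrightarrow> gdist H u v \<le> n"
  unfolding gdist_def by (rule Least_le)

lemma gdist_self: "gdist H u u = 0"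
  using gdist_le[of 0 H u u] by simp

lemma gdist_eq_0: "H\<^sup>*\<^sup>* u v \<Longrightarrow> gdist H u v = 0 \<longleftrightarrow> u = v"
  using gdist_relpowp[of H u v] gdist_self[of H u] by auto

lemma gdist_step: "H\<^sup>*\<^sup>* u v \<Longrightarrow> H v w \<Longrightarrow> gdist H u w \<le> Suc (gdist H u v)"
  by (rule gdist_le) (auto intro: gdist_relpowp)

text \<open>The last edge of a shortest walk.\<close>

lemma gdist_parent:
  assumes "H\<^sup>*\<^sup>* u w" "0 < gdist H u w"
  shows "\<exists>v. H v w \<and> gdist H u w = Suc (gdist H u v)"
proof -
  obtain n where n: "gdist H u w = Suc n" using assms(2) gr0_implies_Suc by blast
  then have "(H ^^ Suc n) u w" using gdist_relpowp[OF assms(1)] by simp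
  then obtain v where v: "(H ^^ n) u v" "H v w" by auto
  have "gdist H u v \<le> n" using v(1) by (rule gdist_le)
  moreover have "gdist H u w \<le> Suc (gdist H u v)"
    using v gdist_step relpowp_imp_rtranclp by metis
  ultimately show ?thesis using n v by auto
qed

text \<open>Whichever copy the traversal starts in, it enters the other one through the bridge
  at x, so there it lists vertices by their distance from x.\<close>

lemma psi_two_copies:
  fixes \<beta> :: "'v \<Rightarrow> bool" and \<eta> :: "'v \<Rightarrow> 'h"
  assumes bft: "bft V E vs"
    and bij: "bij_betw (\<lambda>v. (\<beta> v, \<eta> v)) V (UNIV \<times> V0)"
    and E: "\<And>u v. \<lbrakk>u \<in> V; v \<in> V\<rbrakk> \<Longrightarrow> E u v \<longleftrightarrow>
          (\<beta> u = \<beta> v \<and> H (\<eta> u) (\<eta> v)) \<or> (\<beta> u \<noteq> \<beta> v \<and> \<eta> u = x \<and> \<eta> v = x)"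
    and HV: "\<And>h h'. H h h' \<Longrightarrow> h \<in> V0 \<and> h' \<in> V0"
    and symH: "symp H"
    and conn: "\<And>h. h \<in> V0 \<Longrightarrow> H\<^sup>*\<^sup>* x h"
    and cV: "\<And>i. i < 6 \<Longrightarrow> c i \<in> V"
    and \<beta>c: "\<And>i. i < 6 \<Longrightarrow> \<beta> (c i) \<longleftrightarrow> i \<ge> 3"
    and \<eta>c: "\<eta> (c 0) = x" "\<eta> (c 1) = y" "\<eta> (c 2) = z" "\<eta> (c 3) = x" "\<eta> (c 4) = y" "\<eta> (c 5) = z"
    and dist: "gdist H x z = gdist H x y \<or> gdist H x z = gdist H x y + 2"
  shows "psi vs E c \<longleftrightarrow> gdist H x y = gdist H x z"
proof -
  have setvs: "set vs = V" using bft unfolding bft_def by simp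
  have \<eta>V: "\<eta> v \<in> V0" if "v \<in> V" for v
    using bij that unfolding bij_betw_def by auto
  have ex: "\<exists>v\<in>V. \<beta> v = b \<and> \<eta> v = h" if "h \<in> V0" for b h
  proof -
    have "(b, h) \<in> (\<lambda>v. (\<beta> v, \<eta> v)) ` V" using bij that unfolding bij_betw_def by auto
    then show ?thesis by auto
  qed
  have inj: "u = v" if "u \<in> V" "v \<in> V" "\<beta> u = \<beta> v" "\<eta> u = \<eta> v" for u v
    using bij that unfolding bij_betw_def inj_on_def by auto
  have xV: "x \<in> V0" using \<eta>c(1) \<eta>V[of "c 0"] cV[of 0] by simp
  have conn2: "H\<^sup>*\<^sup>* h h'" if "h \<in> V0" "h' \<in> V0" for h h'
  proof -
    have "H\<^sup>*\<^sup>* h x" using conn[OF that(1)] symp_rtranclp[OF symH] by (auto dest: sympD)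
    then show ?thesis using conn[OF that(2)] by simp
  qed
  define r where "r = vs ! 0"
  have rV: "r \<in> V"
    unfolding r_def using setvs cV[of 0] by (metis length_pos_if_in_set nth_mem zero_less_numeral)
  \<comment> \<open>Distance from \<open>r\<close> in the joined graph. A walk into the other copy
    must cross the bridge, whose single edge accounts for the \<open>+ 1\<close>. The interpretation
    checks the local conditions that characterise distances, so no shortest walks of the joined
    graph are needed.\<close>
  define D where "D v = (if \<beta> v = \<beta> r then gdist H (\<eta> r) (\<eta> v)
                         else gdist H (\<eta> r) x + 1 + gdist H x (\<eta> v))" for v
  interpret bft_levels V E vs D
  proof
    show "bft V E vs" by (rule bft)
    show "E v u" if "u \<in> V" "v \<in> V" "E u v" for u v
      using that(3) E[OF that(1,2)] E[OF that(2,1)] sympD[OF symH, of "\<eta> u" "\<eta> v"] by auto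
    show "D v = 0 \<longleftrightarrow> v = vs ! 0" if "v \<in> V" for v
    proof (cases "\<beta> v = \<beta> r")
      case True
      have "gdist H (\<eta> r) (\<eta> v) = 0 \<longleftrightarrow> \<eta> r = \<eta> v"
        using gdist_eq_0 conn2 \<eta>V rV that by metis
      moreover have "\<eta> r = \<eta> v \<longleftrightarrow> v = r" using inj[OF that rV True] by metis
      ultimately show ?thesis unfolding D_def if_P[OF True] by (simp add: r_def)
    next
      case False
      then have "v \<noteq> r" by metis
      moreover have "D v \<noteq> 0" unfolding D_def if_not_P[OF False] by simp
      ultimately show ?thesis unfolding r_def by blast
    qed
    show "D v \<le> Suc (D u)" if uv: "u \<in> V" "v \<in> V" "E u v" for u v
    proof (cases "\<beta> u = \<beta> v")
      case True
      then have "H (\<eta> u) (\<eta> v)" using E uv by auto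
      then show ?thesis using True conn2 \<eta>V uv rV xV gdist_step[of H _ "\<eta> u" "\<eta> v"]
        unfolding D_def by auto
    next
      case False
      then have "\<eta> u = x" "\<eta> v = x" using E uv by auto
      then show ?thesis using False unfolding D_def by (auto simp: gdist_self)
    qed
    show "\<exists>u\<in>V. E u v \<and> D v = Suc (D u)" if v: "v \<in> V" "0 < D v" for v
    proof -
      \<comment> \<open>The point from which distances in the copy of \<open>v\<close> are counted:
        the root, or the end of the bridge.\<close>
      define o' where "o' = (if \<beta> v = \<beta> r then \<eta> r else x)"
      have o': "o' \<in> V0" unfolding o'_def using \<eta>V rV xV by simp
      show ?thesis
      proof (cases "gdist H o' (\<eta> v) = 0")
        case True
        then have eq: "o' = \<eta> v" using gdist_eq_0 conn2 o' \<eta>V v by metis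
        \<comment> \<open>Here \<open>v\<close> is the entrance of the other copy, and its parent is
          the opposite end of the bridge.\<close>
        then have nb: "\<beta> v \<noteq> \<beta> r" "\<eta> v = x"
          using v unfolding D_def o'_def by (auto simp: gdist_self split: if_splits)
        obtain u where u: "u \<in> V" "\<beta> u = \<beta> r" "\<eta> u = x" using ex xV by blast
        then have "E u v" using E v nb by auto
        moreover have "D v = Suc (D u)" unfolding D_def using u nb by (simp add: gdist_self)
        ultimately show ?thesis using u by blast
      next
        case False
        then obtain h where h: "H h (\<eta> v)" "gdist H o' (\<eta> v) = Suc (gdist H o' h)"
          using gdist_parent conn2 o' \<eta>V v by (metis neq0_conv)
        obtain u where u: "u \<in> V" "\<beta> u = \<beta> v" "\<eta> u = h" using ex HV h by blast
        then have "E u v" using E v h by auto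
        moreover have "D v = Suc (D u)" using u h unfolding D_def o'_def by (auto split: if_splits)
        ultimately show ?thesis using u by blast
      qed
    qed
  qed
  \<comment> \<open>Away from \<open>r\<close>, \<open>D\<close> is the distance from
    \<open>x\<close> plus a positive constant, so differences are those of \<open>gdist\<close> and
    no vertex has level 0.\<close>
  have other: "quasi_level vs E v w \<longleftrightarrow> gdist H x y = gdist H x z"
    if "v \<in> V" "w \<in> V" "\<eta> v = y" "\<eta> w = z" "\<beta> v \<noteq> \<beta> r" "\<beta> w \<noteq> \<beta> r" for v w
    using quasi_level_iff[of v w] that dist unfolding D_def by auto
  have first: "olt vs u v" if "u \<in> V" "v \<in> V" "\<eta> u = x" "\<eta> v = x" "\<beta> u = \<beta> r" "\<beta> v \<noteq> \<beta> r" for u v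
    using olt_if_closer[of u v] that unfolding D_def by (auto simp: gdist_self)
  show ?thesis
  proof (cases "\<beta> r")
    case True
    then have "olt vs (c 3) (c 0)" using first cV \<beta>c \<eta>c by simp
    moreover have "quasi_level vs E (c 1) (c 2) \<longleftrightarrow> gdist H x y = gdist H x z"
      using other cV \<beta>c \<eta>c True by simp
    ultimately show ?thesis unfolding psi_iff using olt_asym by blast
  next
    case False
    then have "olt vs (c 0) (c 3)" using first cV \<beta>c \<eta>c by simp
    moreover have "quasi_level vs E (c 4) (c 5) \<longleftrightarrow> gdist H x y = gdist H x z"
      using other cV \<beta>c \<eta>c False by simp
    ultimately show ?thesis unfolding psi_iff using olt_asym by blast
  qed
qed

section \<open>The layered graph of a reachability problem\<close>

text \<open>Time runs downwards because 0, 1 and T are values of closed terms while T - 1 is not: there is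
  no predecessor function.  Level 0 is a hub that makes the graph connected.\<close>

definition descend :: "'c set \<Rightarrow> ('c \<Rightarrow> 'c \<Rightarrow> bool) \<Rightarrow> nat \<Rightarrow> nat \<times> 'c \<Rightarrow> nat \<times> 'c \<Rightarrow> bool" where
  "descend C R T = (\<lambda>(t, c) (t', c'). c \<in> C \<and> c' \<in> C \<and> t \<le> T \<and> t = Suc t'
      \<and> (t' = 0 \<or> c = c' \<or> R c c'))"

definition layered :: "'c set \<Rightarrow> ('c \<Rightarrow> 'c \<Rightarrow> bool) \<Rightarrow> nat \<Rightarrow> nat \<times> 'c \<Rightarrow> nat \<times> 'c \<Rightarrow> bool" where
  "layered C R T h h' \<longleftrightarrow> descend C R T h h' \<or> descend C R T h' h"

lemma symp_layered: "symp (layered C R T)"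
  by (rule sympI) (auto simp: layered_def)

lemma layered_in: "layered C R T h h' \<Longrightarrow> h \<in> {..T} \<times> C \<and> h' \<in> {..T} \<times> C"
  by (auto simp: layered_def descend_def split: prod.splits)

text \<open>Idling pads a run of \<open>m\<close> steps to a descent of exactly \<open>n\<close>
  levels; the idle edges all come at the start.\<close>

lemma layered_idle:
  assumes "(R' ^^ m) s c" "m \<le> n" "n \<le> T" "R' = (\<lambda>a b. a \<in> C \<and> b \<in> C \<and> R a b)" "s \<in> C"
  shows "c \<in> C \<and> (layered C R T ^^ n) (T, s) (T - n, c)"
  using assms(1-3)
proof (induction n arbitrary: m c)
  case 0
  then show ?case using assms by auto
next
  case (Suc n)
  have eq: "T - n = Suc (T - Suc n)" using Suc.prems by simp
  show ?case
  proof (cases m)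
    case 0
    then have c: "c = s" using Suc.prems by simp
    have "(layered C R T ^^ n) (T, s) (T - n, s)" using Suc.IH[of 0 s] Suc.prems by simp
    moreover have "layered C R T (T - n, s) (T - Suc n, s)"
      unfolding layered_def descend_def using eq Suc.prems assms(5) by simp
    ultimately show ?thesis using c assms(5) by auto
  next
    case (Suc m')
    then obtain c' where c': "(R' ^^ m') s c'" "R' c' c" using Suc.prems by auto
    have "(layered C R T ^^ n) (T, s) (T - n, c')"
      using Suc.IH[of m' c'] Suc.prems Suc c' by simp
    moreover have "layered C R T (T - n, c') (T - Suc n, c)"
      unfolding layered_def descend_def using eq Suc.prems assms(4) c' by simp
    ultimately show ?thesis using c' assms(4) by auto
  qed
qed

text \<open>Each edge changes the level by one, which gives the bound on the length and the parity.
  A walk of the minimal length \<open>T - t\<close> can never go up, and as long as it stays above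
  level 0 each of its edges idles or makes a step of \<open>R\<close>.\<close>

lemma layered_walk:
  assumes "(layered C R T ^^ n) (T, s) (t, c)"
  shows "t \<le> T \<and> T \<le> t + n \<and> even (n + T + t)
    \<and> (T = t + n \<and> 0 < t \<longrightarrow> (\<lambda>a b. a \<in> C \<and> b \<in> C \<and> R a b)\<^sup>*\<^sup>* s c)"
  using assms
proof (induction n arbitrary: t c)
  case 0
  then show ?case by auto
next
  case (Suc n)
  then obtain t' c' where w: "(layered C R T ^^ n) (T, s) (t', c')" "layered C R T (t', c') (t, c)"
    by auto
  note IH = Suc.IH[OF w(1)]
  from w(2) consider "descend C R T (t', c') (t, c)" | "descend C R T (t, c) (t', c')"
    unfolding layered_def by blast
  then show ?case
  proof cases
    case 1
    then have d: "t' = Suc t" "t' \<le> T" "c' \<in> C" "c \<in> C" "t = 0 \<or> c' = c \<or> R c' c"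
      by (auto simp: descend_def)
    have "(\<lambda>a b. a \<in> C \<and> b \<in> C \<and> R a b)\<^sup>*\<^sup>* s c" if "T = t + Suc n" "0 < t"
    proof -
      have "(\<lambda>a b. a \<in> C \<and> b \<in> C \<and> R a b)\<^sup>*\<^sup>* s c'" using IH that d by auto
      then show ?thesis using d that
        by (metis (mono_tags, lifting) nat_less_le rtranclp.rtrancl_into_rtrancl)
    qed
    then show ?thesis using IH d by auto
  next
    case 2
    then have d: "t = Suc t'" "t \<le> T" by (auto simp: descend_def)
    then show ?thesis using IH by auto
  qed
qed

text \<open>Idle down to level 1, cross to \<open>(0, c)\<close> through the hub, climb to the top
  in \<open>c\<close> and descend to level \<open>t\<close>.\<close>

lemma layered_connected:
  assumes "s \<in> C" "c \<in> C" "t \<le> T" "1 \<le> T"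
  shows "(layered C R T)\<^sup>*\<^sup>* (T, s) (t, c)"
proof -
  let ?H = "layered C R T"
  have down: "?H\<^sup>*\<^sup>* (T, a) (T - n, a)" if "a \<in> C" "n \<le> T" for a n
    using layered_idle[OF _ _ that(2) refl that(1), of 0 R a] relpowp_imp_rtranclp by fastforce
  have symr: "?H\<^sup>*\<^sup>* u v \<Longrightarrow> ?H\<^sup>*\<^sup>* v u" for u v
    using symp_rtranclp[OF symp_layered] by (auto dest: sympD)
  have hub: "?H (1, a) (0, b)" if "a \<in> C" "b \<in> C" for a b
    unfolding layered_def descend_def using that assms by simp
  have "?H\<^sup>*\<^sup>* (T, s) (1, s)" using down[of s "T - 1"] assms by simp
  also have "?H\<^sup>*\<^sup>* (1, s) (0, c)" using hub assms by blast
  also have "?H\<^sup>*\<^sup>* (0, c) (T, c)" using down[of c T] assms symr by simp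
  also have "?H\<^sup>*\<^sup>* (T, c) (t, c)" using down[of c "T - t"] assms by simp
  finally show ?thesis .
qed

text \<open>A run from \<open>s\<close> to \<open>g\<close>, padded by idling, gives
  \<open>T - 1\<close>. Without a run the hub still provides a walk of length \<open>T + 1\<close>;
  the length \<open>T\<close> has the wrong parity, and a walk of length \<open>T - 1\<close> would
  be a run.\<close>

lemma layered_gdist:
  assumes "finite C" "s \<in> C" "g \<in> C" and T: "card {(a, b). a \<in> C \<and> b \<in> C \<and> R a b} < T"
  defines "R' \<equiv> (\<lambda>a b. a \<in> C \<and> b \<in> C \<and> R a b)"
  shows "gdist (layered C R T) (T, s) (1, g) = (if R'\<^sup>*\<^sup>* s g then T - 1 else T + 1)"
proof -
  let ?H = "layered C R T"
  have T1: "1 \<le> T" using T by simp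
  note w = layered_walk[OF gdist_relpowp[OF layered_connected[OF assms(2,3) T1 T1, of R]],
      folded R'_def]
  show ?thesis
  proof (cases "R'\<^sup>*\<^sup>* s g")
    case True
    \<comment> \<open>A reachable configuration is reached in at most as many steps as
      \<open>R'\<close> has pairs; hence the hypothesis on \<open>T\<close> counts pairs of
      configurations.\<close>
    let ?S = "{(a, b). R' a b}"
    have fin: "finite ?S"
      by (rule finite_subset[of _ "C \<times> C"]) (auto simp: R'_def assms(1))
    have "(s, g) \<in> ?S\<^sup>*" using True by (simp add: rtranclp_rtrancl_eq)
    then obtain m where m: "m \<le> card ?S" "(s, g) \<in> ?S ^^ m"
      using rtrancl_finite_eq_relpow[OF fin] by auto
    then have "(R' ^^ m) s g" using relpowp_relpow_eq[of m ?S] by simp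
    moreover have "m \<le> T - 1" using m T unfolding R'_def by simp
    ultimately have "(?H ^^ (T - 1)) (T, s) (T - (T - 1), g)"
      using layered_idle[of m R' s g "T - 1" T C R] assms(2) R'_def by simp
    then have "gdist ?H (T, s) (1, g) \<le> T - 1" using gdist_le T1 by fastforce
    moreover have "T \<le> 1 + gdist ?H (T, s) (1, g)" using w by simp
    ultimately show ?thesis using True by simp
  next
    case False
    have "(?H ^^ (T - 1)) (T, s) (T - (T - 1), s)"
      using layered_idle[of 0 R' s s "T - 1" T C R] assms(2) R'_def by simp
    then have "(?H ^^ (T - 1)) (T, s) (1, s)" using T1 by simp
    \<comment> \<open>The detour over the hub: two more edges after the descent in
      \<open>s\<close>.\<close>
    moreover have "?H (1, s) (0, s)" "?H (0, s) (1, g)"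
      unfolding layered_def descend_def using T1 assms by simp_all
    ultimately have "(?H ^^ Suc (Suc (T - 1))) (T, s) (1, g)" by auto
    then have "gdist ?H (T, s) (1, g) \<le> T + 1" using gdist_le T1 by fastforce
    moreover have "gdist ?H (T, s) (1, g) \<noteq> T" using w by (metis add.commute add_left_cancel even_add odd_one)
    moreover have "gdist ?H (T, s) (1, g) \<noteq> T - 1" using w False T1 by auto
    moreover have "T - 1 \<le> gdist ?H (T, s) (1, g)" using w by linarith
    ultimately show ?thesis using False by simp
  qed
qed

section \<open>Digit expansions\<close>

fun val :: "nat \<Rightarrow> nat list \<Rightarrow> nat" where
  "val b [] = 0"
| "val b (x # xs) = x + b * val b xs"

lemma val_less:
  assumes "set xs \<subseteq> {..<b}" shows "val b xs < b ^ length xs"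
  using assms
proof (induction xs)
  case (Cons x xs)
  then have "x < b" "Suc (val b xs) \<le> b ^ length xs" by auto
  then have "x + b * val b xs < b * Suc (val b xs)" "b * Suc (val b xs) \<le> b * b ^ length xs"
    by (simp, intro mult_le_mono2)
  then have "x + b * val b xs < b * b ^ length xs" by (rule less_le_trans)
  then show ?case by simp
qed simp

lemma val_Cons_eq_iff:
  assumes "x < b" "y < b"
  shows "x + b * m = y + b * n \<longleftrightarrow> x = y \<and> m = (n::nat)"
proof
  assume eq: "x + b * m = y + b * n"
  then have "(x + b * m) mod b = (y + b * n) mod b" "(x + b * m) div b = (y + b * n) div b" by auto
  then show "x = y \<and> m = n" using assms by auto
qed simp

lemma val_inj:
  assumes "length xs = length ys" "set xs \<subseteq> {..<b}" "set ys \<subseteq> {..<b}"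
  shows "val b xs = val b ys \<longleftrightarrow> xs = ys"
  using assms by (induction xs ys rule: list_induct2) (auto simp: val_Cons_eq_iff)

lemma val_surj:
  "x < b ^ k \<Longrightarrow> \<exists>xs. length xs = k \<and> set xs \<subseteq> {..<b} \<and> val b xs = x"
proof (induction k arbitrary: x)
  case 0
  then show ?case by (intro exI[of _ "[]"]) simp
next
  case (Suc k)
  have b: "0 < b" using Suc.prems by (cases b) auto
  have "x div b < b ^ k" using Suc.prems by (simp add: less_mult_imp_div_less mult.commute)
  then obtain xs where xs: "length xs = k" "set xs \<subseteq> {..<b}" "val b xs = x div b"
    using Suc.IH by blast
  then show ?case using b by (intro exI[of _ "x mod b # xs"]) auto
qed

text \<open>The two alternatives are an increment without and with a carry. Unfolded over a fixed
  number of digits, this makes the successor on digit strings quantifier-free.\<close>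

lemma val_eq_Suc_iff:
  assumes "x < b" "y < b"
  shows "y + b * n = Suc (x + b * m) \<longleftrightarrow> (y = Suc x \<and> n = m) \<or> (Suc x = b \<and> y = 0 \<and> n = Suc m)"
proof (cases "Suc x = b")
  case True
  then have "Suc (x + b * m) = 0 + b * Suc m" by simp
  then show ?thesis using val_Cons_eq_iff[of y b 0 n "Suc m"] assms True by auto
next
  case False
  then show ?thesis using val_Cons_eq_iff[of y b "Suc x" n m] assms by auto
qed

lemma val_replicate_0: "val b (replicate k 0) = 0"
  by (induction k) auto

lemma val_replicate_max: "0 < b \<Longrightarrow> Suc (val b (replicate k (b - 1))) = b ^ k"
proof (induction k)
  case (Suc k)
  have "Suc (val b (replicate (Suc k) (b - 1))) = b * Suc (val b (replicate k (b - 1)))"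
    using Suc.prems by simp
  also have "\<dots> = b ^ Suc k" using Suc by simp
  finally show ?case .
qed simp

section \<open>Orders and substitution\<close>

type_synonym ctx = "struc \<times> nat list"
type_synonym pred = "ctx \<Rightarrow> (nat \<Rightarrow> nat) \<Rightarrow> bool"

abbreviation sz :: "ctx \<Rightarrow> nat" where "sz G \<equiv> size (fst G)"

lemma is_orderD:
  assumes "is_order A os"
  shows "distinct os" "set os = {0..<size A}" "length os = size A"
  using assms distinct_card[of os] unfolding is_order_def by auto

lemma nth_order_less: "is_order A os \<Longrightarrow> i < size A \<Longrightarrow> os ! i < size A"
  using is_orderD[of A os] nth_mem[of i os] by auto

lemma rank_nth: "distinct os \<Longrightarrow> i < length os \<Longrightarrow> rank os (os ! i) = i"
  unfolding rank_def by (rule the_equality) (auto simp: nth_eq_iff_index_eq)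

lemma nth_rank:
  assumes "is_order A os" "x < size A"
  shows "os ! rank os x = x" "rank os x < size A"
proof -
  obtain i where "i < length os" "os ! i = x"
    using assms is_orderD[of A os] by (metis atLeast0LessThan in_set_conv_nth lessThan_iff)
  then show "os ! rank os x = x" "rank os x < size A"
    using rank_nth[of os i] is_orderD[OF assms(1)] by auto
qed

lemma eq_rank_iff: "is_order A os \<Longrightarrow> x < size A \<Longrightarrow> i < size A \<Longrightarrow> i = rank os x \<longleftrightarrow> os ! i = x"
  using nth_rank rank_nth[of os i] is_orderD[of A os] by auto

lemma filter_eq_upt: "filter (\<lambda>j. j = i) [0..<m] = (if i < m then [i] else [])"
  by (induction m) auto

lemma succ_nth:
  assumes "distinct os" "i < length os"
  shows "succ os (os ! i) = (if Suc i < length os then os ! Suc i else os ! i)"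
proof -
  have "filter (\<lambda>j. os ! j = os ! i) [0..<length os - 1] = filter (\<lambda>j. j = i) [0..<length os - 1]"
    by (rule filter_cong) (use assms in \<open>auto simp: nth_eq_iff_index_eq\<close>)
  then have "filter (\<lambda>j. os ! j = os ! i) [0..<length os - 1] = (if i < length os - 1 then [i] else [])"
    by (simp only: filter_eq_upt)
  then show ?thesis unfolding succ_def using assms by auto
qed

section \<open>Substitution of terms for variables\<close>

fun subst_tm :: "(nat \<Rightarrow> tm) \<Rightarrow> tm \<Rightarrow> tm" where
  "subst_tm \<sigma> (TVar i) = \<sigma> i"
| "subst_tm \<sigma> (TCst i) = TCst i"
| "subst_tm \<sigma> TMin = TMin"
| "subst_tm \<sigma> TMax = TMax"
| "subst_tm \<sigma> (TFun f ts) = TFun f (map (subst_tm \<sigma>) ts)"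
| "subst_tm \<sigma> (TSucc t) = TSucc (subst_tm \<sigma> t)"

fun subst_fm :: "(nat \<Rightarrow> tm) \<Rightarrow> fm \<Rightarrow> fm" where
  "subst_fm \<sigma> FTrue = FTrue"
| "subst_fm \<sigma> (FEq s t) = FEq (subst_tm \<sigma> s) (subst_tm \<sigma> t)"
| "subst_fm \<sigma> (FRel r ts) = FRel r (map (subst_tm \<sigma>) ts)"
| "subst_fm \<sigma> (FNeg p) = FNeg (subst_fm \<sigma> p)"
| "subst_fm \<sigma> (FConj p q) = FConj (subst_fm \<sigma> p) (subst_fm \<sigma> q)"
| "subst_fm \<sigma> (FDisj p q) = FDisj (subst_fm \<sigma> p) (subst_fm \<sigma> q)"

lemma ev_subst: "ev A os v (subst_tm \<sigma> t) = ev A os (\<lambda>i. ev A os v (\<sigma> i)) t"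
  by (induction t) (auto intro!: arg_cong[of _ _ "fn A _"])

lemma holds_subst: "holds A os v (subst_fm \<sigma> p) = holds A os (\<lambda>i. ev A os v (\<sigma> i)) p"
  by (induction p) (auto simp: ev_subst comp_def)

lemma wf_tm_subst:
  "\<lbrakk>wf_tm L k t; \<And>i. i < k \<Longrightarrow> wf_tm L k' (\<sigma> i)\<rbrakk> \<Longrightarrow> wf_tm L k' (subst_tm \<sigma> t)"
  by (induction t) auto

lemma wf_fm_subst:
  "\<lbrakk>wf_fm L k p; \<And>i. i < k \<Longrightarrow> wf_tm L k' (\<sigma> i)\<rbrakk> \<Longrightarrow> wf_fm L k' (subst_fm \<sigma> p)"
  by (induction p) (auto intro: wf_tm_subst)

lemma wf_tm_mono: "wf_tm L k t \<Longrightarrow> k \<le> k' \<Longrightarrow> wf_tm L k' t"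
  by (induction t) auto

lemma wf_fm_mono: "wf_fm L k p \<Longrightarrow> k \<le> k' \<Longrightarrow> wf_fm L k' p"
  by (induction p) (auto intro: wf_tm_mono)

section \<open>Quantifier-free predicates\<close>

text \<open>Elements are represented by their ranks in the order.  A variable v i of the second
  level ranges over the numbers below (size A)^K and stands for the block of K first-level
  variables that hold its base-(size A) digits, least significant digit first.\<close>

locale definability =
  fixes L :: sig and K n0 :: nat
  assumes K: "3 \<le> K" and n0: "3 \<le> n0"
begin

definition ok :: "ctx \<Rightarrow> bool" where
  "ok G \<longleftrightarrow> is_struc L (fst G) \<and> is_order (fst G) (snd G) \<and> n0 \<le> sz G"

definition big :: "ctx \<Rightarrow> nat" where
  "big G = sz G ^ K"

definition Qr :: "pred \<Rightarrow> bool" where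
  "Qr P \<longleftrightarrow> (\<exists>k p. wf_fm L k p \<and> (\<forall>G v. ok G \<longrightarrow> (\<forall>i. v i < sz G) \<longrightarrow>
      (holds (fst G) (snd G) (\<lambda>i. snd G ! v i) p \<longleftrightarrow> P G v)))"

lemma ok_sz: "ok G \<Longrightarrow> 3 \<le> sz G"
  using n0 unfolding ok_def by simp

lemma ok_order: "ok G \<Longrightarrow> is_order (fst G) (snd G)"
  unfolding ok_def by simp

lemma big_gt: "ok G \<Longrightarrow> c < sz G \<Longrightarrow> c < big G"
  using self_le_power[of "sz G" K] K ok_sz[of G] unfolding big_def by simp

lemma big_pos: "ok G \<Longrightarrow> 0 < big G"
  using big_gt[of G 0] ok_sz[of G] by simp

lemma QrI:
  assumes "wf_fm L k p"
    "\<And>G v. \<lbrakk>ok G; \<And>i. v i < sz G\<rbrakk> \<Longrightarrow> holds (fst G) (snd G) (\<lambda>i. snd G ! v i) p \<longleftrightarrow> P G v"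
  shows "Qr P"
  using assms unfolding Qr_def by blast

lemma Qr_cong:
  assumes "\<And>G v. \<lbrakk>ok G; \<forall>i. v i < sz G\<rbrakk> \<Longrightarrow> P G v \<longleftrightarrow> P' G v" "Qr P'" shows "Qr P"
proof -
  obtain k p where "wf_fm L k p" "\<forall>G v. ok G \<longrightarrow> (\<forall>i. v i < sz G) \<longrightarrow>
      (holds (fst G) (snd G) (\<lambda>i. snd G ! v i) p \<longleftrightarrow> P' G v)" using assms(2) unfolding Qr_def by blast
  then show ?thesis using assms(1) by (intro QrI[of k p]) simp_all
qed

lemma Qr_const: "Qr (\<lambda>G v. b)"
  by (cases b) (auto intro: QrI[of 0 FTrue] QrI[of 0 "FNeg FTrue"])

lemma Qr_not: assumes "Qr P" shows "Qr (\<lambda>G v. \<not> P G v)"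
proof -
  obtain k p where "wf_fm L k p" "\<forall>G v. ok G \<longrightarrow> (\<forall>i. v i < sz G) \<longrightarrow>
      (holds (fst G) (snd G) (\<lambda>i. snd G ! v i) p \<longleftrightarrow> P G v)" using assms unfolding Qr_def by blast
  then show ?thesis by (intro QrI[of k "FNeg p"]) auto
qed

lemma Qr_conj: assumes "Qr P" "Qr Q" shows "Qr (\<lambda>G v. P G v \<and> Q G v)"
proof -
  obtain k p where p: "wf_fm L k p" "\<forall>G v. ok G \<longrightarrow> (\<forall>i. v i < sz G) \<longrightarrow>
      (holds (fst G) (snd G) (\<lambda>i. snd G ! v i) p \<longleftrightarrow> P G v)" using assms unfolding Qr_def by blast
  obtain l q where q: "wf_fm L l q" "\<forall>G v. ok G \<longrightarrow> (\<forall>i. v i < sz G) \<longrightarrow>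
      (holds (fst G) (snd G) (\<lambda>i. snd G ! v i) q \<longleftrightarrow> Q G v)" using assms unfolding Qr_def by blast
  show ?thesis
    by (rule QrI[of "max k l" "FConj p q"]) (use p q in \<open>auto intro: wf_fm_mono\<close>)
qed

lemma Qr_disj: "Qr P \<Longrightarrow> Qr Q \<Longrightarrow> Qr (\<lambda>G v. P G v \<or> Q G v)"
  using Qr_not[OF Qr_conj[OF Qr_not[of P] Qr_not[of Q]]] by simp

lemma Qr_all_less: "(\<And>i. i < m \<Longrightarrow> Qr (P i)) \<Longrightarrow> Qr (\<lambda>G v. \<forall>i<m::nat. P i G v)"
proof (induction m)
  case 0
  show ?case by (rule Qr_cong[OF _ Qr_const[of True]]) simp
next
  case (Suc m)
  have "Qr (\<lambda>G v. (\<forall>i<m. P i G v) \<and> P m G v)" using Suc by (intro Qr_conj) auto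
  then show ?case by (rule Qr_cong[rotated]) (auto simp: less_Suc_eq)
qed

lemma Qr_all_set: "(\<And>i. i \<in> set xs \<Longrightarrow> Qr (P i)) \<Longrightarrow> Qr (\<lambda>G v. \<forall>i\<in>set xs. P i G v)"
proof (induction xs)
  case Nil
  show ?case by (rule Qr_cong[OF _ Qr_const[of True]]) simp
next
  case (Cons x xs)
  have "Qr (\<lambda>G v. P x G v \<and> (\<forall>i\<in>set xs. P i G v))" using Cons by (intro Qr_conj) auto
  then show ?case by (rule Qr_cong[rotated]) auto
qed

lemma Qr_ren: assumes "Qr P" shows "Qr (\<lambda>G v. P G (\<lambda>i. v (\<rho> i)))"
proof -
  obtain k p where p: "wf_fm L k p" "\<forall>G v. ok G \<longrightarrow> (\<forall>i. v i < sz G) \<longrightarrow>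
      (holds (fst G) (snd G) (\<lambda>i. snd G ! v i) p \<longleftrightarrow> P G v)" using assms unfolding Qr_def by blast
  show ?thesis
  proof (rule QrI)
    have "\<rho> i < Suc (\<Sum>i<k. \<rho> i)" if "i < k" for i
      using member_le_sum[of i "{..<k}" \<rho>] that by simp
    then show "wf_fm L (Suc (\<Sum>i<k. \<rho> i)) (subst_fm (\<lambda>i. TVar (\<rho> i)) p)"
      using p(1) by (auto intro: wf_fm_subst)
    show "holds (fst G) (snd G) (\<lambda>i. snd G ! v i) (subst_fm (\<lambda>i. TVar (\<rho> i)) p) \<longleftrightarrow> P G (\<lambda>i. v (\<rho> i))"
      if "ok G" "\<And>i. v i < sz G" for G v
      using p(2) that by (simp add: holds_subst)
  qed
qed

lemma nth_eq_iff: "ok G \<Longrightarrow> i < sz G \<Longrightarrow> j < sz G \<Longrightarrow> snd G ! i = snd G ! j \<longleftrightarrow> i = j"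
  using is_orderD[OF ok_order] by (simp add: nth_eq_iff_index_eq)

lemma Qr_eq: "Qr (\<lambda>G v. v i = v j)"
  by (rule QrI[of "Suc (max i j)" "FEq (TVar i) (TVar j)"]) (auto simp: nth_eq_iff less_Suc_eq_le)

lemma last_order: "ok G \<Longrightarrow> last (snd G) = snd G ! (sz G - 1)"
  using is_orderD[OF ok_order, of G] ok_sz[of G] by (metis last_conv_nth list.size(3) not_numeral_le_zero)

lemma hd_order: "ok G \<Longrightarrow> hd (snd G) = snd G ! 0"
  using is_orderD[OF ok_order, of G] ok_sz[of G] by (metis hd_conv_nth list.size(3) not_numeral_le_zero)

lemma succ_order:
  "ok G \<Longrightarrow> i < sz G \<Longrightarrow> succ (snd G) (snd G ! i) = (if Suc i < sz G then snd G ! Suc i else snd G ! i)"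
  using succ_nth[of "snd G" i] is_orderD[OF ok_order, of G] by simp

lemma Qr_top: "Qr (\<lambda>G v. v i = sz G - 1)"
proof (rule QrI)
  show "wf_fm L (Suc i) (FEq (TVar i) TMax)" by simp
  fix G and v :: "nat \<Rightarrow> nat" assume "ok G" "\<And>i. v i < sz G"
  then show "holds (fst G) (snd G) (\<lambda>i. snd G ! v i) (FEq (TVar i) TMax) \<longleftrightarrow> v i = sz G - 1"
    using ok_sz[of G] by (simp add: last_order nth_eq_iff)
qed

lemma Qr_suc: "Qr (\<lambda>G v. v j = Suc (v i))"
proof (rule QrI)
  \<comment> \<open>\<open>TSucc\<close> maps the maximum to itself, so the maximum has to be
    excluded.\<close>
  let ?p = "FConj (FNeg (FEq (TVar i) TMax)) (FEq (TVar j) (TSucc (TVar i)))"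
  show "wf_fm L (Suc (max i j)) ?p" by (simp add: less_Suc_eq_le)
  fix G and v :: "nat \<Rightarrow> nat" assume G: "ok G" and v: "\<And>i. v i < sz G"
  show "holds (fst G) (snd G) (\<lambda>i. snd G ! v i) ?p \<longleftrightarrow> v j = Suc (v i)"
  proof (cases "Suc (v i) < sz G")
    case True
    then have "v i \<noteq> sz G - 1" by simp
    then show ?thesis using True G v[of i] v[of j] by (simp add: last_order nth_eq_iff succ_order)
  next
    case False
    then have "v i = sz G - 1" using v[of i] by simp
    then show ?thesis using G v[of i] v[of j] by (simp add: last_order)
  qed
qed

definition numeral_tm :: "nat \<Rightarrow> tm" where
  "numeral_tm c = (TSucc ^^ c) TMin"

lemma wf_numeral_tm: "wf_tm L k (numeral_tm c)"
  unfolding numeral_tm_def by (induction c) auto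

lemma ev_numeral_tm: "ok G \<Longrightarrow> c < sz G \<Longrightarrow> ev (fst G) (snd G) v (numeral_tm c) = snd G ! c"
  unfolding numeral_tm_def by (induction c) (auto simp: hd_order succ_order)

text \<open>The origin of \<open>n0\<close>: in a structure of size at least \<open>n0\<close>, the
  \<open>c\<close>-fold successor of the minimum does not get stuck at the maximum and has rank
  \<open>c\<close>.\<close>

lemma Qr_num: assumes "c < n0" shows "Qr (\<lambda>G v. v i = c)"
proof (rule QrI)
  show "wf_fm L (Suc i) (FEq (TVar i) (numeral_tm c))" by (simp add: wf_numeral_tm)
  fix G and v :: "nat \<Rightarrow> nat" assume "ok G" "\<And>i. v i < sz G"
  moreover have "c < sz G" if "ok G" using that assms unfolding ok_def by simp
  ultimately show "holds (fst G) (snd G) (\<lambda>i. snd G ! v i) (FEq (TVar i) (numeral_tm c)) \<longleftrightarrow> v i = c"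
    by (simp add: ev_numeral_tm nth_eq_iff)
qed

lemma Qr_rel:
  assumes "r < length (rels L)" "length is = rels L ! r"
  shows "Qr (\<lambda>G v. rel (fst G) r (map (\<lambda>i. snd G ! v i) is))"
proof (rule QrI)
  have "\<forall>i\<in>set is. i < Suc (sum_list is)" by (simp add: member_le_sum_list less_Suc_eq_le)
  then show "wf_fm L (Suc (sum_list is)) (FRel r (map TVar is))" using assms by auto
  show "holds (fst G) (snd G) (\<lambda>i. snd G ! v i) (FRel r (map TVar is)) \<longleftrightarrow>
      rel (fst G) r (map (\<lambda>i. snd G ! v i) is)" for G and v :: "nat \<Rightarrow> nat"
    by (simp add: comp_def)
qed

lemma Qr_cst: assumes "c < ncsts L" shows "Qr (\<lambda>G v. v i = rank (snd G) (cst (fst G) c))"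
proof (rule QrI)
  show "wf_fm L (Suc i) (FEq (TVar i) (TCst c))" using assms by simp
  fix G and v :: "nat \<Rightarrow> nat" assume "ok G" "\<And>i. v i < sz G"
  then show "holds (fst G) (snd G) (\<lambda>i. snd G ! v i) (FEq (TVar i) (TCst c)) \<longleftrightarrow>
      v i = rank (snd G) (cst (fst G) c)"
    using eq_rank_iff[of "fst G" "snd G" "cst (fst G) c" "v i"] assms
    unfolding ok_def is_struc_def by simp
qed

lemma fn_less:
  assumes "ok G" "f < length (funs L)" "length xs = funs L ! f" "\<And>x. x \<in> set xs \<Longrightarrow> x < sz G"
  shows "fn (fst G) f xs < sz G"
  using assms unfolding ok_def is_struc_def by blast

lemma Qr_fn:
  assumes "f < length (funs L)" "length is = funs L ! f"
  shows "Qr (\<lambda>G v. v j = rank (snd G) (fn (fst G) f (map (\<lambda>i. snd G ! v i) is)))"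
proof (rule QrI)
  have "\<forall>i\<in>set is. i < Suc (sum_list is + j)" using member_le_sum_list[of _ "is"] by fastforce
  then show "wf_fm L (Suc (sum_list is + j)) (FEq (TVar j) (TFun f (map TVar is)))" using assms by auto
  fix G and v :: "nat \<Rightarrow> nat" assume Gv: "ok G" "\<And>i. v i < sz G"
  then have "fn (fst G) f (map (\<lambda>i. snd G ! v i) is) < sz G"
    using assms by (intro fn_less) (auto intro: nth_order_less ok_order)
  then show "holds (fst G) (snd G) (\<lambda>i. snd G ! v i) (FEq (TVar j) (TFun f (map TVar is))) \<longleftrightarrow>
      v j = rank (snd G) (fn (fst G) f (map (\<lambda>i. snd G ! v i) is))"
    using Gv eq_rank_iff[OF ok_order, of G] by (simp add: comp_def)
qed

text \<open>Digits are abstract here, so that the lemma applies both to blocks of elements and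
  to tuples of such blocks.\<close>

lemma Qr_val_Suc:
  fixes xs ys :: "(ctx \<Rightarrow> (nat \<Rightarrow> nat) \<Rightarrow> nat) list"
  assumes "length xs = length ys"
    and "\<And>x y. (x, y) \<in> set (zip xs ys) \<Longrightarrow> Qr (\<lambda>G v. x G v = y G v) \<and> Qr (\<lambda>G v. y G v = Suc (x G v))
          \<and> Qr (\<lambda>G v. Suc (x G v) = b G) \<and> Qr (\<lambda>G v. y G v = 0)
          \<and> (\<forall>G v. ok G \<longrightarrow> (\<forall>i. v i < sz G) \<longrightarrow> x G v < b G \<and> y G v < b G)"
  shows "Qr (\<lambda>G v. map (\<lambda>x. x G v) xs = map (\<lambda>y. y G v) ys)
       \<and> Qr (\<lambda>G v. val (b G) (map (\<lambda>y. y G v) ys) = Suc (val (b G) (map (\<lambda>x. x G v) xs)))"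
  using assms
proof (induction xs ys rule: list_induct2)
  case Nil
  show ?case using Qr_const[of True] Qr_const[of False] by simp
next
  case (Cons x xs y ys)
  have mem: "(x', y') \<in> set (zip (x # xs) (y # ys))" if "(x', y') \<in> set (zip xs ys)" for x' y'
    using that by simp
  have "Qr (\<lambda>G v. map (\<lambda>x. x G v) xs = map (\<lambda>y. y G v) ys)
       \<and> Qr (\<lambda>G v. val (b G) (map (\<lambda>y. y G v) ys) = Suc (val (b G) (map (\<lambda>x. x G v) xs)))"
    by (rule Cons.IH) (rule Cons.prems, erule mem)
  then have IH: "Qr (\<lambda>G v. map (\<lambda>x. x G v) xs = map (\<lambda>y. y G v) ys)"
       "Qr (\<lambda>G v. val (b G) (map (\<lambda>y. y G v) ys) = Suc (val (b G) (map (\<lambda>x. x G v) xs)))"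
    by blast+
  have xy0: "(x, y) \<in> set (zip (x # xs) (y # ys))" by simp
  have xy: "Qr (\<lambda>G v. x G v = y G v)" "Qr (\<lambda>G v. y G v = Suc (x G v))"
       "Qr (\<lambda>G v. Suc (x G v) = b G)" "Qr (\<lambda>G v. y G v = 0)"
       "\<And>G v. ok G \<Longrightarrow> \<forall>i. v i < sz G \<Longrightarrow> x G v < b G \<and> y G v < b G"
    using Cons.prems[OF xy0] by blast+
  have bd: "set (map (\<lambda>x. x G v) xs) \<subseteq> {..<b G}" "set (map (\<lambda>y. y G v) ys) \<subseteq> {..<b G}"
    if "ok G" "\<forall>i. v i < sz G" for G v
  proof -
    have "x' G v < b G \<and> y' G v < b G" if xy': "(x', y') \<in> set (zip xs ys)" for x' y'
      using Cons.prems[OF mem[OF xy']] \<open>ok G\<close> \<open>\<forall>i. v i < sz G\<close> by blast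
    then have "\<forall>i<length xs. (xs ! i) G v < b G \<and> (ys ! i) G v < b G"
      using Cons.hyps by (auto simp: set_zip)
    then show "set (map (\<lambda>x. x G v) xs) \<subseteq> {..<b G}" "set (map (\<lambda>y. y G v) ys) \<subseteq> {..<b G}"
      using Cons.hyps by (auto simp: in_set_conv_nth)
  qed
  have "Qr (\<lambda>G v. x G v = y G v \<and> map (\<lambda>x. x G v) xs = map (\<lambda>y. y G v) ys)"
    using xy IH by (intro Qr_conj)
  moreover have "Qr (\<lambda>G v. (y G v = Suc (x G v) \<and> map (\<lambda>x. x G v) xs = map (\<lambda>y. y G v) ys)
     \<or> (Suc (x G v) = b G \<and> y G v = 0
        \<and> val (b G) (map (\<lambda>y. y G v) ys) = Suc (val (b G) (map (\<lambda>x. x G v) xs))))"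
    using xy IH by (intro Qr_disj Qr_conj)
  then have "Qr (\<lambda>G v. val (b G) (map (\<lambda>y. y G v) (y # ys)) = Suc (val (b G) (map (\<lambda>x. x G v) (x # xs))))"
  proof (rule Qr_cong[rotated])
    fix G and v :: "nat \<Rightarrow> nat" assume Gv: "ok G" "\<forall>i. v i < sz G"
    \<comment> \<open>Without a carry the higher digits must agree. Equal values are turned into
      equal lists here, which is why both claims of the lemma go through one induction.\<close>
    have "val (b G) (map (\<lambda>y. y G v) ys) = val (b G) (map (\<lambda>x. x G v) xs)
        \<longleftrightarrow> map (\<lambda>x. x G v) xs = map (\<lambda>y. y G v) ys"
      using val_inj[of "map (\<lambda>y. y G v) ys" "map (\<lambda>x. x G v) xs"] bd[OF Gv] Cons.hyps by auto
    then show "val (b G) (map (\<lambda>y. y G v) (y # ys)) = Suc (val (b G) (map (\<lambda>x. x G v) (x # xs)))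
       \<longleftrightarrow> (y G v = Suc (x G v) \<and> map (\<lambda>x. x G v) xs = map (\<lambda>y. y G v) ys)
     \<or> (Suc (x G v) = b G \<and> y G v = 0
        \<and> val (b G) (map (\<lambda>y. y G v) ys) = Suc (val (b G) (map (\<lambda>x. x G v) xs)))"
      using xy(5)[OF Gv] by (simp add: val_eq_Suc_iff)
  qed
  ultimately show ?case by simp
qed

section \<open>Numbers as blocks of elements\<close>

definition num :: "ctx \<Rightarrow> (nat \<Rightarrow> nat) \<Rightarrow> nat \<Rightarrow> nat" where
  "num G v i = val (sz G) (map (\<lambda>j. v (i * K + j)) [0..<K])"

definition Qf :: "pred \<Rightarrow> bool" where
  "Qf P \<longleftrightarrow> Qr (\<lambda>G v. P G (num G v))"

lemma num_less: assumes "\<forall>i. v i < sz G" shows "num G v i < big G"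
proof -
  have "set (map (\<lambda>j. v (i * K + j)) [0..<K]) \<subseteq> {..<sz G}" using assms by auto
  from val_less[OF this] show ?thesis unfolding num_def big_def by simp
qed

lemma num_eq_val_iff:
  assumes "\<forall>i. v i < sz G" "length ds = K" "set ds \<subseteq> {..<sz G}"
  shows "num G v i = val (sz G) ds \<longleftrightarrow> (\<forall>j<K. v (i * K + j) = ds ! j)"
proof -
  have "num G v i = val (sz G) ds \<longleftrightarrow> map (\<lambda>j. v (i * K + j)) [0..<K] = ds"
    unfolding num_def using assms by (intro val_inj) auto
  also have "\<dots> \<longleftrightarrow> (\<forall>j<K. v (i * K + j) = ds ! j)"
    using assms(2) by (auto simp: list_eq_iff_nth_eq)
  finally show ?thesis .
qed

lemma Qf_cong:
  assumes "\<And>G v. \<lbrakk>ok G; \<forall>i. v i < big G\<rbrakk> \<Longrightarrow> P G v \<longleftrightarrow> P' G v" "Qf P'" shows "Qf P"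
  using assms(2) unfolding Qf_def
  by (rule Qr_cong[rotated]) (rule assms(1), assumption, simp add: num_less)

lemma Qf_const: "Qf (\<lambda>G v. b)" unfolding Qf_def by (rule Qr_const)
lemma Qf_not: "Qf P \<Longrightarrow> Qf (\<lambda>G v. \<not> P G v)" unfolding Qf_def by (rule Qr_not)
lemma Qf_conj: "Qf P \<Longrightarrow> Qf Q \<Longrightarrow> Qf (\<lambda>G v. P G v \<and> Q G v)" unfolding Qf_def by (rule Qr_conj)
lemma Qf_disj: "Qf P \<Longrightarrow> Qf Q \<Longrightarrow> Qf (\<lambda>G v. P G v \<or> Q G v)" unfolding Qf_def by (rule Qr_disj)
lemma Qf_all_less: "(\<And>i. i < m \<Longrightarrow> Qf (P i)) \<Longrightarrow> Qf (\<lambda>G v. \<forall>i<m::nat. P i G v)"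
  unfolding Qf_def by (rule Qr_all_less)
lemma Qf_imp: "Qf P \<Longrightarrow> Qf Q \<Longrightarrow> Qf (\<lambda>G v. P G v \<longrightarrow> Q G v)"
  unfolding imp_conv_disj by (intro Qf_disj Qf_not)

lemma Qf_ren: assumes "Qf P" shows "Qf (\<lambda>G v. P G (\<lambda>i. v (\<rho> i)))"
proof -
  have eq: "(\<lambda>i. num G v (\<rho> i)) = num G (\<lambda>i. v (\<rho> (i div K) * K + i mod K))" for G v
  proof
    fix i
    have "(i * K + j) div K = i" "(i * K + j) mod K = j" if "j < K" for j
      using that by auto
    then show "num G v (\<rho> i) = num G (\<lambda>i. v (\<rho> (i div K) * K + i mod K)) i"
      unfolding num_def by (intro arg_cong[of _ _ "val (sz G)"] map_cong) auto
  qed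
  show ?thesis
    unfolding Qf_def eq using Qr_ren[OF assms[unfolded Qf_def]] .
qed

lemma Qf_eq: "Qf (\<lambda>G v. v i = v j)"
proof -
  have "Qr (\<lambda>G v. \<forall>t<K. v (i * K + t) = v (j * K + t))" by (intro Qr_all_less Qr_eq)
  then show ?thesis unfolding Qf_def
  proof (rule Qr_cong[rotated])
    fix G and v :: "nat \<Rightarrow> nat" assume "ok G" "\<forall>i. v i < sz G"
    then show "num G v i = num G v j \<longleftrightarrow> (\<forall>t<K. v (i * K + t) = v (j * K + t))"
      using num_eq_val_iff[of v G "map (\<lambda>t. v (j * K + t)) [0..<K]" i]
      unfolding num_def[of G v j] by auto
  qed
qed

lemma num_eq_small_iff:
  assumes "\<forall>i. v i < sz G" "c < sz G"
  shows "num G v i = c \<longleftrightarrow> v (i * K) = c \<and> (\<forall>t<K - 1. v (i * K + Suc t) = 0)"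
proof -
  have c: "c = val (sz G) (c # replicate (K - 1) 0)" by (simp add: val_replicate_0)
  have "num G v i = val (sz G) (c # replicate (K - 1) 0)
     \<longleftrightarrow> (\<forall>j<K. v (i * K + j) = (c # replicate (K - 1) 0) ! j)"
    using assms K by (intro num_eq_val_iff) auto
  also have "\<dots> \<longleftrightarrow> (\<forall>j<Suc (K - 1). v (i * K + j) = (c # replicate (K - 1) 0) ! j)"
    using K by simp
  also have "\<dots> \<longleftrightarrow> v (i * K) = c \<and> (\<forall>t<K - 1. v (i * K + Suc t) = 0)"
    unfolding All_less_Suc2 by simp
  finally show ?thesis unfolding c[symmetric] .
qed

text \<open>Lifts a predicate on elements to numbers: the variables in \<open>I\<close> are required
  to have zero higher digits, so their lowest digit is the whole number. Outside \<open>I\<close>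
  the remainder modulo \<open>sz G\<close> extracts the lowest digit.\<close>

lemma Qf_small_digit:
  assumes "Qr (\<lambda>G v. P G (\<lambda>i. v (i * K)))" "finite I"
  shows "Qf (\<lambda>G v. (\<forall>i\<in>I. v i < sz G) \<and> P G (\<lambda>i. if i \<in> I then v i else v i mod sz G))"
proof -
  obtain xs where xs: "set xs = I" using finite_list[OF assms(2)] by blast
  have "Qr (\<lambda>G v. (\<forall>i\<in>set xs. \<forall>t<K - 1. v (i * K + Suc t) = 0) \<and> P G (\<lambda>i. v (i * K)))"
    using n0 by (intro Qr_conj Qr_all_less Qr_all_set Qr_num assms) auto
  then show ?thesis unfolding Qf_def xs
  proof (rule Qr_cong[rotated])
    fix G and v :: "nat \<Rightarrow> nat" assume Gv: "ok G" "\<forall>i. v i < sz G"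
    have mod: "num G v i mod sz G = v (i * K)" for i
    proof -
      have "[0..<K] = 0 # [1..<K]" using K by (simp add: upt_rec)
      then show ?thesis unfolding num_def using Gv by simp
    qed
    have small: "num G v i < sz G \<longleftrightarrow> (\<forall>t<K - 1. v (i * K + Suc t) = 0)" for i
      using num_eq_small_iff[of v G "num G v i" i] num_eq_small_iff[of v G "v (i * K)" i] Gv by metis
    have "(\<lambda>i. if i \<in> I then num G v i else num G v i mod sz G) = (\<lambda>i. v (i * K))"
      if "\<forall>i\<in>I. num G v i < sz G"
      using that mod by (metis mod_less)
    then show "(\<forall>i\<in>I. num G v i < sz G) \<and> P G (\<lambda>i. if i \<in> I then num G v i else num G v i mod sz G)
        \<longleftrightarrow> (\<forall>i\<in>I. \<forall>t<K - 1. v (i * K + Suc t) = 0) \<and> P G (\<lambda>i. v (i * K))"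
      using small by auto
  qed
qed

lemma Qf_small: "Qf (\<lambda>G v. v i < sz G)"
  using Qf_small_digit[of "\<lambda>_ _. True" "{i}"] Qr_const by simp

lemma Qf_top: "Qf (\<lambda>G v. v i = sz G - 1)"
proof -
  have "Qf (\<lambda>G v. (\<forall>i\<in>{i}. v i < sz G) \<and> (if i \<in> {i} then v i else v i mod sz G) = sz G - 1)"
    by (rule Qf_small_digit) (use Qr_top[of "i * K"] in simp_all)
  then show ?thesis by (rule Qf_cong[rotated]) (use ok_sz in fastforce)
qed

lemma Qf_num: assumes "c < n0" shows "Qf (\<lambda>G v. v i = c)"
proof -
  have "Qf (\<lambda>G v. (\<forall>i\<in>{i}. v i < sz G) \<and> (if i \<in> {i} then v i else v i mod sz G) = c)"
    by (rule Qf_small_digit) (auto intro: Qr_num[OF assms])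
  then show ?thesis by (rule Qf_cong[rotated]) (use assms in \<open>auto simp: ok_def\<close>)
qed

lemma Qf_rel:
  assumes "r < length (rels L)" "length is = rels L ! r"
  shows "Qf (\<lambda>G v. (\<forall>i\<in>set is. v i < sz G) \<and> rel (fst G) r (map (\<lambda>i. snd G ! v i) is))"
proof -
  have "Qr (\<lambda>G v. rel (fst G) r (map (\<lambda>i. snd G ! v (i * K)) is))"
    using Qr_rel[OF assms(1), of "map (\<lambda>i. i * K) is"] assms(2) by (simp add: comp_def)
  from Qf_small_digit[OF this finite_set[of "is"]] show ?thesis
  proof (rule Qf_cong[rotated])
    fix G and v :: "nat \<Rightarrow> nat"
    have eq: "map (\<lambda>i. snd G ! (if i \<in> set is then v i else v i mod sz G)) is = map (\<lambda>i. snd G ! v i) is"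
      by simp
    show "(\<forall>i\<in>set is. v i < sz G) \<and> rel (fst G) r (map (\<lambda>i. snd G ! v i) is) \<longleftrightarrow> (\<forall>i\<in>set is. v i < sz G)
        \<and> rel (fst G) r (map (\<lambda>i. snd G ! (if i \<in> set is then v i else v i mod sz G)) is)"
      unfolding eq by (rule refl)
  qed
qed

lemma Qf_cst:
  assumes "c < ncsts L" shows "Qf (\<lambda>G v. v i = rank (snd G) (cst (fst G) c))"
proof -
  have "Qf (\<lambda>G v. (\<forall>i\<in>{i}. v i < sz G) \<and>
      (if i \<in> {i} then v i else v i mod sz G) = rank (snd G) (cst (fst G) c))"
    by (rule Qf_small_digit) (auto intro: Qr_cst[OF assms])
  then show ?thesis
    by (rule Qf_cong[rotated]) (use assms nth_rank(2) in \<open>auto simp: ok_def is_struc_def\<close>)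
qed

lemma Qf_fn:
  assumes "f < length (funs L)" "length is = funs L ! f"
  shows "Qf (\<lambda>G v. (\<forall>i\<in>set is. v i < sz G) \<and> v j = rank (snd G) (fn (fst G) f (map (\<lambda>i. snd G ! v i) is)))"
proof -
  have "Qr (\<lambda>G v. v (j * K) = rank (snd G) (fn (fst G) f (map (\<lambda>i. snd G ! v (i * K)) is)))"
    using Qr_fn[OF assms(1), of "map (\<lambda>i. i * K) is" "j * K"] assms(2) by (simp add: comp_def)
  moreover have "finite (insert j (set is))" by simp
  ultimately have "Qf (\<lambda>G v. (\<forall>i\<in>insert j (set is). v i < sz G)
      \<and> (if j \<in> insert j (set is) then v j else v j mod sz G) =
        rank (snd G) (fn (fst G) f (map (\<lambda>i. snd G ! (if i \<in> insert j (set is) then v i else v i mod sz G)) is)))"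
    by (rule Qf_small_digit)
  then show ?thesis
  proof (rule Qf_cong[rotated])
    fix G and v :: "nat \<Rightarrow> nat" assume G: "ok G"
    \<comment> \<open>The value of a function is an element, so \<open>v j\<close> is small whenever
      the equation holds and \<open>j\<close> may join the set of small variables.\<close>
    have "rank (snd G) (fn (fst G) f (map (\<lambda>i. snd G ! v i) is)) < sz G" if "\<forall>i\<in>set is. v i < sz G"
      by (intro nth_rank ok_order G fn_less assms)
        (use assms that G in \<open>auto intro: nth_order_less ok_order\<close>)
    moreover have eq: "map (\<lambda>i. snd G ! (if i \<in> insert j (set is) then v i else v i mod sz G)) is
        = map (\<lambda>i. snd G ! v i) is" by simp
    ultimately show "(\<forall>i\<in>set is. v i < sz G) \<and> v j = rank (snd G) (fn (fst G) f (map (\<lambda>i. snd G ! v i) is))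
      \<longleftrightarrow> (\<forall>i\<in>insert j (set is). v i < sz G) \<and> (if j \<in> insert j (set is) then v j else v j mod sz G) =
        rank (snd G) (fn (fst G) f (map (\<lambda>i. snd G ! (if i \<in> insert j (set is) then v i else v i mod sz G)) is))"
      unfolding eq by auto
  qed
qed

lemma Qf_suc: "Qf (\<lambda>G v. v j = Suc (v i))"
proof -
  let ?d = "\<lambda>i. map (\<lambda>t G v. v (i * K + t)) [0..<K] :: (ctx \<Rightarrow> (nat \<Rightarrow> nat) \<Rightarrow> nat) list"
  have "Qr (\<lambda>G v. map (\<lambda>x. x G v) (?d i) = map (\<lambda>y. y G v) (?d j))
       \<and> Qr (\<lambda>G v. val (sz G) (map (\<lambda>y. y G v) (?d j)) = Suc (val (sz G) (map (\<lambda>x. x G v) (?d i))))"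
  proof (rule Qr_val_Suc)
    fix x y assume "(x, y) \<in> set (zip (?d i) (?d j))"
    then obtain t where t: "x = (\<lambda>G v. v (i * K + t))" "y = (\<lambda>G v. v (j * K + t))"
      by (auto simp: set_zip)
    have "Qr (\<lambda>G v. Suc (v (i * K + t)) = sz G)"
      by (rule Qr_cong[OF _ Qr_top[of "i * K + t"]]) (use ok_sz in force)
    then show "Qr (\<lambda>G v. x G v = y G v) \<and> Qr (\<lambda>G v. y G v = Suc (x G v))
          \<and> Qr (\<lambda>G v. Suc (x G v) = sz G) \<and> Qr (\<lambda>G v. y G v = 0)
          \<and> (\<forall>G v. ok G \<longrightarrow> (\<forall>i. v i < sz G) \<longrightarrow> x G v < sz G \<and> y G v < sz G)"
      unfolding t using Qr_eq Qr_suc Qr_num[of 0] n0 by simp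
  qed simp
  then show ?thesis unfolding Qf_def num_def by (simp add: comp_def)
qed

lemma Qf_max: "Qf (\<lambda>G v. Suc (v i) = big G)"
proof -
  have "Qr (\<lambda>G v. \<forall>t<K. v (i * K + t) = sz G - 1)" by (intro Qr_all_less Qr_top)
  then show ?thesis unfolding Qf_def
  proof (rule Qr_cong[rotated])
    fix G and v :: "nat \<Rightarrow> nat" assume Gv: "ok G" "\<forall>i. v i < sz G"
    then have "Suc (num G v i) = big G \<longleftrightarrow> num G v i = val (sz G) (replicate K (sz G - 1))"
      using val_replicate_max[of "sz G" K] ok_sz[of G] unfolding big_def by linarith
    also have "\<dots> \<longleftrightarrow> (\<forall>t<K. v (i * K + t) = sz G - 1)"
      using num_eq_val_iff[of v G "replicate K (sz G - 1)" i] Gv ok_sz[of G]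
      by (simp add: set_replicate_conv_if)
    finally show "Suc (num G v i) = big G \<longleftrightarrow> (\<forall>t<K. v (i * K + t) = sz G - 1)" .
  qed
qed

text \<open>The same successor one level up, with numbers below \<open>big G\<close> as digits; it
  drives the clock of the interpreted graph.\<close>

lemma Qf_val_Suc:
  assumes "length xs = length ys"
  shows "Qf (\<lambda>G v. val (big G) (map v ys) = Suc (val (big G) (map v xs)))"
proof -
  let ?d = "map (\<lambda>i G v. num G v i) :: nat list \<Rightarrow> (ctx \<Rightarrow> (nat \<Rightarrow> nat) \<Rightarrow> nat) list"
  have "Qr (\<lambda>G v. map (\<lambda>x. x G v) (?d xs) = map (\<lambda>y. y G v) (?d ys))
       \<and> Qr (\<lambda>G v. val (big G) (map (\<lambda>y. y G v) (?d ys)) = Suc (val (big G) (map (\<lambda>x. x G v) (?d xs))))"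
  proof (rule Qr_val_Suc)
    fix x y assume "(x, y) \<in> set (zip (?d xs) (?d ys))"
    then obtain i j where t: "x = (\<lambda>G v. num G v i)" "y = (\<lambda>G v. num G v j)"
      by (auto simp: set_zip)
    show "Qr (\<lambda>G v. x G v = y G v) \<and> Qr (\<lambda>G v. y G v = Suc (x G v))
          \<and> Qr (\<lambda>G v. Suc (x G v) = big G) \<and> Qr (\<lambda>G v. y G v = 0)
          \<and> (\<forall>G v. ok G \<longrightarrow> (\<forall>i. v i < sz G) \<longrightarrow> x G v < big G \<and> y G v < big G)"
      unfolding t using Qf_eq[of i j] Qf_suc[of j i] Qf_max[of i] Qf_num[of 0 j] n0 num_less
      unfolding Qf_def by simp
  qed (simp add: assms)
  then show ?thesis unfolding Qf_def by (simp add: comp_def)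
qed

end

section \<open>Predicates defined by reachability\<close>

text \<open>A list placed in front of an assignment, which shifts the old variables up. Registers
  and bound variables always come first and parameters last, as with de Bruijn indices.\<close>

definition cat :: "nat list \<Rightarrow> (nat \<Rightarrow> nat) \<Rightarrow> nat \<Rightarrow> nat" where
  "cat us v i = (if i < length us then us ! i else v (i - length us))"

lemma cat_append: "cat (us @ ws) v = cat us (cat ws v)"
  by (rule ext) (simp add: cat_def nth_append less_diff_conv2 add.commute)

lemma cat_Nil: "cat [] v = v"
  by (rule ext) (simp add: cat_def)

lemma cat_single: "cat [y] v 0 = y" "cat [y] v (Suc i) = v i"
  by (simp_all add: cat_def)

lemma cat_ren:
  "length us = m \<Longrightarrow> (\<lambda>i. cat us v (if i < m then i else m + \<rho> (i - m))) = cat us (\<lambda>i. v (\<rho> i))"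
  by (rule ext) (simp add: cat_def)

context definability
begin

definition T :: "ctx \<Rightarrow> nat \<Rightarrow> nat list set" where
  "T G m = {xs. length xs = m \<and> set xs \<subseteq> {..<big G}}"

definition path :: "ctx \<Rightarrow> pred \<Rightarrow> nat \<Rightarrow> (nat \<Rightarrow> nat) \<Rightarrow> nat list \<Rightarrow> nat list \<Rightarrow> bool" where
  "path G \<phi> m v a b \<longleftrightarrow> a \<in> T G m \<and> b \<in> T G m \<and> \<phi> G (cat a (cat b v))"

definition runs ::
    "ctx \<Rightarrow> nat \<Rightarrow> pred \<Rightarrow> pred \<Rightarrow> pred \<Rightarrow> (nat \<Rightarrow> nat) \<Rightarrow> bool" where
  "runs G m I \<phi> F v \<longleftrightarrow> (\<exists>a b. a \<in> T G m \<and> b \<in> T G m \<and> I G (cat a v) \<and> (path G \<phi> m v)\<^sup>*\<^sup>* a b \<and> F G (cat b v))"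

definition represents :: "nat \<Rightarrow> pred \<Rightarrow> pred \<Rightarrow> pred \<Rightarrow> pred \<Rightarrow> bool" where
  "represents m I \<phi> F P \<longleftrightarrow>
     (\<forall>G v. ok G \<longrightarrow> (\<forall>i. v i < big G) \<longrightarrow> (P G v \<longleftrightarrow> runs G m I \<phi> F v))"

text \<open>The number of registers and the three quantifier-free conditions are fixed for all
  structures and orders at once; the parameters \<open>v\<close> stay constant along a run.\<close>

definition Def :: "pred \<Rightarrow> bool" where
  "Def P \<longleftrightarrow> (\<exists>m I \<phi> F. Qf I \<and> Qf \<phi> \<and> Qf F \<and> represents m I \<phi> F P)"

lemma T_length: "a \<in> T G m \<Longrightarrow> length a = m" by (simp add: T_def)

lemma T_append: "a \<in> T G m \<Longrightarrow> b \<in> T G n \<Longrightarrow> a @ b \<in> T G (m + n)" by (auto simp: T_def)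

lemma T_split: assumes "a \<in> T G (m + n)" obtains x y where "a = x @ y" "x \<in> T G m" "y \<in> T G n"
proof
  show "a = take m a @ drop m a" by simp
  show "take m a \<in> T G m" "drop m a \<in> T G n"
    using assms set_take_subset[of m a] set_drop_subset[of m a] by (auto simp: T_def)
qed

lemma T_nth: "a \<in> T G m \<Longrightarrow> i < m \<Longrightarrow> a ! i < big G"
  unfolding T_def using nth_mem[of i a] by blast

lemma cat_bd: "a \<in> T G m \<Longrightarrow> \<forall>i. v i < big G \<Longrightarrow> \<forall>i. cat a v i < big G"
  by (simp add: cat_def T_nth T_length)

lemma T_zero: "ok G \<Longrightarrow> replicate m 0 \<in> T G m"
  using big_pos[of G] by (auto simp: T_def)

lemma T_single: "[y] \<in> T G (Suc 0) \<longleftrightarrow> y < big G" by (simp add: T_def)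

lemma T_snoc: assumes "e \<in> T G (m + 1)" shows "\<exists>a y. e = a @ [y] \<and> a \<in> T G m \<and> y < big G"
proof -
  obtain a b where ab: "e = a @ b" "a \<in> T G m" "b \<in> T G 1" using T_split[OF assms] .
  then obtain y where "b = [y]" by (auto simp: T_def length_Suc_conv)
  then show ?thesis using ab by (auto simp: T_single)
qed

lemma DefI:
  assumes "Qf I" "Qf \<phi>" "Qf F"
   "\<And>G v. \<lbrakk>ok G; \<forall>i. v i < big G\<rbrakk> \<Longrightarrow> P G v \<longleftrightarrow>
     (\<exists>a b. a \<in> T G m \<and> b \<in> T G m \<and> I G (cat a v) \<and> (path G \<phi> m v)\<^sup>*\<^sup>* a b \<and> F G (cat b v))"
  shows "Def P"
proof -
  have "represents m I \<phi> F P" unfolding represents_def runs_def by (intro allI impI, rule assms(4), assumption+)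
  then show ?thesis unfolding Def_def using assms(1-3) by blast
qed

lemma representsD:
  assumes "represents m I \<phi> F P" "ok G" "\<forall>i. v i < big G"
  shows "P G v \<longleftrightarrow>
     (\<exists>a b. a \<in> T G m \<and> b \<in> T G m \<and> I G (cat a v) \<and> (path G \<phi> m v)\<^sup>*\<^sup>* a b \<and> F G (cat b v))"
  using assms unfolding represents_def runs_def by blast

lemma Def_cong:
  assumes "\<And>G v. \<lbrakk>ok G; \<forall>i. v i < big G\<rbrakk> \<Longrightarrow> P G v \<longleftrightarrow> P' G v" "Def P'" shows "Def P"
proof -
  obtain m I \<phi> F where Q: "Qf I" "Qf \<phi>" "Qf F" "represents m I \<phi> F P'"
    using assms(2) unfolding Def_def by blast
  show ?thesis by (rule DefI[OF Q(1-3), of _ m]) (simp add: assms(1) representsD[OF Q(4)])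
qed

lemma Def_Qf: assumes "Qf P" shows "Def P"
proof (rule DefI)
  show "Qf P" "Qf (\<lambda>_ _. False)" "Qf (\<lambda>_ _. True)" using assms Qf_const by auto
  fix G and v :: "nat \<Rightarrow> nat"
  show "P G v \<longleftrightarrow> (\<exists>a b. a \<in> T G 0 \<and> b \<in> T G 0 \<and> P G (cat a v)
      \<and> (path G (\<lambda>_ _. False) 0 v)\<^sup>*\<^sup>* a b \<and> True)"
    by (auto simp: T_def cat_Nil)
qed

text \<open>If the guard fails, initial and final conditions hold everywhere, so a run of length
  zero accepts. Negation falls only on the quantifier-free \<open>\<theta>\<close>.\<close>

lemma Def_imp: assumes "Qf \<theta>" "Def P" shows "Def (\<lambda>G v. \<theta> G v \<longrightarrow> P G v)"
proof -
  obtain m I \<phi> F where Q: "Qf I" "Qf \<phi>" "Qf F" "represents m I \<phi> F P"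
    using assms(2) unfolding Def_def by blast
  let ?\<theta> = "\<lambda>G w. \<theta> G (\<lambda>i. w (m + i))"
  show ?thesis
  proof (rule DefI)
    show "Qf (\<lambda>G w. ?\<theta> G w \<longrightarrow> I G w)" "Qf \<phi>" "Qf (\<lambda>G w. ?\<theta> G w \<longrightarrow> F G w)"
      using Q(1-3) Qf_ren[OF assms(1), of "\<lambda>i. m + i"] by (auto intro: Qf_imp)
    fix G and v :: "nat \<Rightarrow> nat" assume Gv: "ok G" "\<forall>i. v i < big G"
    have \<theta>: "?\<theta> G (cat a v) \<longleftrightarrow> \<theta> G v" if "a \<in> T G m" for a
      using T_length[OF that] by (simp add: cat_def)
    show "(\<theta> G v \<longrightarrow> P G v) \<longleftrightarrow> (\<exists>a b. a \<in> T G m \<and> b \<in> T G m \<and> (?\<theta> G (cat a v) \<longrightarrow> I G (cat a v))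
        \<and> (path G \<phi> m v)\<^sup>*\<^sup>* a b \<and> (?\<theta> G (cat b v) \<longrightarrow> F G (cat b v)))"
      using representsD[OF Q(4) Gv] T_zero[OF Gv(1)] \<theta> by (cases "\<theta> G v") (simp; blast)+
  qed
qed

lemma Def_ren: assumes "Def P" shows "Def (\<lambda>G v. P G (\<lambda>i. v (\<rho> i)))"
proof -
  obtain m I \<phi> F where Q: "Qf I" "Qf \<phi>" "Qf F" "represents m I \<phi> F P"
    using assms unfolding Def_def by blast
  let ?\<rho> = "\<lambda>m i. if i < m then i else m + \<rho> (i - m)"
  show ?thesis
  proof (rule DefI)
    show "Qf (\<lambda>G w. I G (\<lambda>i. w (?\<rho> m i)))" "Qf (\<lambda>G w. \<phi> G (\<lambda>i. w (?\<rho> (m + m) i)))"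
       "Qf (\<lambda>G w. F G (\<lambda>i. w (?\<rho> m i)))"
      by (rule Qf_ren[OF Q(1)] Qf_ren[OF Q(2)] Qf_ren[OF Q(3)])+
    fix G and v :: "nat \<Rightarrow> nat" assume Gv: "ok G" "\<forall>i. v i < big G"
    have 1: "(\<lambda>i. cat a v (?\<rho> m i)) = cat a (\<lambda>i. v (\<rho> i))" if "a \<in> T G m" for a
      by (rule cat_ren[OF T_length[OF that]])
    have "(\<lambda>i. cat a (cat b v) (?\<rho> (m + m) i)) = cat a (cat b (\<lambda>i. v (\<rho> i)))"
      if "a \<in> T G m" "b \<in> T G m" for a b
      unfolding cat_append[symmetric] by (rule cat_ren[OF T_length[OF T_append[OF that]]])
    then have 2: "path G (\<lambda>G w. \<phi> G (\<lambda>i. w (?\<rho> (m + m) i))) m v = path G \<phi> m (\<lambda>i. v (\<rho> i))"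
      unfolding path_def by (intro ext) (auto simp del: if_splits)
    have bd: "\<forall>i. v (\<rho> i) < big G" using Gv by simp
    show "P G (\<lambda>i. v (\<rho> i)) \<longleftrightarrow> (\<exists>a b. a \<in> T G m \<and> b \<in> T G m \<and> I G (\<lambda>i. cat a v (?\<rho> m i))
        \<and> (path G (\<lambda>G w. \<phi> G (\<lambda>i. w (?\<rho> (m + m) i))) m v)\<^sup>*\<^sup>* a b \<and> F G (\<lambda>i. cat b v (?\<rho> m i)))"
      unfolding representsD[OF Q(4) Gv(1) bd] 2
      by (intro iff_exI conj_cong refl) (simp_all add: 1)
  qed
qed

text \<open>The two runs are interleaved: a step moves one component and keeps the other.
  Reachability in this product is reachability in both components, whatever the lengths of the two
  runs.\<close>

lemma Def_conj: assumes "Def P1" "Def P2" shows "Def (\<lambda>G v. P1 G v \<and> P2 G v)"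
proof -
  obtain m I1 \<phi>1 F1 where Q1: "Qf I1" "Qf \<phi>1" "Qf F1" "represents m I1 \<phi>1 F1 P1"
    using assms(1) unfolding Def_def by blast
  obtain n I2 \<phi>2 F2 where Q2: "Qf I2" "Qf \<phi>2" "Qf F2" "represents n I2 \<phi>2 F2 P2"
    using assms(2) unfolding Def_def by blast
  \<comment> \<open>The variables of a condition are the \<open>m\<close> registers of the first
    run, the \<open>n\<close> of the second and then the parameters; in a step the block of
    \<open>m + n\<close> registers occurs twice. Each renaming extracts what one of the runs
    sees.\<close>
  define r1 where "r1 i = (if i < m then i else i + n)" for i
  define r2 where "r2 i = m + i" for i
  define s1 where "s1 i = (if i < m then i else if i < 2 * m then i + n else i + 2 * n)" for i
  define s2 where "s2 i = (if i < n then m + i else 2 * m + i)" for i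
  define \<phi> where "\<phi> G w \<longleftrightarrow>
      (\<phi>1 G (\<lambda>i. w (s1 i)) \<and> (\<forall>i<n. w (m + i) = w (m + n + m + i)))
      \<or> ((\<forall>i<m. w i = w (m + n + i)) \<and> \<phi>2 G (\<lambda>i. w (s2 i)))" for G and w :: "nat \<Rightarrow> nat"
  show ?thesis
  proof (rule DefI)
    show "Qf (\<lambda>G w. I1 G (\<lambda>i. w (r1 i)) \<and> I2 G (\<lambda>i. w (r2 i)))"
      by (intro Qf_conj Qf_ren[OF Q1(1)] Qf_ren[OF Q2(1)])
    show "Qf \<phi>" unfolding \<phi>_def
      by (intro Qf_disj Qf_conj Qf_all_less Qf_eq Qf_ren[OF Q1(2)] Qf_ren[OF Q2(2)])
    show "Qf (\<lambda>G w. F1 G (\<lambda>i. w (r1 i)) \<and> F2 G (\<lambda>i. w (r2 i)))"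
      by (intro Qf_conj Qf_ren[OF Q1(3)] Qf_ren[OF Q2(3)])
    fix G and v :: "nat \<Rightarrow> nat" assume Gv: "ok G" "\<forall>i. v i < big G"
    have r: "(\<lambda>i. cat (a @ b) v (r1 i)) = cat a v" "(\<lambda>i. cat (a @ b) v (r2 i)) = cat b v"
      if "a \<in> T G m" "b \<in> T G n" for a b
      using that[THEN T_length] by (auto simp: cat_def r1_def r2_def nth_append)
    have st: "path G \<phi> (m + n) v (a @ b) (c @ d) \<longleftrightarrow>
        (path G \<phi>1 m v a c \<and> b = d) \<or> (a = c \<and> path G \<phi>2 n v b d)"
      if t: "a \<in> T G m" "b \<in> T G n" "c \<in> T G m" "d \<in> T G n" for a b c d
    proof -
      note len = t[THEN T_length]
      let ?w = "cat (a @ b) (cat (c @ d) v)"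
      have "(\<lambda>i. ?w (s1 i)) = cat a (cat c v)" "(\<lambda>i. ?w (s2 i)) = cat b (cat d v)"
        using len by (auto simp: cat_def s1_def s2_def nth_append mult_2 intro!: ext arg_cong[of _ _ v])
      moreover have "(\<forall>i<n. ?w (m + i) = ?w (m + n + m + i)) \<longleftrightarrow> b = d"
        "(\<forall>i<m. ?w i = ?w (m + n + i)) \<longleftrightarrow> a = c"
        using len by (auto simp: list_eq_iff_nth_eq cat_def nth_append)
      ultimately show ?thesis unfolding path_def \<phi>_def using t T_append by auto
    qed
    have star: "(path G \<phi> (m + n) v)\<^sup>*\<^sup>* (a @ b) (c @ d) \<longleftrightarrow>
        (path G \<phi>1 m v)\<^sup>*\<^sup>* a c \<and> (path G \<phi>2 n v)\<^sup>*\<^sup>* b d"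
      if t: "a \<in> T G m" "b \<in> T G n" "c \<in> T G m" "d \<in> T G n" for a b c d
    proof
      have "\<exists>c d. e = c @ d \<and> c \<in> T G m \<and> d \<in> T G n \<and> (path G \<phi>1 m v)\<^sup>*\<^sup>* a c \<and> (path G \<phi>2 n v)\<^sup>*\<^sup>* b d"
        if "(path G \<phi> (m + n) v)\<^sup>*\<^sup>* (a @ b) e" for e
        using that
      proof induction
        case base
        then show ?case using t by blast
      next
        case (step e e')
        then obtain c d where e: "e = c @ d" "c \<in> T G m" "d \<in> T G n"
          "(path G \<phi>1 m v)\<^sup>*\<^sup>* a c" "(path G \<phi>2 n v)\<^sup>*\<^sup>* b d" by blast
        have "e' \<in> T G (m + n)" using step unfolding path_def by blast
        then obtain c' d' where e': "e' = c' @ d'" "c' \<in> T G m" "d' \<in> T G n" by (rule T_split)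
        have "(path G \<phi>1 m v c c' \<and> d = d') \<or> (c = c' \<and> path G \<phi>2 n v d d')"
          using st[of c d c' d'] step(2) e e' by simp
        then show ?case using e e' by (metis rtranclp.rtrancl_into_rtrancl)
      qed
      moreover assume "(path G \<phi> (m + n) v)\<^sup>*\<^sup>* (a @ b) (c @ d)"
      ultimately show "(path G \<phi>1 m v)\<^sup>*\<^sup>* a c \<and> (path G \<phi>2 n v)\<^sup>*\<^sup>* b d"
        using t by (metis T_length append_eq_append_conv)
    next
      assume ac: "(path G \<phi>1 m v)\<^sup>*\<^sup>* a c \<and> (path G \<phi>2 n v)\<^sup>*\<^sup>* b d"
      have "(path G \<phi> (m + n) v)\<^sup>*\<^sup>* (a @ b) (c @ b)"
        using ac[THEN conjunct1] t(1)
      proof (induction rule: converse_rtranclp_induct)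
        case (step a a')
        then have "a' \<in> T G m" unfolding path_def by blast
        then show ?case using step st[of a b a' b] t by (metis converse_rtranclp_into_rtranclp)
      qed simp
      also have "(path G \<phi> (m + n) v)\<^sup>*\<^sup>* (c @ b) (c @ d)"
        using ac[THEN conjunct2] t(2)
      proof (induction rule: converse_rtranclp_induct)
        case (step b b')
        then have "b' \<in> T G n" unfolding path_def by blast
        then show ?case using step st[of c b c b'] t by (metis converse_rtranclp_into_rtranclp)
      qed simp
      finally show "(path G \<phi> (m + n) v)\<^sup>*\<^sup>* (a @ b) (c @ d)" .
    qed
    have ex: "(\<exists>e f. e \<in> T G (m + n) \<and> f \<in> T G (m + n) \<and> X e f) \<longleftrightarrow>
       (\<exists>a b c d. a \<in> T G m \<and> b \<in> T G n \<and> c \<in> T G m \<and> d \<in> T G n \<and> X (a @ b) (c @ d))" for X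
      by (metis T_split T_append)
    show "P1 G v \<and> P2 G v \<longleftrightarrow> (\<exists>e f. e \<in> T G (m + n) \<and> f \<in> T G (m + n) \<and>
        (I1 G (\<lambda>i. cat e v (r1 i)) \<and> I2 G (\<lambda>i. cat e v (r2 i))) \<and> (path G \<phi> (m + n) v)\<^sup>*\<^sup>* e f
        \<and> F1 G (\<lambda>i. cat f v (r1 i)) \<and> F2 G (\<lambda>i. cat f v (r2 i)))"
      unfolding ex representsD[OF Q1(4) Gv] representsD[OF Q2(4) Gv] using r star by (smt (verit, best))
  qed
qed

text \<open>The witness is guessed together with the initial state in one more register, which every
  step copies. It stands behind the other registers, so the inner run sees it as its first
  parameter.\<close>

lemma Def_ex: assumes "Def (\<lambda>G v. P G (\<lambda>i. v (Suc i)) (v 0))" shows "Def (\<lambda>G v. \<exists>y<big G. P G v y)"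
proof -
  obtain m I \<phi> F where Q: "Qf I" "Qf \<phi>" "Qf F" "represents m I \<phi> F (\<lambda>G v. P G (\<lambda>i. v (Suc i)) (v 0))"
    using assms unfolding Def_def by blast
  define s where "s i = (if i < m then i else if i < 2 * m then Suc i else if i = 2 * m then m else Suc i)" for i
  define \<psi> where "\<psi> G w \<longleftrightarrow> \<phi> G (\<lambda>i. w (s i)) \<and> w m = w (m + Suc m)" for G and w :: "nat \<Rightarrow> nat"
  show ?thesis
  proof (rule DefI)
    show "Qf I" by (rule Q)
    show "Qf \<psi>" unfolding \<psi>_def by (intro Qf_conj Qf_eq Qf_ren[OF Q(2)])
    show "Qf F" by (rule Q)
    fix G and v :: "nat \<Rightarrow> nat" assume Gv: "ok G" "\<forall>i. v i < big G"
    have P: "P G v y \<longleftrightarrow> (\<exists>a b. a \<in> T G m \<and> b \<in> T G m \<and> I G (cat a (cat [y] v))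
       \<and> (path G \<phi> m (cat [y] v))\<^sup>*\<^sup>* a b \<and> F G (cat b (cat [y] v)))" if "y < big G" for y
      using representsD[OF Q(4) Gv(1) cat_bd[OF _ Gv(2), of "[y]" 1]] that by (simp add: T_single cat_single)
    have st: "path G \<psi> (m + 1) v (a @ [y]) (b @ [z]) \<longleftrightarrow> y = z \<and> path G \<phi> m (cat [y] v) a b"
      if t: "a \<in> T G m" "b \<in> T G m" "y < big G" "z < big G" for a b y z
    proof -
      note len = t(1,2)[THEN T_length]
      let ?w = "cat (a @ [y]) (cat (b @ [z]) v)"
      have "(\<lambda>i. ?w (s i)) = cat a (cat b (cat [y] v))" if "y = z"
        using len that by (auto simp: cat_def s_def nth_append intro!: ext arg_cong[of _ _ v])
      moreover have "?w m = ?w (m + Suc m) \<longleftrightarrow> y = z"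
        using len by (auto simp: cat_def nth_append)
      moreover have "a @ [y] \<in> T G (m + 1)" "b @ [z] \<in> T G (m + 1)"
        using t by (auto simp: T_def)
      ultimately show ?thesis unfolding path_def \<psi>_def using t by auto
    qed
    have star: "(path G \<psi> (m + 1) v)\<^sup>*\<^sup>* (a @ [y]) (b @ [z]) \<longleftrightarrow> y = z \<and> (path G \<phi> m (cat [y] v))\<^sup>*\<^sup>* a b"
      if t: "a \<in> T G m" "b \<in> T G m" "y < big G" "z < big G" for a b y z
    proof
      have "\<exists>c. e = c @ [y] \<and> c \<in> T G m \<and> (path G \<phi> m (cat [y] v))\<^sup>*\<^sup>* a c"
        if "(path G \<psi> (m + 1) v)\<^sup>*\<^sup>* (a @ [y]) e" for e
        using that
      proof induction
        case base
        then show ?case using t by blast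
      next
        case (step e e')
        then obtain c where e: "e = c @ [y]" "c \<in> T G m" "(path G \<phi> m (cat [y] v))\<^sup>*\<^sup>* a c" by blast
        have "e' \<in> T G (m + 1)" using step unfolding path_def by blast
        then obtain c' z where e': "e' = c' @ [z]" "c' \<in> T G m" "z < big G"
          using T_snoc by blast
        have "y = z \<and> path G \<phi> m (cat [y] v) c c'"
          using st[of c c' y z] step(2) e(1,2) e' t(3) by blast
        then show ?case using e e' rtranclp.rtrancl_into_rtrancl[OF e(3)] by auto
      qed
      moreover assume "(path G \<psi> (m + 1) v)\<^sup>*\<^sup>* (a @ [y]) (b @ [z])"
      ultimately show "y = z \<and> (path G \<phi> m (cat [y] v))\<^sup>*\<^sup>* a b" by fastforce
    next
      assume ab: "y = z \<and> (path G \<phi> m (cat [y] v))\<^sup>*\<^sup>* a b"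
      have "(path G \<psi> (m + 1) v)\<^sup>*\<^sup>* (a @ [y]) (b @ [y])"
        using ab[THEN conjunct2] t(1)
      proof (induction rule: converse_rtranclp_induct)
        case (step a a')
        then have "a' \<in> T G m" unfolding path_def by blast
        then show ?case using step st[of a a' y y] t by (metis converse_rtranclp_into_rtranclp)
      qed simp
      then show "(path G \<psi> (m + 1) v)\<^sup>*\<^sup>* (a @ [y]) (b @ [z])" using ab by simp
    qed
    have ex: "(\<exists>e f. e \<in> T G (m + 1) \<and> f \<in> T G (m + 1) \<and> X e f) \<longleftrightarrow>
       (\<exists>a y b z. a \<in> T G m \<and> y < big G \<and> b \<in> T G m \<and> z < big G \<and> X (a @ [y]) (b @ [z]))" for X
    proof -
      have 2: "a @ [y] \<in> T G (m + 1)" if "a \<in> T G m" "y < big G" for a y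
        using that by (auto simp: T_def)
      show ?thesis using 2 T_snoc by metis
    qed
    show "(\<exists>y<big G. P G v y) \<longleftrightarrow> (\<exists>e f. e \<in> T G (m + 1) \<and> f \<in> T G (m + 1) \<and>
        I G (cat e v) \<and> (path G \<psi> (m + 1) v)\<^sup>*\<^sup>* e f \<and> F G (cat f v))"
      unfolding ex cat_append
    proof
      assume "\<exists>y<big G. P G v y"
      then obtain y where y: "y < big G" "P G v y" by blast
      then obtain a b where "a \<in> T G m" "b \<in> T G m" "I G (cat a (cat [y] v))"
        "(path G \<phi> m (cat [y] v))\<^sup>*\<^sup>* a b" "F G (cat b (cat [y] v))" using P[of y] by auto
      with y show "\<exists>a y b z. a \<in> T G m \<and> y < big G \<and> b \<in> T G m \<and> z < big G \<and>
          I G (cat a (cat [y] v)) \<and> (path G \<psi> (m + 1) v)\<^sup>*\<^sup>* (a @ [y]) (b @ [z]) \<and> F G (cat b (cat [z] v))"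
        using star[of a b y y] by (intro exI[of _ a] exI[of _ y] exI[of _ b] exI[of _ y]) simp
    next
      assume "\<exists>a y b z. a \<in> T G m \<and> y < big G \<and> b \<in> T G m \<and> z < big G \<and>
          I G (cat a (cat [y] v)) \<and> (path G \<psi> (m + 1) v)\<^sup>*\<^sup>* (a @ [y]) (b @ [z]) \<and> F G (cat b (cat [z] v))"
      then obtain a y b z where "a \<in> T G m" "y < big G" "b \<in> T G m" "z < big G"
          "I G (cat a (cat [y] v))" "(path G \<psi> (m + 1) v)\<^sup>*\<^sup>* (a @ [y]) (b @ [z])"
          "F G (cat b (cat [z] v))" by blast
      then show "\<exists>y<big G. P G v y"
        using star[of a b y z] P[of y] by (intro exI[of _ y]) auto
    qed
  qed
qed

text \<open>A guessed number selects the side, 0 for \<open>P\<close> and any other for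
  \<open>Q\<close>. Each side is then guarded by a quantifier-free test, as \<open>Def_imp\<close>
  allows.\<close>

lemma Def_disj: assumes "Def P" "Def Q" shows "Def (\<lambda>G v. P G v \<or> Q G v)"
proof -
  have "Def (\<lambda>G v. (v 0 = 0 \<longrightarrow> P G (\<lambda>i. v (Suc i))) \<and> (v 0 \<noteq> 0 \<longrightarrow> Q G (\<lambda>i. v (Suc i))))"
    using n0 by (intro Def_conj Def_imp Qf_not Qf_num Def_ren[OF assms(1)] Def_ren[OF assms(2)]) auto
  then have "Def (\<lambda>G v. \<exists>y<big G. (y = 0 \<longrightarrow> P G v) \<and> (y \<noteq> 0 \<longrightarrow> Q G v))"
    by (rule Def_ex)
  then show ?thesis
  proof (rule Def_cong[rotated])
    fix G and v :: "nat \<Rightarrow> nat" assume "ok G"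
    then have "0 < big G" "1 < big G" using big_gt[of G 0] big_gt[of G 1] ok_sz[of G] by auto
    then show "P G v \<or> Q G v \<longleftrightarrow> (\<exists>y<big G. (y = 0 \<longrightarrow> P G v) \<and> (y \<noteq> 0 \<longrightarrow> Q G v))"
      by (metis zero_neq_one)
  qed
qed

lemma upt_map_eq_iff:
  assumes "length a = k" shows "a = map w [m..<m + k] \<longleftrightarrow> (\<forall>i<k. a ! i = w (m + i))"
  using assms by (auto simp: list_eq_iff_nth_eq)

text \<open>A run for the transitive closure keeps the current pair (xs, ys) in registers together
  with the state of the run that verifies P for it.\<close>

lemma Def_tranclp:
  assumes "Def P"
  shows "Def (\<lambda>G w. (\<lambda>xs ys. xs \<in> T G k \<and> ys \<in> T G k \<and> P G (cat xs (cat ys (\<lambda>i. w (2 * k + i)))))\<^sup>+\<^sup>+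
      (map w [0..<k]) (map w [k..<k + k]))"
proof -
  obtain m I \<phi> F where Q: "Qf I" "Qf \<phi>" "Qf F" "represents m I \<phi> F P"
    using assms unfolding Def_def by blast
  \<comment> \<open>Layout of the registers: the state of the verifying run, then \<open>xs\<close>,
    then \<open>ys\<close>. With the state in front, the pair becomes the leading parameters of
    \<open>P\<close>.\<close>
  define M where "M = m + (k + k)"
  define r where "r i = (if i < M then i else i + 2 * k)" for i
  define s where "s i = (if i < m then i else if i < 2 * m then i + 2 * k
      else if i < 2 * m + 2 * k then i - m else i + 4 * k)" for i
  define f where "f i = (if i < M then i else i + M + 2 * k)" for i
  define g where "g i = (if i < M then M + i else i + M + 2 * k)" for i
  \<comment> \<open>Either the verifying run advances while the pair stays fixed, or that run
    accepts, the old \<open>ys\<close> becomes the new \<open>xs\<close>, and a new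
    \<open>ys\<close> is guessed along with a new initial state.\<close>
  define \<psi> where "\<psi> G u \<longleftrightarrow>
      ((\<forall>i<k + k. u (m + i) = u (M + m + i)) \<and> \<phi> G (\<lambda>i. u (s i)))
    \<or> (F G (\<lambda>i. u (f i)) \<and> (\<forall>i<k. u (m + k + i) = u (M + m + i)) \<and> I G (\<lambda>i. u (g i)))"
    for G and u :: "nat \<Rightarrow> nat"
  show ?thesis
  proof (rule DefI)
    show "Qf (\<lambda>G u. I G (\<lambda>i. u (r i)) \<and> (\<forall>i<k. u (m + i) = u (M + i)))"
      by (intro Qf_conj Qf_ren[OF Q(1)] Qf_all_less Qf_eq)
    show "Qf \<psi>" unfolding \<psi>_def
      by (intro Qf_disj Qf_conj Qf_all_less Qf_eq Qf_ren[OF Q(1)] Qf_ren[OF Q(2)] Qf_ren[OF Q(3)])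
    show "Qf (\<lambda>G u. F G (\<lambda>i. u (r i)) \<and> (\<forall>i<k. u (m + k + i) = u (M + (k + i))))"
      by (intro Qf_conj Qf_ren[OF Q(3)] Qf_all_less Qf_eq)
    fix G and w :: "nat \<Rightarrow> nat" assume Gw: "ok G" "\<forall>i. w i < big G"
    define v where "v i = w (2 * k + i)" for i
    define A where "A = map w [0..<k]"
    define B where "B = map w [k..<k + k]"
    define R where "R xs ys \<longleftrightarrow> xs \<in> T G k \<and> ys \<in> T G k \<and> P G (cat xs (cat ys v))" for xs ys
    have AB: "A \<in> T G k" "B \<in> T G k" using Gw unfolding A_def B_def T_def by auto
    have vbd: "\<forall>i. v i < big G" using Gw v_def by simp
    have R_iff: "R xs ys \<longleftrightarrow> (\<exists>a b. a \<in> T G m \<and> b \<in> T G m \<and> I G (cat a (cat xs (cat ys v)))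
        \<and> (path G \<phi> m (cat xs (cat ys v)))\<^sup>*\<^sup>* a b \<and> F G (cat b (cat xs (cat ys v))))"
      if "xs \<in> T G k" "ys \<in> T G k" for xs ys
      unfolding R_def using representsD[OF Q(4) Gw(1)] that vbd cat_bd by simp
    have I_iff: "I G (\<lambda>i. cat (a @ xs @ ys) w (r i)) \<longleftrightarrow> I G (cat a (cat xs (cat ys v)))"
      "F G (\<lambda>i. cat (a @ xs @ ys) w (r i)) \<longleftrightarrow> F G (cat a (cat xs (cat ys v)))"
      if t: "a \<in> T G m" "xs \<in> T G k" "ys \<in> T G k" for a xs ys
    proof -
      note len = t[THEN T_length]
      have "(\<lambda>i. cat (a @ xs @ ys) w (r i)) = cat (a @ xs @ ys) v"
        using len by (intro ext) (auto simp: cat_def r_def M_def v_def intro!: arg_cong[of _ _ w])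
      then show "I G (\<lambda>i. cat (a @ xs @ ys) w (r i)) \<longleftrightarrow> I G (cat a (cat xs (cat ys v)))"
        "F G (\<lambda>i. cat (a @ xs @ ys) w (r i)) \<longleftrightarrow> F G (cat a (cat xs (cat ys v)))"
        by (simp_all add: cat_append)
    qed
    have eqA: "(\<forall>i<k. cat (a @ xs @ ys) w (m + i) = cat (a @ xs @ ys) w (M + i)) \<longleftrightarrow> xs = A"
      and eqB: "(\<forall>i<k. cat (a @ xs @ ys) w (m + k + i) = cat (a @ xs @ ys) w (M + (k + i))) \<longleftrightarrow> ys = B"
      if t: "a \<in> T G m" "xs \<in> T G k" "ys \<in> T G k" for a xs ys
    proof -
      note len = t[THEN T_length]
      show "(\<forall>i<k. cat (a @ xs @ ys) w (m + i) = cat (a @ xs @ ys) w (M + i)) \<longleftrightarrow> xs = A"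
        unfolding A_def using upt_map_eq_iff[OF len(2), of w 0] len
        by (simp add: cat_def nth_append M_def)
      show "(\<forall>i<k. cat (a @ xs @ ys) w (m + k + i) = cat (a @ xs @ ys) w (M + (k + i))) \<longleftrightarrow> ys = B"
        unfolding B_def using upt_map_eq_iff[OF len(3), of w k] len
        by (simp add: cat_def nth_append M_def add.assoc)
    qed
    have st: "path G \<psi> M w (a @ xs @ ys) (a' @ xs' @ ys') \<longleftrightarrow>
        (xs = xs' \<and> ys = ys' \<and> path G \<phi> m (cat xs (cat ys v)) a a')
      \<or> (F G (cat a (cat xs (cat ys v))) \<and> xs' = ys \<and> I G (cat a' (cat xs' (cat ys' v))))"
      if t: "a \<in> T G m" "xs \<in> T G k" "ys \<in> T G k" "a' \<in> T G m" "xs' \<in> T G k" "ys' \<in> T G k"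
      for a xs ys a' xs' ys'
    proof -
      note len = t[THEN T_length]
      let ?u = "cat (a @ xs @ ys) (cat (a' @ xs' @ ys') w)"
      have "(\<forall>i<k + k. ?u (m + i) = ?u (M + m + i)) \<longleftrightarrow> (\<forall>i<k + k. (xs @ ys) ! i = (xs' @ ys') ! i)"
        using len by (simp add: cat_def nth_append M_def)
      also have "\<dots> \<longleftrightarrow> xs @ ys = xs' @ ys'" using len by (simp add: list_eq_iff_nth_eq)
      finally have 1: "(\<forall>i<k + k. ?u (m + i) = ?u (M + m + i)) \<longleftrightarrow> xs = xs' \<and> ys = ys'"
        using len by simp
      have "(\<forall>i<k. ?u (m + k + i) = ?u (M + m + i)) \<longleftrightarrow> (\<forall>i<k. ys ! i = xs' ! i)"
        using len by (simp add: cat_def nth_append M_def)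
      then have 2: "(\<forall>i<k. ?u (m + k + i) = ?u (M + m + i)) \<longleftrightarrow> xs' = ys"
        using len by (auto simp: list_eq_iff_nth_eq)
      have "?u (s i) = cat (a @ a' @ xs @ ys) v i" if "xs = xs' \<and> ys = ys'" for i
      proof -
        consider "i < m" | "m \<le> i" "i < 2 * m" | "2 * m \<le> i" "i < 2 * m + 2 * k" | "2 * m + 2 * k \<le> i"
          by linarith
        then show ?thesis
          by cases (use len in \<open>auto simp: cat_def s_def nth_append M_def v_def intro!: arg_cong[of _ _ w]
              arg_cong[of _ _ "nth xs"] arg_cong[of _ _ "nth ys"]\<close>)
      qed
      then have 3: "(\<lambda>i. ?u (s i)) = cat a (cat a' (cat xs (cat ys v)))" if "xs = xs' \<and> ys = ys'"
        using that by (auto simp: cat_append)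
      have "(\<lambda>i. ?u (f i)) = cat (a @ xs @ ys) v" "(\<lambda>i. ?u (g i)) = cat (a' @ xs' @ ys') v"
        using len by (auto simp: cat_def f_def g_def M_def v_def intro!: ext arg_cong[of _ _ w])
      then have 4: "(\<lambda>i. ?u (f i)) = cat a (cat xs (cat ys v))" "(\<lambda>i. ?u (g i)) = cat a' (cat xs' (cat ys' v))"
        by (simp_all add: cat_append)
      have "a @ xs @ ys \<in> T G M" "a' @ xs' @ ys' \<in> T G M"
        unfolding M_def using t by (intro T_append; simp)+
      then show ?thesis unfolding path_def \<psi>_def 1 2 4 using 3 t by auto
    qed
    have T3: "\<exists>a xs ys. e = a @ xs @ ys \<and> a \<in> T G m \<and> xs \<in> T G k \<and> ys \<in> T G k" if "e \<in> T G M" for e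
      using that unfolding M_def by (metis T_split)
    have T3': "a @ xs @ ys \<in> T G M" if "a \<in> T G m" "xs \<in> T G k" "ys \<in> T G k" for a xs ys
      unfolding M_def using that by (intro T_append)
    have run: "(path G \<psi> M w)\<^sup>*\<^sup>* (a @ xs @ ys) (b @ xs @ ys)"
      if "(path G \<phi> m (cat xs (cat ys v)))\<^sup>*\<^sup>* a b" "a \<in> T G m" "xs \<in> T G k" "ys \<in> T G k" for a b xs ys
      using that
    proof (induction rule: converse_rtranclp_induct)
      case (step a a')
      then have "a' \<in> T G m" unfolding path_def by blast
      then have "path G \<psi> M w (a @ xs @ ys) (a' @ xs @ ys)" using step st[of a xs ys a' xs ys] by simp
      then show ?case using step \<open>a' \<in> T G m\<close> by (metis converse_rtranclp_into_rtranclp)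
    qed simp
    have sound: "R\<^sup>+\<^sup>+ A B" if e: "a \<in> T G m" "ys \<in> T G k" "I G (cat a (cat A (cat ys v)))"
        "(path G \<psi> M w)\<^sup>*\<^sup>* (a @ A @ ys) (b @ xs @ B)" "b \<in> T G m" "xs \<in> T G k" "F G (cat b (cat xs (cat B v)))"
      for a b xs ys
    proof -
      \<comment> \<open>Invariant: \<open>xs\<close> has been reached from \<open>A\<close> by
        verified pairs, and the run that verifies the current pair has come from some initial state
        to \<open>b\<close>.\<close>
      have "\<exists>b xs ys a0. e = b @ xs @ ys \<and> b \<in> T G m \<and> xs \<in> T G k \<and> ys \<in> T G k \<and> R\<^sup>*\<^sup>* A xs \<and>
          a0 \<in> T G m \<and> I G (cat a0 (cat xs (cat ys v))) \<and> (path G \<phi> m (cat xs (cat ys v)))\<^sup>*\<^sup>* a0 b"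
        if "(path G \<psi> M w)\<^sup>*\<^sup>* (a @ A @ ys) e" for e
        using that
      proof induction
        case base
        then show ?case using e AB by blast
      next
        case (step e e')
        then obtain b xs ys a0 where b: "e = b @ xs @ ys" "b \<in> T G m" "xs \<in> T G k" "ys \<in> T G k"
          "R\<^sup>*\<^sup>* A xs" "a0 \<in> T G m" "I G (cat a0 (cat xs (cat ys v)))"
          "(path G \<phi> m (cat xs (cat ys v)))\<^sup>*\<^sup>* a0 b" by blast
        have "e' \<in> T G M" using step unfolding path_def by blast
        then obtain b' xs' ys' where b': "e' = b' @ xs' @ ys'" "b' \<in> T G m" "xs' \<in> T G k" "ys' \<in> T G k"
          using T3 by blast
        from step(2) consider "xs = xs'" "ys = ys'" "path G \<phi> m (cat xs (cat ys v)) b b'"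
          | "F G (cat b (cat xs (cat ys v)))" "xs' = ys" "I G (cat b' (cat xs' (cat ys' v)))"
          using st[of b xs ys b' xs' ys'] b b' by auto
        then show ?case
        proof cases
          case 1
          have "(path G \<phi> m (cat xs (cat ys v)))\<^sup>*\<^sup>* a0 b'" using b(8) 1(3) by (rule rtranclp.rtrancl_into_rtrancl)
          then show ?thesis using b b' 1 by blast
        next
          case 2
          have "R xs ys" using R_iff b 2(1) by blast
          then have "R\<^sup>*\<^sup>* A xs'" unfolding 2(2) by (rule rtranclp.rtrancl_into_rtrancl[OF b(5)])
          then show ?thesis using b' 2(3) by blast
        qed
      qed
      from this[OF e(4)] obtain b' xs' ys' a0 where b': "b @ xs @ B = b' @ xs' @ ys'" "b' \<in> T G m" "xs' \<in> T G k"
        "ys' \<in> T G k" "R\<^sup>*\<^sup>* A xs'" "a0 \<in> T G m" "I G (cat a0 (cat xs' (cat ys' v)))"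
        "(path G \<phi> m (cat xs' (cat ys' v)))\<^sup>*\<^sup>* a0 b'" by blast
      have eq: "b = b'" "xs = xs'" "B = ys'" using b'(1-4) e(5,6) AB T_length by auto
      then have "R xs B" using R_iff[OF e(6) AB(2)] b' e(5,7) by blast
      then show ?thesis using b'(5) eq by (metis rtranclp_into_tranclp1)
    qed
    have complete: "\<exists>a ys b xs. a \<in> T G m \<and> ys \<in> T G k \<and> b \<in> T G m \<and> xs \<in> T G k \<and> C \<in> T G k
        \<and> I G (cat a (cat A (cat ys v))) \<and> (path G \<psi> M w)\<^sup>*\<^sup>* (a @ A @ ys) (b @ xs @ C)
        \<and> F G (cat b (cat xs (cat C v)))" if "R\<^sup>+\<^sup>+ A C" for C
      using that
    proof induction
      case (base C)
      then have "C \<in> T G k" unfolding R_def by blast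
      moreover from this base obtain a b where "a \<in> T G m" "b \<in> T G m" "I G (cat a (cat A (cat C v)))"
        "(path G \<phi> m (cat A (cat C v)))\<^sup>*\<^sup>* a b" "F G (cat b (cat A (cat C v)))"
        using R_iff AB by blast
      ultimately show ?case using run[of A C a b] AB by blast
    next
      case (step C C')
      then obtain a ys b xs where a: "a \<in> T G m" "ys \<in> T G k" "b \<in> T G m" "xs \<in> T G k" "C \<in> T G k"
        "I G (cat a (cat A (cat ys v)))" "(path G \<psi> M w)\<^sup>*\<^sup>* (a @ A @ ys) (b @ xs @ C)"
        "F G (cat b (cat xs (cat C v)))" by blast
      have C': "C' \<in> T G k" using step unfolding R_def by blast
      with step(2) a(5) obtain a' b' where a': "a' \<in> T G m" "b' \<in> T G m" "I G (cat a' (cat C (cat C' v)))"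
        "(path G \<phi> m (cat C (cat C' v)))\<^sup>*\<^sup>* a' b'" "F G (cat b' (cat C (cat C' v)))"
        using R_iff by blast
      have "path G \<psi> M w (b @ xs @ C) (a' @ C @ C')"
        using st[of b xs C a' C C'] a a' C' by blast
      then have "(path G \<psi> M w)\<^sup>*\<^sup>* (a @ A @ ys) (b' @ C @ C')"
        using run[of C C' a' b'] a a' C' by (meson converse_rtranclp_into_rtranclp rtranclp_trans)
      then show ?case using a a' C' by blast
    qed
    have R_eq: "R = (\<lambda>xs ys. xs \<in> T G k \<and> ys \<in> T G k \<and> P G (cat xs (cat ys (\<lambda>i. w (2 * k + i)))))"
      unfolding R_def v_def by (rule refl)
    show "(\<lambda>xs ys. xs \<in> T G k \<and> ys \<in> T G k \<and> P G (cat xs (cat ys (\<lambda>i. w (2 * k + i)))))\<^sup>+\<^sup>+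
        (map w [0..<k]) (map w [k..<k + k]) \<longleftrightarrow> (\<exists>e f. e \<in> T G M \<and> f \<in> T G M \<and>
          (I G (\<lambda>i. cat e w (r i)) \<and> (\<forall>i<k. cat e w (m + i) = cat e w (M + i))) \<and>
          (path G \<psi> M w)\<^sup>*\<^sup>* e f \<and>
          F G (\<lambda>i. cat f w (r i)) \<and> (\<forall>i<k. cat f w (m + k + i) = cat f w (M + (k + i))))"
      (is "?L \<longleftrightarrow> (\<exists>e f. ?X e f)")
    proof
      assume ?L
      then have "R\<^sup>+\<^sup>+ A B" unfolding R_eq A_def B_def .
      from complete[OF this] obtain a ys b xs where a: "a \<in> T G m" "ys \<in> T G k" "b \<in> T G m" "xs \<in> T G k"
        "I G (cat a (cat A (cat ys v)))" "(path G \<psi> M w)\<^sup>*\<^sup>* (a @ A @ ys) (b @ xs @ B)"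
        "F G (cat b (cat xs (cat B v)))" by blast
      then have "?X (a @ A @ ys) (b @ xs @ B)" using T3' AB I_iff eqA eqB by simp
      then show "\<exists>e f. ?X e f" by blast
    next
      assume "\<exists>e f. ?X e f"
      then obtain e f where ef: "?X e f" by blast
      then obtain a xs ys b xs' ys' where a: "e = a @ xs @ ys" "a \<in> T G m" "xs \<in> T G k" "ys \<in> T G k"
        and b: "f = b @ xs' @ ys'" "b \<in> T G m" "xs' \<in> T G k" "ys' \<in> T G k" using T3 by metis
      have "xs = A" "ys' = B" using ef eqA eqB a b by blast+
      then have "R\<^sup>+\<^sup>+ A B" using sound[of a ys b xs'] ef a b I_iff by simp
      then show ?L unfolding R_eq A_def B_def .
    qed
  qed
qed

text \<open>Equality of the two lists is quantifier-free and is added as a disjunct to cover length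
  zero. The lists of variables are arbitrary; a renaming moves them to the consecutive positions of
  \<open>Def_tranclp\<close>.\<close>

lemma Def_rtranclp:
  assumes "Def (\<lambda>G v. P G (\<lambda>i. v (2 * k + i)) (map v [0..<k]) (map v [k..<k + k]))"
    and len: "length is = k" "length js = k"
  shows "Def (\<lambda>G v. (\<lambda>xs ys. xs \<in> T G k \<and> ys \<in> T G k \<and> P G v xs ys)\<^sup>*\<^sup>* (map v is) (map v js))"
proof -
  let ?\<rho> = "cat (is @ js) (\<lambda>i. i)"
  have m: "map (\<lambda>i. v (?\<rho> i)) [0..<k] = map v is" "map (\<lambda>i. v (?\<rho> i)) [k..<k + k] = map v js"
    "(\<lambda>i. v (?\<rho> (2 * k + i))) = v" for v :: "nat \<Rightarrow> nat"
    using len by (auto simp: cat_def nth_append list_eq_iff_nth_eq)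
  have c: "map (cat xs (cat ys v)) [0..<k] = xs" "map (cat xs (cat ys v)) [k..<k + k] = ys"
    "(\<lambda>i. cat xs (cat ys v) (2 * k + i)) = v"
    if "xs \<in> T G k" "ys \<in> T G k" for xs ys v G
    using that[THEN T_length] by (auto simp: cat_def nth_append list_eq_iff_nth_eq)
  have "Def (\<lambda>G v. (\<lambda>xs ys. xs \<in> T G k \<and> ys \<in> T G k \<and> P G v xs ys)\<^sup>+\<^sup>+ (map v is) (map v js))"
    using Def_ren[OF Def_tranclp[OF assms(1), of k], of ?\<rho>] unfolding m
    by (rule Def_cong[rotated]) (auto simp: c cong: conj_cong)
  moreover have "Def (\<lambda>G v. \<forall>i<k. v (is ! i) = v (js ! i))"
    by (intro Def_Qf Qf_all_less Qf_eq)
  ultimately have "Def (\<lambda>G v. (\<forall>i<k. v (is ! i) = v (js ! i)) \<or>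
      (\<lambda>xs ys. xs \<in> T G k \<and> ys \<in> T G k \<and> P G v xs ys)\<^sup>+\<^sup>+ (map v is) (map v js))"
    by (intro Def_disj)
  then show ?thesis
  proof (rule Def_cong[rotated])
    fix G and v :: "nat \<Rightarrow> nat"
    have "map v is = map v js \<longleftrightarrow> (\<forall>i<k. v (is ! i) = v (js ! i))"
      using len by (simp add: list_eq_iff_nth_eq)
    then show "(\<lambda>xs ys. xs \<in> T G k \<and> ys \<in> T G k \<and> P G v xs ys)\<^sup>*\<^sup>* (map v is) (map v js) \<longleftrightarrow>
      (\<forall>i<k. v (is ! i) = v (js ! i)) \<or>
      (\<lambda>xs ys. xs \<in> T G k \<and> ys \<in> T G k \<and> P G v xs ys)\<^sup>+\<^sup>+ (map v is) (map v js)"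
      using rtranclpD tranclp_into_rtranclp by (metis (mono_tags, lifting) rtranclp.rtrancl_refl)
  qed
qed

end

section \<open>Definable arithmetic\<close>

lemma cat_map: "cat (map v is) (\<lambda>i. v (\<rho> i)) = (\<lambda>i. v (cat is \<rho> i))"
  by (rule ext) (simp add: cat_def)

lemma cat_single_map: "cat [v k] (\<lambda>i. v (\<rho> i)) = (\<lambda>i. v (cat [k] \<rho> i))"
  using cat_map[of v "[k]" \<rho>] by simp

context definability
begin

named_theorems def_intros

lemmas [def_intros] = Def_conj Def_disj Def_ex

lemma Def_eq [def_intros]: "Def (\<lambda>G v. v i = v j)"
  and Def_suc [def_intros]: "Def (\<lambda>G v. v i = Suc (v j))"
  and Def_small [def_intros]: "Def (\<lambda>G v. v i < sz G)"
  and Def_top [def_intros]: "Def (\<lambda>G v. v i = sz G - 1)"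
  by (rule Def_Qf Qf_eq Qf_suc Qf_small Qf_top)+

lemma Def_num [def_intros]: "c < n0 \<Longrightarrow> Def (\<lambda>G v. v i = c)"
  and Def_not_num [def_intros]: "c < n0 \<Longrightarrow> Def (\<lambda>G v. v i \<noteq> c)"
  by (intro Def_Qf Qf_num Qf_not; assumption)+

lemma num_big: "ok G \<Longrightarrow> c < n0 \<Longrightarrow> c < big G"
  using big_gt[of G c] unfolding ok_def by simp

text \<open>The factor leaves room for doubling a power of two below \<open>sz G\<close>, which the
  test for \<open>bitlen\<close> does.\<close>

lemma sz_big: "ok G \<Longrightarrow> 3 * sz G \<le> big G"
proof -
  assume "ok G"
  then have n: "3 \<le> sz G" by (rule ok_sz)
  then have "sz G ^ 2 \<le> sz G ^ K" using K by (intro power_increasing) auto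
  moreover have "3 * sz G \<le> sz G ^ 2" using n by (simp add: power2_eq_square)
  ultimately show ?thesis unfolding big_def by simp
qed

text \<open>The pairs \<open>(x, f x)\<close> are what can be reached from \<open>(0, f 0)\<close>
  by the step \<open>S\<close>. Monotonicity guarantees that no intermediate value exceeds the last
  one, so if the result fits below \<open>big G\<close>, the whole run does.\<close>

lemma Def_iter:
  assumes zero: "Def (\<lambda>G v. v 0 = f G (\<lambda>i. v (Suc i)) 0)"
    and step: "Def (\<lambda>G v. S G (\<lambda>i. v (i + 3)) (v 0) (v 1) (v 2))"
    and mono: "\<And>G v x. ok G \<Longrightarrow> \<forall>i. v i < big G \<Longrightarrow> f G v x \<le> f G v (Suc x)"
    and S: "\<And>G v x s'. ok G \<Longrightarrow> \<forall>i. v i < big G \<Longrightarrow> x < big G \<Longrightarrow> f G v x < big G \<Longrightarrow> s' < big G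
      \<Longrightarrow> S G v x (f G v x) s' \<longleftrightarrow> s' = f G v (Suc x)"
  shows "Def (\<lambda>G v. f G v (v i) = v j)"
proof -
  let ?P = "\<lambda>G v xs ys. ys ! 0 = Suc (xs ! 0) \<and> S G v (xs ! 0) (xs ! 1) (ys ! 1)"
  let ?R = "\<lambda>G v xs ys. xs \<in> T G 2 \<and> ys \<in> T G 2 \<and> ?P G v xs ys"
  have "Def (\<lambda>G v. v 2 = Suc (v 0) \<and> S G (\<lambda>i. v (i + 6)) (v 0) (v 1) (v 3))"
    using Def_ren[OF step, of "\<lambda>i. if i = 0 then 0 else if i = 1 then 1 else if i = 2 then 3 else i + 3"]
    by (intro def_intros) (simp add: numeral_eq_Suc)
  then have "Def (\<lambda>G v. ?P G (\<lambda>i. v (Suc (Suc (2 * 2 + i)))) (map v [0..<2]) (map v [2..<2 + 2]))"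
    by (simp add: numeral_eq_Suc add.commute[of _ "_::nat"])
  \<comment> \<open>Since \<open>z\<close> is guessed before \<open>s\<close>, under both
    quantifiers \<open>s\<close> is variable 0, \<open>z\<close> is variable 1, and the parameters
    have moved up by two.\<close>
  then have "Def (\<lambda>G v. (\<lambda>xs ys. xs \<in> T G 2 \<and> ys \<in> T G 2 \<and> ?P G (\<lambda>i. v (Suc (Suc i))) xs ys)\<^sup>*\<^sup>*
     (map v [1, 0]) (map v [Suc (Suc i), Suc (Suc j)]))"
    by (intro Def_rtranclp) simp_all
  moreover have "Def (\<lambda>G v. v 0 = 0)" "Def (\<lambda>G v. v 0 = f G (\<lambda>i. v (Suc (Suc i))) 0)"
    using Def_num[of 0] n0 Def_ren[OF zero, of "\<lambda>i. if i = 0 then 0 else Suc i"] by simp_all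
  ultimately have "Def (\<lambda>G v. \<exists>z<big G. z = 0 \<and> (\<exists>s<big G. s = f G v 0 \<and> (?R G v)\<^sup>*\<^sup>* [z, s] [v i, v j]))"
    by (intro Def_ex Def_conj) simp_all
  then show ?thesis
  proof (rule Def_cong[rotated])
    fix G and v :: "nat \<Rightarrow> nat" assume Gv: "ok G" "\<forall>i. v i < big G"
    have mono': "f G v x \<le> f G v y" if "x \<le> y" for x y
      using lift_Suc_mono_le[of "f G v", OF mono[OF Gv] that] .
    define R where "R = ?R G v"
    have sound: "ys = [ys ! 0, f G v (ys ! 0)]" if "R\<^sup>*\<^sup>* [0, f G v 0] ys" for ys
      using that
    proof induction
      case (step xs ys)
      then have T: "xs \<in> T G 2" "ys \<in> T G 2" and st: "ys ! 0 = Suc (xs ! 0)" "S G v (xs ! 0) (xs ! 1) (ys ! 1)"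
        unfolding R_def by auto
      have xs: "xs ! 1 = f G v (xs ! 0)" using step.IH by (metis nth_Cons_0 nth_Cons_Suc One_nat_def)
      have "ys ! 1 = f G v (Suc (xs ! 0))"
        using S[OF Gv, of "xs ! 0" "ys ! 1"] st(2) T_nth[OF T(1), of 0] T_nth[OF T(1), of 1]
          T_nth[OF T(2), of 1] xs by simp
      then show ?case using st(1) T_length[OF T(2)]
        by (auto simp: list_eq_iff_nth_eq less_Suc_eq numeral_2_eq_2)
    qed simp
    have complete: "R\<^sup>*\<^sup>* [0, f G v 0] [x, f G v x]" if "x < big G" "f G v x < big G" for x
      using that
    proof (induction x)
      case 0
      show ?case by simp
    next
      case (Suc x)
      have fx: "f G v x < big G" using mono'[of x "Suc x"] Suc.prems by simp
      have "R [x, f G v x] [Suc x, f G v (Suc x)]"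
        unfolding R_def using Suc.prems fx S[OF Gv, of x "f G v (Suc x)"] by (simp add: T_def)
      then show ?case by (rule rtranclp.rtrancl_into_rtrancl[OF Suc.IH[OF Suc_lessD[OF Suc.prems(1)] fx]])
    qed
    have "f G v (v i) = v j \<longleftrightarrow> (\<exists>z<big G. z = 0 \<and> (\<exists>s<big G. s = f G v 0 \<and> R\<^sup>*\<^sup>* [z, s] [v i, v j]))"
    proof
      assume eq: "f G v (v i) = v j"
      have "f G v 0 < big G" using mono'[of 0 "v i"] eq Gv(2)[rule_format, of j] by simp
      moreover have "R\<^sup>*\<^sup>* [0, f G v 0] [v i, v j]" using complete[of "v i"] eq Gv(2) by simp
      ultimately show "\<exists>z<big G. z = 0 \<and> (\<exists>s<big G. s = f G v 0 \<and> R\<^sup>*\<^sup>* [z, s] [v i, v j])"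
        using big_pos[OF Gv(1)] by blast
    next
      assume "\<exists>z<big G. z = 0 \<and> (\<exists>s<big G. s = f G v 0 \<and> R\<^sup>*\<^sup>* [z, s] [v i, v j])"
      then have "R\<^sup>*\<^sup>* [0, f G v 0] [v i, v j]" by blast
      from sound[OF this] show "f G v (v i) = v j" by simp
    qed
    then show "f G v (v i) = v j \<longleftrightarrow> (\<exists>z<big G. z = 0 \<and> (\<exists>s<big G. s = f G v 0 \<and> (?R G v)\<^sup>*\<^sup>* [z, s] [v i, v j]))"
      unfolding R_def .
  qed
qed

section \<open>Addition, multiplication, powers, order and division\<close>

lemma Def_plus [def_intros]: "Def (\<lambda>G v. v i + v j = v k)"
proof (rule Def_iter[where f = "\<lambda>G v x. v i + x" and S = "\<lambda>G v x s s'. s' = Suc s"])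
  show "Def (\<lambda>G v. v 0 = v (Suc i) + 0)" using Def_eq by simp
  show "Def (\<lambda>G v. v 2 = Suc (v 1))" by (intro def_intros)
qed auto

lemma Def_times [def_intros]: "Def (\<lambda>G v. v i * v j = v k)"
proof (rule Def_iter[where f = "\<lambda>G v x. v i * x" and S = "\<lambda>G v x s s'. v i + s = s'"])
  show "Def (\<lambda>G v. v 0 = v (Suc i) * 0)" using Def_num n0 by simp
  show "Def (\<lambda>G v. v (i + 3) + v 1 = v 2)" by (intro def_intros)
qed auto

text \<open>Base 0 is set aside because \<open>0 ^ x\<close> drops from 1 to 0, against the
  monotonicity that \<open>Def_iter\<close> requires.\<close>

lemma Def_pow: "Def (\<lambda>G v. v i \<noteq> 0 \<and> v i ^ v j = v k)"
proof -
  have "Def (\<lambda>G v. (if v i = 0 then 1 else v i ^ v j) = v k)"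
  proof (rule Def_iter[where f = "\<lambda>G v x. if v i = 0 then 1 else v i ^ x"
      and S = "\<lambda>G v x s s'. (v i = 0 \<and> s' = 1) \<or> (v i \<noteq> 0 \<and> v i * s = s')"])
    have "Def (\<lambda>G v. v 0 = 1)" using Def_num n0 by simp
    then show "Def (\<lambda>G v. v 0 = (if v (Suc i) = 0 then 1 else v (Suc i) ^ 0))"
      by (rule Def_cong[rotated]) simp
    show "Def (\<lambda>G v. (v (i + 3) = 0 \<and> v 2 = 1) \<or> (v (i + 3) \<noteq> 0 \<and> v (i + 3) * v 1 = v 2))"
      using n0 by (intro def_intros) auto
    show "(if v i = 0 then 1 else v i ^ x) \<le> (if v i = 0 then 1 else v i ^ Suc x)" for v :: "nat \<Rightarrow> nat" and x
      by simp
  qed auto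
  then have "Def (\<lambda>G v. v i \<noteq> 0 \<and> (if v i = 0 then 1 else v i ^ v j) = v k)"
    using n0 by (intro def_intros) auto
  then show ?thesis by (rule Def_cong[rotated]) auto
qed

lemma Def_less [def_intros]: "Def (\<lambda>G v. v i < v j)"
proof -
  have "Def (\<lambda>G v. \<exists>d<big G. \<exists>e<big G. v i + d = e \<and> v j = Suc e)" by (intro def_intros)
  then show ?thesis
  proof (rule Def_cong[rotated])
    fix G and v :: "nat \<Rightarrow> nat" assume v: "\<forall>i. v i < big G"
    show "v i < v j \<longleftrightarrow> (\<exists>d<big G. \<exists>e<big G. v i + d = e \<and> v j = Suc e)"
    proof
      assume ij: "v i < v j"
      then have "v j - 1 - v i < big G" "v j - 1 < big G" using v[rule_format, of j] by auto
      then show "\<exists>d<big G. \<exists>e<big G. v i + d = e \<and> v j = Suc e"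
        using ij by (intro exI[of _ "v j - 1 - v i"] conjI exI[of _ "v j - 1"]) auto
    qed auto
  qed
qed

lemma Def_le [def_intros]: "Def (\<lambda>G v. v i \<le> v j)"
  unfolding le_less by (intro def_intros)

lemma Def_sz [def_intros]: "Def (\<lambda>G v. v i = sz G)"
proof -
  have "Def (\<lambda>G v. \<exists>t<big G. t = sz G - 1 \<and> v i = Suc t)" by (intro def_intros)
  then show ?thesis
  proof (rule Def_cong[rotated])
    fix G and v :: "nat \<Rightarrow> nat" assume G: "ok G"
    then have "sz G - 1 < big G" "Suc (sz G - 1) = sz G" using big_gt ok_sz[of G] by auto
    then show "v i = sz G \<longleftrightarrow> (\<exists>t<big G. t = sz G - 1 \<and> v i = Suc t)" by metis
  qed
qed

text \<open>Quotient and remainder are pinned down by existence alone. The product and the remainder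
  are at most \<open>v j\<close>, so bounding the guesses by \<open>big G\<close> loses
  nothing.\<close>

lemma Def_div [def_intros]: "Def (\<lambda>G v. v k \<noteq> 0 \<and> v i = v j div v k)"
proof -
  let ?X = "\<lambda>G v. v k \<noteq> 0 \<and> (\<exists>m<big G. \<exists>l<big G. v i * v k = m \<and> m + l = v j \<and> l < v k)"
  have "Def ?X"
    using n0 by (intro def_intros) auto
  then show ?thesis
  proof (rule Def_cong[rotated])
    fix G and v :: "nat \<Rightarrow> nat" assume v: "\<forall>i. v i < big G"
    have "v i = v j div v k \<longleftrightarrow> (\<exists>m<big G. \<exists>l<big G. v i * v k = m \<and> m + l = v j \<and> l < v k)"
      if "v k \<noteq> 0"
    proof
      assume eq: "v i = v j div v k"
      have "v i * v k \<le> v j" "v j mod v k \<le> v j" "v i * v k + v j mod v k = v j" 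
        unfolding eq by (rule div_times_less_eq_dividend mod_less_eq_dividend div_mult_mod_eq)+
      moreover have "v j < big G" using v by blast
      ultimately show "\<exists>m<big G. \<exists>l<big G. v i * v k = m \<and> m + l = v j \<and> l < v k"
        using that by (intro exI[of _ "v i * v k"] conjI exI[of _ "v j mod v k"]) auto
    next
      assume "\<exists>m<big G. \<exists>l<big G. v i * v k = m \<and> m + l = v j \<and> l < v k"
      then obtain l where "v i * v k + l = v j" "l < v k" by blast
      then show "v i = v j div v k" by (metis add.right_neutral div_less div_mult_self3 that)
    qed
    then show "v k \<noteq> 0 \<and> v i = v j div v k \<longleftrightarrow> ?X G v" by blast
  qed
qed

lemma Def_mod [def_intros]: "Def (\<lambda>G v. v k \<noteq> 0 \<and> v i = v j mod v k)"
proof -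
  let ?X = "\<lambda>G v. \<exists>q<big G. (v k \<noteq> 0 \<and> q = v j div v k) \<and> (\<exists>m<big G. q * v k = m \<and> m + v i = v j)"
  have "Def ?X"
    by (intro def_intros)
  then show ?thesis
  proof (rule Def_cong[rotated])
    fix G and v :: "nat \<Rightarrow> nat" assume v: "\<forall>i. v i < big G"
    have j: "v j < big G" using v by blast
    have q: "v j div v k < big G" using j div_le_dividend[of "v j" "v k"] by (rule le_less_trans[rotated])
    have m: "v j div v k * v k < big G"
      using j div_times_less_eq_dividend[of "v j" "v k"] by (rule le_less_trans[rotated])
    have "v i = v j mod v k \<longleftrightarrow> v j div v k * v k + v i = v j"
      using div_mult_mod_eq[of "v j" "v k"] by linarith
    then show "v k \<noteq> 0 \<and> v i = v j mod v k \<longleftrightarrow> ?X G v"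
      using q m by auto
  qed
qed

section \<open>Definable words\<close>

definition letter :: "nat list \<Rightarrow> nat \<Rightarrow> nat \<Rightarrow> bool" where
  "letter w x c \<longleftrightarrow> x < length w \<and> w ! x = c"

lemma letter_append: "letter (w1 @ w2) x c \<longleftrightarrow> letter w1 x c \<or> (\<exists>t. length w1 + t = x \<and> letter w2 t c)"
proof (cases "x < length w1")
  case True
  then show ?thesis unfolding letter_def by (auto simp: nth_append)
next
  case False
  then obtain t where "x = length w1 + t" by (metis le_Suc_ex not_less)
  then show ?thesis unfolding letter_def by (auto simp: nth_append)
qed

lemma letter_concat_upt: "letter (concat (map g [0..<n])) x c \<longleftrightarrow>
    (\<exists>a<n. \<exists>t. length (concat (map g [0..<a])) + t = x \<and> letter (g a) t c)"
  by (induction n) (auto simp: letter_append less_Suc_eq, auto simp: letter_def)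

lemma concat_map_concat: "concat (map f (concat xss)) = concat (map (\<lambda>xs. concat (map f xs)) xss)"
  by (induction xss) auto

text \<open>Variable 0 is the length or a position and variable 1 a letter; the parameters of the
  word start at 2. Since variables range below \<open>big G\<close>, a longer word is described only
  on that part, and its length equals no \<open>v 0\<close>.\<close>

definition DefW :: "(ctx \<Rightarrow> (nat \<Rightarrow> nat) \<Rightarrow> nat list) \<Rightarrow> bool" where
  "DefW W \<longleftrightarrow> Def (\<lambda>G v. length (W G (\<lambda>i. v (Suc (Suc i)))) = v 0)
            \<and> Def (\<lambda>G v. letter (W G (\<lambda>i. v (Suc (Suc i)))) (v 0) (v 1))"

lemma DefW_length: assumes "DefW W" shows "Def (\<lambda>G v. length (W G (\<lambda>i. v (\<rho> i))) = v k)"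
  using Def_ren[of _ "cat [k, k] \<rho>", OF assms[unfolded DefW_def, THEN conjunct1]] by (simp add: cat_def)

lemma DefW_letter: assumes "DefW W" shows "Def (\<lambda>G v. letter (W G (\<lambda>i. v (\<rho> i))) (v k) (v l))"
  using Def_ren[of _ "cat [k, l] \<rho>", OF assms[unfolded DefW_def, THEN conjunct2]] by (simp add: cat_def)

lemma DefW_length_cat:
  assumes "DefW W" shows "Def (\<lambda>G v. length (W G (cat [v j] (\<lambda>i. v (\<rho> i)))) = v k)"
  unfolding cat_single_map by (rule DefW_length[OF assms])

lemma DefW_letter_cat:
  assumes "DefW W" shows "Def (\<lambda>G v. letter (W G (cat [v j] (\<lambda>i. v (\<rho> i)))) (v k) (v l))"
  unfolding cat_single_map by (rule DefW_letter[OF assms])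

lemma DefW_ren: "DefW W \<Longrightarrow> DefW (\<lambda>G v. W G (\<lambda>i. v (\<rho> i)))"
  unfolding DefW_def[of "\<lambda>G v. W G (\<lambda>i. v (\<rho> i))"] by (intro conjI DefW_length DefW_letter)

lemma DefW_cong:
  assumes "\<And>G v. ok G \<Longrightarrow> \<forall>i. v i < big G \<Longrightarrow> W G v = W' G v" "DefW W'" shows "DefW W"
  unfolding DefW_def
proof
  show "Def (\<lambda>G v. length (W G (\<lambda>i. v (Suc (Suc i)))) = v 0)"
    by (rule Def_cong[OF _ DefW_length[OF assms(2), of "\<lambda>i. Suc (Suc i)" 0]]) (simp add: assms(1))
  show "Def (\<lambda>G v. letter (W G (\<lambda>i. v (Suc (Suc i)))) (v 0) (v 1))"
    by (rule Def_cong[OF _ DefW_letter[OF assms(2), of "\<lambda>i. Suc (Suc i)" 0 1]]) (simp add: assms(1))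
qed

lemma DefW_append:
  assumes "DefW W1" "DefW W2" shows "DefW (\<lambda>G v. W1 G v @ W2 G v)"
  unfolding DefW_def
proof
  let ?X = "\<lambda>G v. \<exists>a<big G. \<exists>b<big G. length (W1 G (\<lambda>i. v (Suc (Suc i)))) = a
      \<and> length (W2 G (\<lambda>i. v (Suc (Suc i)))) = b \<and> a + b = v 0"
  have "Def ?X"
    by (intro def_intros DefW_length[OF assms(1)] DefW_length[OF assms(2)])
  then show "Def (\<lambda>G v. length (W1 G (\<lambda>i. v (Suc (Suc i))) @ W2 G (\<lambda>i. v (Suc (Suc i)))) = v 0)"
  proof (rule Def_cong[rotated])
    fix G and v :: "nat \<Rightarrow> nat" assume "\<forall>i. v i < big G"
    then have "v 0 < big G" by blast
    then show "length (W1 G (\<lambda>i. v (Suc (Suc i))) @ W2 G (\<lambda>i. v (Suc (Suc i)))) = v 0 \<longleftrightarrow> ?X G v" by auto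
  qed
  let ?X = "\<lambda>G v. letter (W1 G (\<lambda>i. v (Suc (Suc i)))) (v 0) (v 1) \<or>
     (\<exists>a<big G. \<exists>t<big G. length (W1 G (\<lambda>i. v (Suc (Suc i)))) = a \<and> a + t = v 0
        \<and> letter (W2 G (\<lambda>i. v (Suc (Suc i)))) t (v 1))"
  have "Def ?X"
    by (intro def_intros DefW_length[OF assms(1)] DefW_letter[OF assms(1)] DefW_letter[OF assms(2)])
  then show "Def (\<lambda>G v. letter (W1 G (\<lambda>i. v (Suc (Suc i))) @ W2 G (\<lambda>i. v (Suc (Suc i)))) (v 0) (v 1))"
  proof (rule Def_cong[rotated])
    fix G and v :: "nat \<Rightarrow> nat" assume "\<forall>i. v i < big G"
    then have v0: "v 0 < big G" by blast
    have bd: "a < big G \<and> t < big G" if "a + t = v 0" for a t using v0 that by linarith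
    show "letter (W1 G (\<lambda>i. v (Suc (Suc i))) @ W2 G (\<lambda>i. v (Suc (Suc i)))) (v 0) (v 1) \<longleftrightarrow> ?X G v" 
      unfolding letter_append using bd by blast
  qed
qed

text \<open>The offset at which the word with index \<open>v i\<close> starts in a concatenation,
  summed up by iteration. It allows a position to be split into an index and a position inside one
  of the words.\<close>

lemma DefW_prefix:
  assumes "DefW W"
  shows "Def (\<lambda>G v. length (concat (map (\<lambda>a. W G (cat [a] (\<lambda>i. v (\<rho> i)))) [0..<v i])) = v j)"
proof -
  define W' where "W' G w = W G (\<lambda>i. w (cat [0] (\<lambda>i. Suc (\<rho> i)) i))" for G and w :: "nat \<Rightarrow> nat"
  have W': "DefW W'" unfolding W'_def by (rule DefW_ren[OF assms])
  have eq: "W' G (cat [a] v) = W G (cat [a] (\<lambda>i. v (\<rho> i)))" for G a v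
    unfolding W'_def by (intro arg_cong[of _ _ "W G"] ext) (simp add: cat_def)
  have "Def (\<lambda>G v. length (concat (map (\<lambda>a. W' G (cat [a] v)) [0..<v i])) = v j)"
  proof (rule Def_iter[where f = "\<lambda>G v x. length (concat (map (\<lambda>a. W' G (cat [a] v)) [0..<x]))"
      and S = "\<lambda>G v x s s'. \<exists>l<big G. length (W' G (cat [x] v)) = l \<and> s + l = s'"])
    show "Def (\<lambda>G v. v 0 = length (concat (map (\<lambda>a. W' G (cat [a] (\<lambda>i. v (Suc i)))) [0..<0])))"
      using Def_num[of 0 0] n0 by simp
    show "Def (\<lambda>G v. \<exists>l<big G. length (W' G (cat [v 0] (\<lambda>i. v (i + 3)))) = l \<and> v 1 + l = v 2)"
      by (intro def_intros DefW_length_cat[OF W'])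
  qed auto
  then show ?thesis unfolding eq .
qed

lemma DefW_concat_upt:
  assumes "DefW W" shows "DefW (\<lambda>G v. concat (map (\<lambda>a. W G (cat [a] v)) [0..<sz G]))"
  unfolding DefW_def
proof
  have "Def (\<lambda>G v. \<exists>n<big G. n = sz G \<and>
      length (concat (map (\<lambda>a. W G (cat [a] (\<lambda>i. v (Suc (Suc i))))) [0..<n])) = v 0)"
    by (intro def_intros DefW_prefix[OF assms])
  then show "Def (\<lambda>G v. length (concat (map (\<lambda>a. W G (cat [a] (\<lambda>i. v (Suc (Suc i))))) [0..<sz G])) = v 0)"
    by (rule Def_cong[rotated]) (use sz_big ok_sz in \<open>force simp del: length_concat\<close>)
  have "Def (\<lambda>G v. \<exists>a<big G. a < sz G \<and> (\<exists>s<big G.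
      length (concat (map (\<lambda>a. W G (cat [a] (\<lambda>i. v (Suc (Suc i))))) [0..<a])) = s \<and>
      (\<exists>t<big G. s + t = v 0 \<and> letter (W G (cat [a] (\<lambda>i. v (Suc (Suc i))))) t (v 1))))"
    by (intro def_intros DefW_prefix[OF assms] DefW_letter_cat[OF assms])
  then show "Def (\<lambda>G v. letter (concat (map (\<lambda>a. W G (cat [a] (\<lambda>i. v (Suc (Suc i))))) [0..<sz G])) (v 0) (v 1))"
  proof (rule Def_cong[rotated])
    fix G and v :: "nat \<Rightarrow> nat" assume Gv: "ok G" "\<forall>i. v i < big G"
    let ?w = "\<lambda>a. W G (cat [a] (\<lambda>i. v (Suc (Suc i))))"
    have bd: "a < big G" if "a < sz G" for a using big_gt Gv that by blast
    have "v 0 < big G" using Gv by blast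
    then have bd': "s < big G" "t < big G" if "s + t = v 0" for s t using that by auto
    show "letter (concat (map ?w [0..<sz G])) (v 0) (v 1) \<longleftrightarrow> (\<exists>a<big G. a < sz G \<and> (\<exists>s<big G.
      length (concat (map ?w [0..<a])) = s \<and> (\<exists>t<big G. s + t = v 0 \<and> letter (?w a) t (v 1))))"
      unfolding letter_concat_upt using bd bd' by metis
  qed
qed

lemma DefW_tuples:
  assumes "DefW W" shows "DefW (\<lambda>G v. concat (map (\<lambda>t. W G (cat t v)) (tuples (sz G) k)))"
  using assms
proof (induction k arbitrary: W)
  case 0
  then show ?case by (simp add: cat_Nil)
next
  case (Suc k)
  \<comment> \<open>The induction hypothesis concatenates over the tail \<open>t\<close> with the
    first coordinate \<open>a\<close> as leading parameter; \<open>\<rho>\<close> moves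
    \<open>a\<close> from behind \<open>t\<close> to the front.\<close>
  define \<rho> where "\<rho> i = (if i = 0 then k else if i - 1 < k then i - 1 else i)" for i
  define W' where "W' G w = W G (\<lambda>i. w (\<rho> i))" for G and w :: "nat \<Rightarrow> nat"
  have len: "t \<in> set (tuples n k) \<Longrightarrow> length t = k" for t n k
    by (induction k arbitrary: t) auto
  have eq: "W' G (cat t (cat [a] v)) = W G (cat (a # t) v)" if "t \<in> set (tuples (sz G) k)" for G a t v
    unfolding W'_def using len[OF that]
    by (intro arg_cong[of _ _ "W G"] ext) (auto simp: cat_def \<rho>_def nth_Cons split: nat.splits)
  have "DefW W'" unfolding W'_def by (rule DefW_ren[OF Suc.prems])
  then have "DefW (\<lambda>G v. concat (map (\<lambda>t. W' G (cat t v)) (tuples (sz G) k)))" by (rule Suc.IH)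
  from DefW_concat_upt[OF this]
  have "DefW (\<lambda>G v. concat (map (\<lambda>a. concat (map (\<lambda>t. W' G (cat t (cat [a] v))) (tuples (sz G) k))) [0..<sz G]))" .
  then show ?case
    by (rule DefW_cong[rotated]) (simp add: concat_map_concat comp_def eq cong: map_cong)
qed

lemma DefW_single: "c < n0 \<Longrightarrow> DefW (\<lambda>G v. [c])"
  unfolding DefW_def letter_def
  by (rule conjI; rule Def_cong[OF _ Def_conj[OF Def_num[of 0 0] Def_num[of c 1]]] Def_cong[OF _ Def_num[of 1 0]])
    (use n0 in auto)

lemma DefW_Nil: "DefW (\<lambda>G v. [])"
  unfolding DefW_def letter_def
  by (rule conjI; rule Def_cong[OF _ Def_num[of 0 0]] Def_cong[OF _ Def_Qf[OF Qf_const[of False]]])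
    (use n0 in auto)

lemma DefW_concat_list:
  assumes "\<And>r. r \<in> set rs \<Longrightarrow> DefW (W r)" shows "DefW (\<lambda>G v. concat (map (\<lambda>r. W r G v) rs))"
  using assms by (induction rs) (auto intro: DefW_Nil DefW_append)

lemma DefW_bit:
  assumes "Qf P" shows "DefW (\<lambda>G v. [if P G v then 1 else 0])"
  unfolding DefW_def letter_def
proof
  show "Def (\<lambda>G v. length [if P G (\<lambda>i. v (Suc (Suc i))) then 1 else 0::nat] = v 0)"
    by (rule Def_cong[OF _ Def_num[of 1 0]]) (use n0 in auto)
  have "Def (\<lambda>G v. v 0 = 0 \<and> ((P G (\<lambda>i. v (Suc (Suc i))) \<and> v 1 = 1) \<or> (\<not> P G (\<lambda>i. v (Suc (Suc i))) \<and> v 1 = 0)))"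
    using n0 by (intro Def_Qf Qf_conj Qf_disj Qf_not Qf_num Qf_ren[OF assms]) auto
  then show "Def (\<lambda>G v. v 0 < length [if P G (\<lambda>i. v (Suc (Suc i))) then 1 else 0::nat] \<and>
       [if P G (\<lambda>i. v (Suc (Suc i))) then 1 else 0] ! v 0 = v 1)"
    by (rule Def_cong[rotated]) auto
qed

lemma DefW_unary: "DefW (\<lambda>G v. replicate (sz G) 1)"
  unfolding DefW_def letter_def
proof
  show "Def (\<lambda>G v. length (replicate (sz G) (1::nat)) = v 0)"
    by (rule Def_cong[OF _ Def_sz[of 0]]) auto
  show "Def (\<lambda>G v. v 0 < length (replicate (sz G) (1::nat)) \<and> replicate (sz G) 1 ! v 0 = v 1)"
    by (rule Def_cong[OF _ Def_conj[OF Def_small[of 0] Def_num[of 1 1]]]) (use n0 in auto)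
qed

text \<open>The number is guessed and pinned by its definition; \<open>less\<close> ensures that the
  bounded guess can find it.\<close>

lemma DefW_let:
  assumes W: "DefW W" and t: "Def (\<lambda>G v. v 0 = t G (\<lambda>i. v (Suc i)))"
    and less: "\<And>G v. ok G \<Longrightarrow> \<forall>i. v i < big G \<Longrightarrow> t G v < big G"
  shows "DefW (\<lambda>G v. W G (cat [t G v] v))"
  unfolding DefW_def
proof
  have t': "Def (\<lambda>G v. v i = t G (\<lambda>i. v (\<rho> i)))" for i \<rho>
    using Def_ren[OF t, of "cat [i] \<rho>"] by (simp add: cat_def)
  have "Def (\<lambda>G v. \<exists>x<big G. x = t G (\<lambda>i. v (Suc (Suc i))) \<and> length (W G (cat [x] (\<lambda>i. v (Suc (Suc i))))) = v 0)"
    by (intro def_intros t' DefW_length_cat[OF W])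
  then show "Def (\<lambda>G v. length (W G (cat [t G (\<lambda>i. v (Suc (Suc i)))] (\<lambda>i. v (Suc (Suc i))))) = v 0)"
    by (rule Def_cong[rotated]) (use less in auto)
  have "Def (\<lambda>G v. \<exists>x<big G. x = t G (\<lambda>i. v (Suc (Suc i))) \<and> letter (W G (cat [x] (\<lambda>i. v (Suc (Suc i))))) (v 0) (v 1))"
    by (intro def_intros t' DefW_letter_cat[OF W])
  then show "Def (\<lambda>G v. letter (W G (cat [t G (\<lambda>i. v (Suc (Suc i)))] (\<lambda>i. v (Suc (Suc i))))) (v 0) (v 1))"
    by (rule Def_cong[rotated]) (use less in auto)
qed

section \<open>The input word is definable\<close>

text \<open>One-point rules: a guess with a defining equation disappears and leaves only the bound
  that its value has to meet.\<close>

lemma bex_eq: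
  "(\<exists>x<N. x = t \<and> P x) \<longleftrightarrow> t < N \<and> P t" "(\<exists>x<N. t = x \<and> P x) \<longleftrightarrow> t < N \<and> P t"
  "(\<exists>x<N. (A \<and> x = t) \<and> P x) \<longleftrightarrow> A \<and> t < N \<and> P t" "(\<exists>x<N. (A \<and> t = x) \<and> P x) \<longleftrightarrow> A \<and> t < N \<and> P t"
  for t N :: nat
  by auto

text \<open>The condition is upward closed in \<open>w\<close>, so leastness needs a test only at
  the predecessor \<open>u\<close>; \<open>u = 0\<close> passes outright because
  \<open>bitlen\<close> is at least 1.\<close>

lemma bitlen_iff: "w = bitlen n \<longleftrightarrow> (\<exists>u. w = Suc u \<and> n \<le> 2 * 2 ^ u \<and> (u = 0 \<or> 2 ^ u < n))"
proof -
  let ?P = "\<lambda>w. w \<ge> 1 \<and> n \<le> 2 ^ w"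
  have ex: "?P (Suc n)" using less_imp_le[OF less_exp[of "Suc n"]] by simp
  have P: "?P (bitlen n)" unfolding bitlen_def by (rule LeastI[of ?P, OF ex])
  have least: "bitlen n \<le> w" if "?P w" for w unfolding bitlen_def using that by (rule Least_le)
  show ?thesis
  proof
    assume w: "w = bitlen n"
    then obtain u where u: "w = Suc u" using P by (cases "bitlen n") auto
    have "u = 0 \<or> 2 ^ u < n" using least[of u] w u by (cases "n \<le> 2 ^ u") (auto simp: Suc_le_eq)
    moreover have "n \<le> 2 * 2 ^ u" using P[THEN conjunct2] unfolding w[symmetric] u by simp
    ultimately show "\<exists>u. w = Suc u \<and> n \<le> 2 * 2 ^ u \<and> (u = 0 \<or> 2 ^ u < n)"
      using u by (intro exI[of _ u] conjI)
  next
    assume "\<exists>u. w = Suc u \<and> n \<le> 2 * 2 ^ u \<and> (u = 0 \<or> 2 ^ u < n)"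
    then obtain u where u: "w = Suc u" "n \<le> 2 * 2 ^ u" "u = 0 \<or> 2 ^ u < n" by blast
    then have "bitlen n \<le> w" by (intro least) simp
    moreover have "w \<le> bitlen n"
    proof (rule ccontr)
      assume "\<not> w \<le> bitlen n"
      then have "bitlen n \<le> u" using u by simp
      then have "(2::nat) ^ bitlen n \<le> 2 ^ u" by (intro power_increasing) auto
      moreover have "u \<noteq> 0" using \<open>bitlen n \<le> u\<close> P by auto
      ultimately show False using u P by linarith
    qed
    ultimately show "w = bitlen n" by simp
  qed
qed

lemma Def_bitlen [def_intros]: "Def (\<lambda>G v. v i = bitlen (sz G))"
proof -
  let ?X = "\<lambda>G v. \<exists>u<big G. v i = Suc u \<and> (\<exists>b<big G. b = 2 \<and> (\<exists>p<big G. (b \<noteq> 0 \<and> b ^ u = p) \<and>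
    (\<exists>q<big G. p + p = q \<and> (\<exists>n<big G. n = sz G \<and> n \<le> q \<and> (u = 0 \<or> p < n)))))"
  have "Def ?X"
    using n0 by (intro def_intros Def_pow) auto
  then show ?thesis
  proof (rule Def_cong[rotated])
    fix G and v :: "nat \<Rightarrow> nat" assume Gv: "ok G" "\<forall>i. v i < big G"
    have n: "3 \<le> sz G" "3 * sz G \<le> big G" using ok_sz sz_big Gv by auto
    have i: "v i < big G" using Gv by blast
    show "v i = bitlen (sz G) \<longleftrightarrow> ?X G v"
      unfolding bitlen_iff bex_eq
    proof (intro iff_exI)
      fix u
      have "(2::nat) ^ u < sz G" if "u = 0 \<or> 2 ^ u < sz G" using that n by auto
      then show "v i = Suc u \<and> sz G \<le> 2 * 2 ^ u \<and> (u = 0 \<or> 2 ^ u < sz G) \<longleftrightarrow>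
        u < big G \<and> v i = Suc u \<and> 2 < big G \<and> 2 \<noteq> (0::nat) \<and> 2 ^ u < big G \<and>
        2 ^ u + 2 ^ u < big G \<and> sz G < big G \<and> sz G \<le> 2 ^ u + 2 ^ u \<and> (u = 0 \<or> 2 ^ u < sz G)"
        using n i by linarith
    qed
  qed
qed

lemma bitlen_less: assumes "3 \<le> n" shows "2 ^ (bitlen n - 1) < n" "bitlen n \<le> n"
proof -
  obtain u where u: "bitlen n = Suc u" "u = 0 \<or> 2 ^ u < n" using bitlen_iff by blast
  then show "2 ^ (bitlen n - 1) < n" using assms by auto
  then have "bitlen n - 1 < n" by (rule less_trans[OF less_exp])
  then show "bitlen n \<le> n" by simp
qed

text \<open>The most significant bit comes first, so the bit at position \<open>v 0\<close> has
  weight \<open>2 ^ f\<close> with \<open>v 0 + Suc f\<close> equal to the length. It is then read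
  off by a division and a remainder.\<close>

lemma DefW_bin: "DefW (\<lambda>G v. bin (bitlen (sz G)) (v 0))"
  unfolding DefW_def
proof
  show "Def (\<lambda>G v. length (bin (bitlen (sz G)) (v (Suc (Suc 0)))) = v 0)"
    by (rule Def_cong[OF _ Def_bitlen[of 0]]) (auto simp: bin_def)
  let ?X = "\<lambda>G v. \<exists>w<big G. w = bitlen (sz G) \<and> (\<exists>e<big G. \<exists>f<big G. v 0 + e = w \<and> e = Suc f \<and>
     (\<exists>b<big G. b = 2 \<and> (\<exists>p<big G. (b \<noteq> 0 \<and> b ^ f = p) \<and> (\<exists>q<big G. (p \<noteq> 0 \<and> q = v 2 div p) \<and> (b \<noteq> 0 \<and> v 1 = q mod b)))))"
  have "Def ?X"
    using n0 by (intro def_intros Def_pow) auto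
  then show "Def (\<lambda>G v. letter (bin (bitlen (sz G)) (v (Suc (Suc 0)))) (v 0) (v 1))"
  proof (rule Def_cong[rotated])
    fix G and v :: "nat \<Rightarrow> nat" assume Gv: "ok G" "\<forall>i. v i < big G"
    let ?w = "bitlen (sz G)"
    have n: "3 \<le> sz G" "sz G < big G" using ok_sz[OF Gv(1)] sz_big[OF Gv(1)] by auto
    have w: "?w < big G" "(2::nat) ^ (?w - 1) < big G" using bitlen_less[OF n(1)] n(2) by linarith+
    have q: "v 2 div p < big G" for p using Gv(2) div_le_dividend[of "v 2" p] by (metis le_less_trans)
    have 1: "letter (bin ?w (v 2)) (v 0) (v 1) \<longleftrightarrow>
        (\<exists>f. v 0 + Suc f = ?w \<and> v 1 = (v 2 div 2 ^ f) mod 2)"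
    proof (cases "v 0 < ?w")
      case True
      then obtain f where f: "v 0 + Suc f = ?w" by (metis add_Suc_right less_imp_Suc_add)
      then have "?w - 1 - v 0 = f" by simp
      moreover have "v 0 + Suc f' = ?w \<longleftrightarrow> f' = f" for f' using f by linarith
      ultimately show ?thesis using True unfolding letter_def bin_def by auto
    next
      case False
      then show ?thesis unfolding letter_def bin_def by auto
    qed
    show "letter (bin ?w (v (Suc (Suc 0)))) (v 0) (v 1) \<longleftrightarrow> ?X G v"
      unfolding bex_eq 1[unfolded numeral_2_eq_2, folded numeral_2_eq_2]
    proof
      assume "letter (bin ?w (v (Suc (Suc 0)))) (v 0) (v 1)"
      then obtain f where f: "v 0 + Suc f = ?w" "v 1 = (v 2 div 2 ^ f) mod 2"
        using 1 by (metis numeral_2_eq_2)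
      then have "(2::nat) ^ f \<le> 2 ^ (?w - 1)" by (intro power_increasing) auto
      then have "(2::nat) ^ f < big G" "Suc f < big G" "f < big G" using w f by linarith+
      then show "?w < big G \<and> (\<exists>e<big G. \<exists>f<big G. v 0 + e = ?w \<and> e = Suc f \<and> 2 < big G \<and> 2 \<noteq> (0::nat) \<and>
          2 ^ f < big G \<and> 2 ^ f \<noteq> (0::nat) \<and> v 2 div 2 ^ f < big G \<and> 2 \<noteq> (0::nat) \<and> v 1 = v 2 div 2 ^ f mod 2)"
        using f w n q by (intro conjI exI[of _ "Suc f"] exI[of _ f]) auto
    next
      assume "?w < big G \<and> (\<exists>e<big G. \<exists>f<big G. v 0 + e = ?w \<and> e = Suc f \<and> 2 < big G \<and> 2 \<noteq> (0::nat) \<and>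
          2 ^ f < big G \<and> 2 ^ f \<noteq> (0::nat) \<and> v 2 div 2 ^ f < big G \<and> 2 \<noteq> (0::nat) \<and> v 1 = v 2 div 2 ^ f mod 2)"
      then have "\<exists>f. v 0 + Suc f = ?w \<and> v 1 = v 2 div 2 ^ f mod 2" by blast
      then show "letter (bin ?w (v (Suc (Suc 0)))) (v 0) (v 1)"
        using 1 by (metis numeral_2_eq_2)
    qed
  qed
qed

lemma tuples_less: "t \<in> set (tuples n k) \<Longrightarrow> length t = k \<and> (\<forall>x\<in>set t. x < n)"
  by (induction k arbitrary: t) auto

lemma map_cat_upt: "length t = k \<Longrightarrow> map (\<lambda>i. f (cat t v i)) [0..<k] = map f t"
  by (auto simp: cat_def list_eq_iff_nth_eq)

lemma map_eq_concat: "map f xs = concat (map (\<lambda>x. [f x]) xs)"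
  by (induction xs) auto

lemma DefW_enc_rel:
  assumes "r < length (rels L)"
  shows "DefW (\<lambda>G v. map (\<lambda>t. if rel (fst G) r (map (\<lambda>a. snd G ! a) t) then 1 else 0) (tuples (sz G) (rels L ! r)))"
proof -
  let ?k = "rels L ! r"
  let ?P = "\<lambda>G v. (\<forall>i\<in>set [0..<?k]. v i < sz G) \<and> rel (fst G) r (map (\<lambda>i. snd G ! v i) [0..<?k])"
  have "Qf ?P" by (rule Qf_rel) (use assms in auto)
  from DefW_tuples[OF DefW_bit[OF this], of ?k] show ?thesis
  proof (rule DefW_cong[rotated])
    fix G and v :: "nat \<Rightarrow> nat"
    have "[if rel (fst G) r (map (\<lambda>a. snd G ! a) t) then 1 else 0] = [if ?P G (cat t v) then 1 else 0::nat]"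
      if "t \<in> set (tuples (sz G) ?k)" for t
      using tuples_less[OF that] map_cat_upt[of t ?k "\<lambda>a. snd G ! a" v] by (auto simp: cat_def)
    note eq = this
    show "map (\<lambda>t. if rel (fst G) r (map (\<lambda>a. snd G ! a) t) then 1 else 0::nat) (tuples (sz G) ?k)
       = concat (map (\<lambda>t. [if ?P G (cat t v) then 1 else 0]) (tuples (sz G) ?k))"
      by (rule trans[OF map_eq_concat], intro arg_cong[of _ _ concat] map_cong[OF refl], erule eq)
  qed
qed

lemma DefW_enc_cst:
  assumes "c < ncsts L" shows "DefW (\<lambda>G v. bin (bitlen (sz G)) (rank (snd G) (cst (fst G) c)))"
proof -
  have "DefW (\<lambda>G v. bin (bitlen (sz G)) (cat [rank (snd G) (cst (fst G) c)] v 0))"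
  proof (rule DefW_let[OF DefW_bin])
    show "Def (\<lambda>G v. v 0 = rank (snd G) (cst (fst G) c))" by (intro Def_Qf Qf_cst assms)
    show "rank (snd G) (cst (fst G) c) < big G" if "ok G" for G
      using that assms nth_rank(2)[of "fst G" "snd G" "cst (fst G) c"] big_gt[OF that]
      unfolding ok_def is_struc_def by simp
  qed
  then show ?thesis by (simp add: cat_single)
qed

lemma DefW_enc_fn:
  assumes "f < length (funs L)"
  shows "DefW (\<lambda>G v. concat (map (\<lambda>t. bin (bitlen (sz G)) (rank (snd G) (fn (fst G) f (map (\<lambda>a. snd G ! a) t))))
     (tuples (sz G) (funs L ! f))))"
proof -
  let ?k = "funs L ! f"
  let ?S = "\<lambda>G v. \<forall>i\<in>set [0..<?k]. v i < sz G"
  let ?r = "\<lambda>G v. rank (snd G) (fn (fst G) f (map (\<lambda>i. snd G ! v i) [0..<?k]))"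
  \<comment> \<open>A total function with default 0, as \<open>DefW_let\<close> substitutes it for
    arbitrary parameters; on the tuples of the encoding all entries are ranks and the default does
    not occur.\<close>
  let ?t = "\<lambda>G v. if ?S G v then ?r G v else 0"
  have r: "Qf (\<lambda>G v. ?S G (\<lambda>i. v (Suc i)) \<and> v 0 = ?r G (\<lambda>i. v (Suc i)))"
    using Qf_fn[OF assms, of "map Suc [0..<?k]" 0]
    by (simp add: comp_def del: image_Suc_atLeastLessThan)
  have "Qf (\<lambda>G v. \<forall>i<?k. v (Suc i) < sz G)" by (intro Qf_all_less Qf_small)
  then have "Qf (\<lambda>G v. \<not> ?S G (\<lambda>i. v (Suc i)) \<and> v 0 = 0)"
    using n0 by (intro Qf_conj Qf_not Qf_num) (auto elim: Qf_cong[rotated])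
  with r have "Qf (\<lambda>G v. (?S G (\<lambda>i. v (Suc i)) \<and> v 0 = ?r G (\<lambda>i. v (Suc i))) \<or> (\<not> ?S G (\<lambda>i. v (Suc i)) \<and> v 0 = 0))"
    by (rule Qf_disj)
  then have d: "Def (\<lambda>G v. v 0 = ?t G (\<lambda>i. v (Suc i)))"
    by (intro Def_Qf) (auto elim: Qf_cong[rotated])
  have less: "?r G v < sz G" if "ok G" "?S G v" for G v
    by (intro nth_rank ok_order that fn_less assms)
      (use that in \<open>auto intro: nth_order_less ok_order\<close>)
  have "DefW (\<lambda>G v. bin (bitlen (sz G)) (cat [?t G v] v 0))"
  proof (rule DefW_let[OF DefW_bin d])
    show "?t G v < big G" if "ok G" for G v
      using less[OF that] big_gt[OF that] big_pos[OF that] by simp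
  qed
  from DefW_tuples[OF this, of ?k] show ?thesis
  proof (rule DefW_cong[rotated])
    fix G and v :: "nat \<Rightarrow> nat"
    have "rank (snd G) (fn (fst G) f (map (\<lambda>a. snd G ! a) t)) = cat [?t G (cat t v)] (cat t v) 0"
      if "t \<in> set (tuples (sz G) ?k)" for t
      using tuples_less[OF that] map_cat_upt[of t ?k "\<lambda>a. snd G ! a" v]
      by (auto simp: cat_single cat_def)
    then show "concat (map (\<lambda>t. bin (bitlen (sz G)) (rank (snd G) (fn (fst G) f (map (\<lambda>a. snd G ! a) t)))) (tuples (sz G) ?k))
       = concat (map (\<lambda>t. bin (bitlen (sz G)) (cat [?t G (cat t v)] (cat t v) 0)) (tuples (sz G) ?k))"
      by (intro arg_cong[of _ _ concat] map_cong) auto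
  qed
qed

lemma DefW_enc: "DefW (\<lambda>G v. enc L (fst G) (snd G))"
proof -
  have sep: "DefW (\<lambda>G v. [2])" using n0 by (intro DefW_single) simp
  show ?thesis unfolding enc_def Let_def
    by (rule DefW_append[OF DefW_unary] DefW_append[OF sep] DefW_append DefW_concat_list sep
        DefW_append[OF DefW_enc_rel sep] DefW_append[OF DefW_enc_cst sep] DefW_append[OF DefW_enc_fn sep] | simp)+
qed

text \<open>Cell 0 holds the left endmarker 3, so cell \<open>Suc t\<close> holds letter
  \<open>t\<close>, and every cell beyond the word reads as the right endmarker 4.\<close>

lemma Def_inp: "Def (\<lambda>G v. inp (enc L (fst G) (snd G)) (int (v i)) = v j)"
  if "4 < n0"
proof -
  have "Def (\<lambda>G v. (v i = 0 \<and> v j = 3) \<or> (\<exists>t<big G. v i = Suc t \<and> letter (enc L (fst G) (snd G)) t (v j))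
    \<or> (\<exists>m<big G. length (enc L (fst G) (snd G)) = m \<and> m < v i \<and> v j = 4))"
    using that n0 by (intro def_intros DefW_length[OF DefW_enc] DefW_letter[OF DefW_enc]) auto
  then show ?thesis
  proof (rule Def_cong[rotated])
    fix G and v :: "nat \<Rightarrow> nat" assume Gv: "ok G" "\<forall>i. v i < big G"
    let ?w = "enc L (fst G) (snd G)"
    have i: "v i < big G" using Gv by blast
    show "inp ?w (int (v i)) = v j \<longleftrightarrow> (v i = 0 \<and> v j = 3) \<or> (\<exists>t<big G. v i = Suc t \<and> letter ?w t (v j))
      \<or> (\<exists>m<big G. length ?w = m \<and> m < v i \<and> v j = 4)"
    proof (cases "v i")
      case 0
      then show ?thesis unfolding inp_def by auto
    next
      case (Suc t)
      then have "inp ?w (int (v i)) = (if length ?w \<le> t then 4 else ?w ! t)"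
        unfolding inp_def by (auto simp: nat_add_distrib)
      then show ?thesis using Suc i unfolding letter_def by auto
    qed
  qed
qed

end

section \<open>Simulation of the Turing machine\<close>

text \<open>Raising 2 to both sides removes the logarithm and leaves powers of natural numbers,
  whose graphs are definable.\<close>

lemma space_le_iff: "nat (space c m) \<le> s \<longleftrightarrow> (m + 2) ^ c \<le> 2 ^ s"
proof -
  have "nat (space c m) \<le> s \<longleftrightarrow> space c m \<le> int s" by linarith
  also have "\<dots> \<longleftrightarrow> real c * log 2 (real m + 2) \<le> real s"
    unfolding space_def by (simp add: ceiling_le_iff)
  also have "real c * log 2 (real m + 2) = log 2 ((real m + 2) ^ c)"
    by (simp add: log_nat_power)
  also have "\<dots> \<le> real s \<longleftrightarrow> (real m + 2) ^ c \<le> 2 powr real s"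
    by (rule log_le_iff) auto
  also have "\<dots> \<longleftrightarrow> real ((m + 2) ^ c) \<le> real (2 ^ s)"
    by (simp add: powr_realpow add.commute)
  also have "\<dots> \<longleftrightarrow> (m + 2) ^ c \<le> 2 ^ s" by (rule of_nat_le_iff)
  finally show ?thesis .
qed

lemma space_nonneg: "0 \<le> space c m"
proof -
  have "0 \<le> log 2 (real m + 2)" by (simp add: zero_le_log_cancel_iff)
  then have "0 \<le> real c * log 2 (real m + 2)" by simp
  then show ?thesis unfolding space_def by linarith
qed

text \<open>Minimality of \<open>s\<close>: the power \<open>2 ^ s\<close> is large enough and its
  half \<open>h\<close> is not. Speaking of the half avoids a reference to
  \<open>s - 1\<close>.\<close>

lemma space_eq_iff:
  "s = nat (space c m) \<longleftrightarrow> (m + 2) ^ c \<le> 2 ^ s \<and> (s = 0 \<or> (\<exists>h. h + h = 2 ^ s \<and> h < (m + 2) ^ c))"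
proof (cases s)
  case 0
  then show ?thesis using space_le_iff[of c m 0] by auto
next
  case (Suc u)
  have "s = nat (space c m) \<longleftrightarrow> nat (space c m) \<le> s \<and> \<not> nat (space c m) \<le> u" using Suc by linarith
  moreover have "h + h = 2 ^ s \<longleftrightarrow> h = 2 ^ u" for h :: nat unfolding Suc by auto
  ultimately show ?thesis unfolding space_le_iff using Suc by (simp add: not_le)
qed

lemma val_digit:
  assumes "set xs \<subseteq> {..<b}" "j < length xs" shows "val b xs div b ^ j mod b = xs ! j"
  using assms
proof (induction xs arbitrary: j)
  case (Cons x xs)
  then have x: "x < b" by simp
  show ?case
  proof (cases j)
    case (Suc i)
    have "(x + b * val b xs) div b = val b xs" using x by simp
    then show ?thesis using Cons Suc by (simp add: div_mult2_eq)
  qed (use x in simp)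
qed simp

text \<open>The old digit is added on the left instead of being subtracted on the right; the
  equation stays free of truncated subtraction and can be checked by sums.\<close>

lemma val_update: "j < length xs \<Longrightarrow> val b (xs[j := y]) + xs ! j * b ^ j = val b xs + y * b ^ j"
proof (induction xs arbitrary: j)
  case (Cons x xs)
  show ?case
  proof (cases j)
    case (Suc i)
    then have "val b (xs[i := y]) + xs ! i * b ^ i = val b xs + y * b ^ i" using Cons by simp
    then have "b * (val b (xs[i := y]) + xs ! i * b ^ i) = b * (val b xs + y * b ^ i)" by simp
    then show ?thesis using Suc by (simp add: algebra_simps)
  qed simp
qed simp

definition move :: "int \<Rightarrow> nat \<Rightarrow> nat \<Rightarrow> bool" where
  "move d x y \<longleftrightarrow> (d = 0 \<and> y = x) \<or> (d = 1 \<and> y = Suc x) \<or> (d = -1 \<and> x = Suc y)"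

definition scale :: "nat \<Rightarrow> int \<Rightarrow> nat \<Rightarrow> nat \<Rightarrow> bool" where
  "scale B d x y \<longleftrightarrow> (d = 0 \<and> y = x) \<or> (d = 1 \<and> x * B = y) \<or> (d = -1 \<and> y * B = x)"

lemma move_iff: "move d x y \<longleftrightarrow> d \<in> {-1, 0, 1} \<and> int y = int x + d"
  unfolding move_def by auto

text \<open>On powers of \<open>B\<close>, scaling moves the exponent. As \<open>B\<close> is at
  least 2, the number 1 is not a multiple of it, so a left move from cell 0 is excluded without a
  separate test.\<close>

lemma scale_iff:
  assumes "2 \<le> B"
  shows "scale B d (B ^ x) z \<longleftrightarrow> (\<exists>y. z = B ^ y \<and> move d x y)"
proof -
  have 1: "z * B = B ^ x \<longleftrightarrow> (\<exists>y. z = B ^ y \<and> x = Suc y)"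
  proof (cases x)
    case 0
    have "z * B \<noteq> 1" using assms by (cases z) auto
    then show ?thesis using 0 by simp
  next
    case (Suc u)
    then show ?thesis using assms by auto
  qed
  show ?thesis unfolding scale_def move_def 1 by (auto simp: mult.commute)
qed

text \<open>A configuration (q, i, j, t) is represented by the numbers [q, i, B^j, tau], where tau has
  the tape t as its base-B digits: reading and writing under the head becomes arithmetic.\<close>

locale simulation = definability +
  fixes M :: ntm and c B :: nat
  assumes finite_delta: "finite (delta M)"
    and B: "2 \<le> B" "B < n0"
    and delta_less: "\<And>q a b q' b' di dj. (q, a, b, q', b', di, dj) \<in> delta M
        \<Longrightarrow> q < n0 \<and> a < n0 \<and> b < B \<and> q' < n0 \<and> b' < B"
    and c: "c < n0" "4 < n0" "start M < n0" "accept M < n0"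
    and big_enough: "\<And>G. ok G \<Longrightarrow> length (enc L (fst G) (snd G)) + 2 < big G
        \<and> (length (enc L (fst G) (snd G)) + 2) ^ c < big G
        \<and> 2 ^ nat (space c (length (enc L (fst G) (snd G)))) < big G
        \<and> B ^ (nat (space c (length (enc L (fst G) (snd G)))) + 2) < big G"
begin

definition inword :: "ctx \<Rightarrow> nat list" where "inword G = enc L (fst G) (snd G)"

definition sp :: "ctx \<Rightarrow> nat" where "sp G = nat (space c (length (inword G)))"

lemma bounds:
  assumes "ok G"
  shows "length (inword G) + 2 < big G" "(length (inword G) + 2) ^ c < big G" "2 ^ sp G < big G"
    "B ^ (sp G + 2) < big G"
  using big_enough[OF assms] unfolding inword_def sp_def by auto

lemma Def_sp: "Def (\<lambda>G v. v i = sp G)"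
proof -
  have "Def (\<lambda>G v. \<exists>m<big G. length (enc L (fst G) (snd G)) = m \<and> (\<exists>b<big G. b = 2 \<and> (\<exists>m2<big G. m + b = m2 \<and>
     (\<exists>e<big G. e = c \<and> (\<exists>z<big G. (m2 \<noteq> 0 \<and> m2 ^ e = z) \<and> (\<exists>p<big G. (b \<noteq> 0 \<and> b ^ v i = p) \<and> z \<le> p \<and>
     (v i = 0 \<or> (\<exists>h<big G. h + h = p \<and> h < z))))))))"
    using c n0 by (intro def_intros DefW_length[OF DefW_enc] Def_pow) auto
  then show ?thesis
  proof (rule Def_cong[rotated])
    fix G and v :: "nat \<Rightarrow> nat" assume Gv: "ok G" "\<forall>i. v i < big G"
    let ?m = "length (enc L (fst G) (snd G))"
    note b = bounds[OF Gv(1), unfolded inword_def]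
    have c': "c < big G" "2 < big G" "?m < big G" using num_big[OF Gv(1)] c b(1) by auto
    have p: "2 ^ v i < big G" if "v i = sp G" using b(3) that by simp
    have h: "h < big G" if "h + h = 2 ^ v i" "2 ^ v i < big G" for h using that by linarith
    have "v i = sp G \<longleftrightarrow> 2 ^ v i < big G \<and> v i = sp G" using p by blast
    also have "\<dots> \<longleftrightarrow> 2 ^ v i < big G \<and> (?m + 2) ^ c \<le> 2 ^ v i \<and>
        (v i = 0 \<or> (\<exists>h<big G. h + h = 2 ^ v i \<and> h < (?m + 2) ^ c))"
      unfolding sp_def inword_def space_eq_iff using h by blast
    finally show "v i = sp G \<longleftrightarrow> (\<exists>m<big G. ?m = m \<and> (\<exists>b<big G. b = 2 \<and> (\<exists>m2<big G. m + b = m2 \<and>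
     (\<exists>e<big G. e = c \<and> (\<exists>z<big G. (m2 \<noteq> 0 \<and> m2 ^ e = z) \<and> (\<exists>p<big G. (b \<noteq> 0 \<and> b ^ v i = p) \<and> z \<le> p \<and>
     (v i = 0 \<or> (\<exists>h<big G. h + h = p \<and> h < z))))))))"
      unfolding bex_eq using b c' by simp
  qed
qed

text \<open>The space bound on the head turns into a bound \<open>Jm\<close> on its power of
  \<open>B\<close>; \<open>Jm\<close> is an argument so that it can be computed once and passed to
  all steps as a parameter. The final inequality keeps the sum that compares old and new tape within
  the range of bounded guesses.\<close>

definition trans :: "ctx \<Rightarrow> nat \<Rightarrow> (nat \<times> nat \<times> nat \<times> nat \<times> nat \<times> int \<times> int) \<Rightarrow> nat list \<Rightarrow> nat list \<Rightarrow> bool" where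
  "trans G Jm = (\<lambda>(q, a, b, q', b', di, dj) xs ys.
     xs ! 0 = q \<and> ys ! 0 = q' \<and> inp (inword G) (int (xs ! 1)) = a
     \<and> xs ! 2 \<noteq> 0 \<and> xs ! 3 div xs ! 2 mod B = b
     \<and> move di (xs ! 1) (ys ! 1) \<and> ys ! 1 \<le> length (inword G) + 1
     \<and> scale B dj (xs ! 2) (ys ! 2) \<and> ys ! 2 \<le> Jm
     \<and> ys ! 3 + b * xs ! 2 = xs ! 3 + b' * xs ! 2 \<and> xs ! 3 + b' * xs ! 2 < big G)"

definition simstep :: "ctx \<Rightarrow> nat \<Rightarrow> nat list \<Rightarrow> nat list \<Rightarrow> bool" where
  "simstep G Jm xs ys \<longleftrightarrow> (\<exists>tr\<in>delta M. trans G Jm tr xs ys)"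

lemma Def_const: "Def (\<lambda>G v. b)"
  by (intro Def_Qf Qf_const)

lemma Def_bex_finite:
  assumes "finite S" "\<And>x. x \<in> S \<Longrightarrow> Def (P x)" shows "Def (\<lambda>G v. \<exists>x\<in>S. P x G v)"
  using assms
proof (induction S)
  case empty
  then show ?case using Def_const[of False] by simp
next
  case (insert x S)
  then have "Def (\<lambda>G v. P x G v \<or> (\<exists>x\<in>S. P x G v))" by (intro Def_disj) auto
  then show ?case by simp
qed

lemma Def_move: "Def (\<lambda>G v. move d (v i) (v j))"
  unfolding move_def by (intro def_intros Def_const)

lemma Def_scale: "Def (\<lambda>G v. scale B d (v i) (v j))"
proof -
  have "Def (\<lambda>G v. (d = 0 \<and> v j = v i) \<or> (d = 1 \<and> (\<exists>b<big G. b = B \<and> v i * b = v j))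
      \<or> (d = -1 \<and> (\<exists>b<big G. b = B \<and> v j * b = v i)))"
    using B(2) by (intro def_intros Def_const)
  then show ?thesis
    by (rule Def_cong[rotated]) (use num_big[OF _ B(2)] in \<open>auto simp: bex_eq scale_def\<close>)
qed

lemma Def_digit: assumes "b < n0" shows "Def (\<lambda>G v. v i \<noteq> 0 \<and> v j div v i mod B = b)"
proof -
  let ?X = "\<lambda>G v. \<exists>d<big G. (v i \<noteq> 0 \<and> d = v j div v i) \<and> (\<exists>r<big G. r = b \<and>
     (\<exists>m<big G. m = B \<and> (m \<noteq> 0 \<and> r = d mod m)))"
  have "Def ?X"
    using B(2) assms by (intro def_intros)
  then show ?thesis
  proof (rule Def_cong[rotated])
    fix G and v :: "nat \<Rightarrow> nat" assume Gv: "ok G" "\<forall>i. v i < big G"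
    have "v j div v i < big G" using Gv(2) div_le_dividend[of "v j" "v i"] by (metis le_less_trans)
    then show "v i \<noteq> 0 \<and> v j div v i mod B = b \<longleftrightarrow> ?X G v"
      unfolding bex_eq using num_big[OF Gv(1)] B assms by auto
  qed
qed

lemma Def_write: assumes "b < n0" "b' < n0"
  shows "Def (\<lambda>G v. v k + b * v i = v j + b' * v i \<and> v j + b' * v i < big G)"
proof -
  let ?X = "\<lambda>G v. \<exists>x<big G. x = b \<and> (\<exists>y<big G. y = b' \<and> (\<exists>p<big G. x * v i = p \<and> (\<exists>p'<big G. y * v i = p' \<and>
     (\<exists>z<big G. v k + p = z \<and> v j + p' = z))))"
  have "Def ?X"
    using assms by (intro def_intros)
  then show ?thesis
  proof (rule Def_cong[rotated])
    fix G and v :: "nat \<Rightarrow> nat" assume Gv: "ok G" "\<forall>i. v i < big G"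
    show "v k + b * v i = v j + b' * v i \<and> v j + b' * v i < big G \<longleftrightarrow> ?X G v"
      unfolding bex_eq using num_big[OF Gv(1)] assms by auto
  qed
qed

lemma Def_inword_le: "Def (\<lambda>G v. v i \<le> length (inword G) + 1)"
proof -
  have "Def (\<lambda>G v. \<exists>m<big G. length (enc L (fst G) (snd G)) = m \<and> (\<exists>k<big G. k = Suc m \<and> v i \<le> k))"
    by (intro def_intros DefW_length[OF DefW_enc])
  then show ?thesis
    by (rule Def_cong[rotated]) (use bounds(1) in \<open>force simp: bex_eq inword_def\<close>)
qed

lemma Def_inp_eq: assumes "a < n0" shows "Def (\<lambda>G v. inp (inword G) (int (v i)) = a)"
proof -
  have "Def (\<lambda>G v. \<exists>s<big G. s = a \<and> inp (enc L (fst G) (snd G)) (int (v i)) = s)"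
    using assms by (intro def_intros Def_inp c)
  then show ?thesis
    by (rule Def_cong[rotated]) (use num_big assms in \<open>auto simp: bex_eq inword_def\<close>)
qed

lemma Def_simstep: "Def (\<lambda>G v. simstep G (v p) [v x0, v x1, v x2, v x3] [v y0, v y1, v y2, v y3])"
  unfolding simstep_def
proof (rule Def_bex_finite[OF finite_delta])
  fix tr assume tr: "tr \<in> delta M"
  obtain q a b q' b' di dj where t: "tr = (q, a, b, q', b', di, dj)" by (cases tr)
  then have less: "q < n0" "a < n0" "b < n0" "q' < n0" "b' < n0" using delta_less[of q a b q' b' di dj] tr B by auto
  have "Def (\<lambda>G v. v x0 = q \<and> v y0 = q' \<and> inp (inword G) (int (v x1)) = a
     \<and> (v x2 \<noteq> 0 \<and> v x3 div v x2 mod B = b)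
     \<and> move di (v x1) (v y1) \<and> v y1 \<le> length (inword G) + 1
     \<and> scale B dj (v x2) (v y2) \<and> v y2 \<le> v p
     \<and> (v y3 + b * v x2 = v x3 + b' * v x2 \<and> v x3 + b' * v x2 < big G))"
    using less by (intro Def_conj Def_num Def_le Def_inp_eq Def_digit Def_move Def_inword_le Def_scale Def_write)
  then show "Def (\<lambda>G v. trans G (v p) tr [v x0, v x1, v x2, v x3] [v y0, v y1, v y2, v y3])"
    by (rule Def_cong[rotated]) (auto simp: trans_def t)
qed

definition simrel :: "ctx \<Rightarrow> nat list \<Rightarrow> nat list \<Rightarrow> bool" where
  "simrel G xs ys \<longleftrightarrow> xs \<in> T G 4 \<and> ys \<in> T G 4 \<and> simstep G (B ^ sp G) xs ys"

definition simacc :: "ctx \<Rightarrow> bool" where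
  "simacc G \<longleftrightarrow> (\<exists>i<big G. \<exists>J<big G. \<exists>u<big G. (simrel G)\<^sup>*\<^sup>* [start M, 0, 1, 0] [accept M, i, J, u])"

lemma Def_simacc: "Def (\<lambda>G v. simacc G)"
proof -
  have star: "Def (\<lambda>G v. (\<lambda>xs ys. xs \<in> T G 4 \<and> ys \<in> T G 4 \<and> simstep G (v p) xs ys)\<^sup>*\<^sup>*
     [v x0, v x1, v x2, v x3] [v y0, v y1, v y2, v y3])" for p x0 x1 x2 x3 y0 y1 y2 y3
  proof -
    have "Def (\<lambda>G v. simstep G (v (2 * 4 + p)) (map v [0..<4]) (map v [4..<4 + 4]))"
      using Def_simstep[of "2 * 4 + p" 0 1 2 3 4 5 6 7] by (simp add: upt_rec numeral_eq_Suc)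
    from Def_rtranclp[where P = "\<lambda>G v. simstep G (v p)", OF this, of "[x0, x1, x2, x3]" "[y0, y1, y2, y3]"]
    show ?thesis by simp
  qed
  let ?X = "\<lambda>G v. \<exists>s<big G. s = sp G \<and> (\<exists>b<big G. b = B \<and> (\<exists>Jm<big G. (b \<noteq> 0 \<and> b ^ s = Jm) \<and>
     (\<exists>q<big G. q = start M \<and> (\<exists>z<big G. z = 0 \<and> (\<exists>n<big G. n = 1 \<and> (\<exists>r<big G. r = accept M \<and>
     (\<exists>i<big G. \<exists>J<big G. \<exists>u<big G. (\<lambda>xs ys. xs \<in> T G 4 \<and> ys \<in> T G 4 \<and> simstep G Jm xs ys)\<^sup>*\<^sup>*
        [q, z, n, z] [r, i, J, u])))))))"
  have "Def ?X"
    using c B by (intro def_intros Def_sp Def_pow star) auto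
  then show ?thesis
  proof (rule Def_cong[rotated])
    fix G and v :: "nat \<Rightarrow> nat" assume G: "ok G"
    have "sp G < big G" using less_exp bounds(3)[OF G] by (rule less_trans)
    moreover have "B ^ sp G \<le> B ^ (sp G + 2)" using B by (intro power_increasing) auto
    then have "B ^ sp G < big G" using bounds(4)[OF G] by (rule le_less_trans)
    ultimately show "simacc G \<longleftrightarrow> ?X G v"
      unfolding bex_eq simacc_def simrel_def[abs_def] using num_big[OF G] c B by auto
  qed
qed

section \<open>Codes of machine configurations\<close>

definition digits :: "ctx \<Rightarrow> (int \<Rightarrow> nat) \<Rightarrow> nat list" where
  "digits G t = map (\<lambda>p. t (int p)) [0..<Suc (sp G)]"

text \<open>Only cells 0 to \<open>sp G\<close> enter the code; a run that starts at cell 0 and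
  respects the space bound visits no others.\<close>

definition code :: "ctx \<Rightarrow> config \<Rightarrow> nat list" where
  "code G = (\<lambda>(q, i, j, t). [q, nat i, B ^ nat j, val B (digits G t)])"

definition valid :: "ctx \<Rightarrow> config \<Rightarrow> bool" where
  "valid G = (\<lambda>(q, i, j, t). q < n0 \<and> 0 \<le> i \<and> i \<le> int (length (inword G)) + 1 \<and> 0 \<le> j \<and> j \<le> int (sp G)
      \<and> (\<forall>p. t p < B))"

lemma code_T: assumes "ok G" "valid G cf" shows "code G cf \<in> T G 4"
proof -
  obtain q i j t where cf: "cf = (q, i, j, t)" by (cases cf)
  have v: "q < n0" "0 \<le> i" "i \<le> int (length (inword G)) + 1" "0 \<le> j" "j \<le> int (sp G)" "\<forall>p. t p < B"
    using assms(2) unfolding valid_def cf by auto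
  have "nat i < big G" using v bounds(1)[OF assms(1)] by linarith
  have "B ^ nat j \<le> B ^ (sp G + 2)" using v B by (intro power_increasing) auto
  then have 1: "B ^ nat j < big G" using bounds(4)[OF assms(1)] by linarith
  have "set (digits G t) \<subseteq> {..<B}" "length (digits G t) = Suc (sp G)" using v unfolding digits_def by auto
  then have "val B (digits G t) < B ^ Suc (sp G)" using val_less by metis
  moreover have "B ^ Suc (sp G) \<le> B ^ (sp G + 2)" using B by (intro power_increasing) auto
  ultimately have "val B (digits G t) < big G" using bounds(4)[OF assms(1)] by linarith
  then show ?thesis unfolding cf code_def T_def
    using num_big[OF assms(1) v(1)] \<open>nat i < big G\<close> 1 by simp
qed

text \<open>A bisimulation: from the code of a valid configuration one reaches exactly the codes of
  its space-bounded successors, so no number tuple without meaning becomes reachable.\<close>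

lemma simrel_code:
  assumes G: "ok G" and cf: "valid G cf"
  shows "simrel G (code G cf) ys \<longleftrightarrow>
    (\<exists>cf'. ys = code G cf' \<and> valid G cf' \<and> step_bounded M c (inword G) cf cf')"
proof -
  obtain q i j t where cf': "cf = (q, i, j, t)" by (cases cf)
  have v: "q < n0" "0 \<le> i" "i \<le> int (length (inword G)) + 1" "0 \<le> j" "j \<le> int (sp G)" "\<forall>p. t p < B"
    using cf unfolding valid_def cf' by auto
  define x where "x = nat i"
  define y where "y = nat j"
  have i: "i = int x" and j: "j = int y" and y: "y \<le> sp G" unfolding x_def y_def using v by auto
  have D: "set (digits G t) \<subseteq> {..<B}" "y < length (digits G t)" "digits G t ! y = t j"
    using v y unfolding digits_def j by (auto simp: nth_append simp del: upt_Suc)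
  have dig: "val B (digits G t) div B ^ y mod B = t j" using val_digit[OF D(1,2)] D(3) by simp
  have upd: "digits G (t(j := b)) = (digits G t)[y := b]" for b
    using y unfolding digits_def j by (auto simp: list_eq_iff_nth_eq nth_list_update simp del: upt_Suc)
  have wr: "val B (digits G (t(j := b'))) + t j * B ^ y = val B (digits G t) + b' * B ^ y" for b'
    unfolding upd using val_update[OF D(2), of B b'] D(3) by simp
  \<comment> \<open>Origin of the exponent \<open>sp G + 2\<close>: the tape is below
    \<open>B ^ (sp G + 1)\<close>, the written digit adds at most as much again, and one more factor
    \<open>B\<close> absorbs the 2.\<close>
  have bd: "val B (digits G t) + b' * B ^ y < big G" if "b' < B" for b'
  proof -
    have "val B (digits G t) < B ^ Suc (sp G)" using val_less[OF D(1)] by (simp add: digits_def)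
    moreover have "b' * B ^ y \<le> B * B ^ sp G" using that y B by (intro mult_mono power_increasing) auto
    then have "b' * B ^ y \<le> B ^ Suc (sp G)" by simp
    ultimately have "val B (digits G t) + b' * B ^ y < 2 * B ^ Suc (sp G)" by linarith
    also have "\<dots> \<le> B * B ^ Suc (sp G)" by (rule mult_le_mono1[OF B(1)])
    also have "\<dots> = B ^ (sp G + 2)" by simp
    finally show ?thesis using bounds(4)[OF G] by linarith
  qed
  have T: "code G cf \<in> T G 4" by (rule code_T[OF G cf])
  have sb: "space c (length (inword G)) = int (sp G)" unfolding sp_def using space_nonneg by simp
  have Bpos: "B ^ y \<noteq> 0" using B by simp
  have powle: "B ^ y' \<le> B ^ sp G \<longleftrightarrow> y' \<le> sp G" for y' using B by (intro power_increasing_iff) auto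
  show ?thesis
  proof
    assume "simrel G (code G cf) ys"
    then obtain q0 a b q' b' di dj where tr: "(q0, a, b, q', b', di, dj) \<in> delta M" and ysT: "ys \<in> T G 4"
      and st: "trans G (B ^ sp G) (q0, a, b, q', b', di, dj) (code G cf) ys"
      unfolding simrel_def simstep_def by (metis prod_cases7)
    then obtain x' z u where ys: "ys = [q', x', z, u]"
      by (auto simp: T_def trans_def numeral_eq_Suc length_Suc_conv)
    have s: "q = q0" "inp (inword G) i = a" "t j = b" "move di x x'" "x' \<le> length (inword G) + 1"
      "scale B dj (B ^ y) z" "z \<le> B ^ sp G" "u + b * B ^ y = val B (digits G t) + b' * B ^ y"
      using st dig unfolding trans_def ys cf' code_def i j by auto
    obtain y' where y': "z = B ^ y'" "move dj y y'" using s(6) scale_iff[OF B(1)] by blast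
    have b: "b' < B" "q' < n0" using delta_less[OF tr] by auto
    define cf2 where "cf2 = (q', int x', int y', t(j := b'))"
    have "ys = code G cf2"
      unfolding ys cf2_def code_def using y' wr[of b'] s(3,8) by simp
    moreover have "valid G cf2"
      unfolding cf2_def valid_def using b v s(5,7) y'(1) powle by auto
    moreover have "step_bounded M c (inword G) cf cf2"
      unfolding step_bounded_def step_def cf' cf2_def sb using tr s y' powle
      by (auto simp: move_iff i j intro!: exI[of _ b'] exI[of _ di] exI[of _ dj])
    ultimately show "\<exists>cf'. ys = code G cf' \<and> valid G cf' \<and> step_bounded M c (inword G) cf cf'" by blast
  next
    assume "\<exists>cf'. ys = code G cf' \<and> valid G cf' \<and> step_bounded M c (inword G) cf cf'"
    then obtain cf2 where cf2: "ys = code G cf2" "valid G cf2" "step_bounded M c (inword G) cf cf2" by blast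
    obtain q' i' j' t' where e: "cf2 = (q', i', j', t')" by (cases cf2)
    obtain b' di dj where st: "(q, inp (inword G) i, t j, q', b', di, dj) \<in> delta M" "di \<in> {-1, 0, 1}"
      "dj \<in> {-1, 0, 1}" "i' = i + di" "0 \<le> i'" "i' \<le> int (length (inword G)) + 1" "j' = j + dj" "0 \<le> j'"
      "t' = t(j := b')" "j' \<le> int (sp G)"
      using cf2(3) unfolding step_bounded_def step_def cf' e sb by auto
    define x' where "x' = nat i'"
    define y' where "y' = nat j'"
    have i': "i' = int x'" and j': "j' = int y'" unfolding x'_def y'_def using st by auto
    have mv: "move di x x'" "move dj y y'" using st unfolding move_iff i' j' i j by auto
    have b: "b' < B" using delta_less[OF st(1)] by auto
    have "trans G (B ^ sp G) (q, inp (inword G) i, t j, q', b', di, dj) (code G cf) ys"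
      unfolding cf2(1) cf' e code_def trans_def
      using mv dig wr[of b'] bd[OF b] Bpos st(6,9,10) powle[of y'] scale_iff[OF B(1), of dj y "B ^ y'"]
      by (auto simp: i j i' j')
    then show "simrel G (code G cf) ys"
      unfolding simrel_def simstep_def using st(1) T code_T[OF G cf2(2)] cf2(1) by blast
  qed
qed

lemma simacc_iff: assumes G: "ok G" shows "simacc G \<longleftrightarrow> accepts M c (inword G)"
proof -
  define c0 :: config where "c0 = (start M, 0, 0, \<lambda>_. 0)"
  have val0: "val B (map (\<lambda>p. 0) xs) = 0" for xs :: "nat list" by (induction xs) auto
  have c0: "valid G c0" "code G c0 = [start M, 0, 1, 0]"
    using c B unfolding c0_def valid_def code_def digits_def by (auto simp: val0 simp del: upt_Suc)
  have fwd: "\<exists>cf. xs = code G cf \<and> valid G cf \<and> (step_bounded M c (inword G))\<^sup>*\<^sup>* c0 cf"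
    if "(simrel G)\<^sup>*\<^sup>* (code G c0) xs" for xs
    using that
  proof induction
    case base
    then show ?case using c0 by blast
  next
    case (step xs ys)
    then obtain cf where cf: "xs = code G cf" "valid G cf" "(step_bounded M c (inword G))\<^sup>*\<^sup>* c0 cf" by blast
    then obtain cf' where "ys = code G cf'" "valid G cf'" "step_bounded M c (inword G) cf cf'"
      using step(2) simrel_code[OF G cf(2)] by blast
    then show ?case using cf(3) by (metis rtranclp.rtrancl_into_rtrancl)
  qed
  have bwd: "valid G cf \<and> (simrel G)\<^sup>*\<^sup>* (code G c0) (code G cf)" if "(step_bounded M c (inword G))\<^sup>*\<^sup>* c0 cf" for cf
    using that
  proof induction
    case base
    then show ?case using c0 by blast
  next
    case (step cf cf')
    obtain q i j t where cf: "cf = (q, i, j, t)" by (cases cf)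
    obtain q' i' j' t' where e: "cf' = (q', i', j', t')" by (cases cf')
    obtain b' di dj where st: "(q, inp (inword G) i, t j, q', b', di, dj) \<in> delta M"
      "0 \<le> i'" "i' \<le> int (length (inword G)) + 1" "0 \<le> j'" "t' = t(j := b')" "j' \<le> space c (length (inword G))"
      using step(2) unfolding step_bounded_def step_def cf e by auto
    have "valid G cf'"
      using step.IH st delta_less[OF st(1)] unfolding cf e valid_def sp_def by auto
    then have "simrel G (code G cf) (code G cf')" using simrel_code[OF G] step by blast
    then show ?case using step.IH \<open>valid G cf'\<close> by (meson rtranclp.rtrancl_into_rtrancl)
  qed
  show ?thesis
  proof
    assume "simacc G"
    then obtain i J u where "(simrel G)\<^sup>*\<^sup>* (code G c0) [accept M, i, J, u]" unfolding simacc_def c0 by blast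
    from fwd[OF this] obtain cf where cf: "[accept M, i, J, u] = code G cf" "(step_bounded M c (inword G))\<^sup>*\<^sup>* c0 cf"
      by blast
    then have "fst cf = accept M" unfolding code_def by (auto split: prod.splits)
    then show "accepts M c (inword G)" unfolding accepts_def using cf(2) c0_def by blast
  next
    assume "accepts M c (inword G)"
    then obtain cf where cf: "(step_bounded M c (inword G))\<^sup>*\<^sup>* c0 cf" "fst cf = accept M"
      unfolding accepts_def c0_def by blast
    note b = bwd[OF cf(1)]
    obtain i J u where e: "code G cf = [accept M, i, J, u]"
      using cf(2) unfolding code_def by (cases cf) auto
    have "i < big G" "J < big G" "u < big G"
      using code_T[OF G, of cf] b unfolding e T_def by auto
    then show "simacc G" unfolding simacc_def using b c0 e by metis
  qed
qed

end

section \<open>Polynomial bounds\<close>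

text \<open>A bare power of the size, without coefficient: from size 2 on, constants and sums can be
  absorbed into the exponent.\<close>

definition polyb :: "sig \<Rightarrow> (ctx \<Rightarrow> nat) \<Rightarrow> bool" where
  "polyb L f \<longleftrightarrow> (\<exists>e. \<forall>G. is_struc L (fst G) \<longrightarrow> 2 \<le> sz G \<longrightarrow> f G \<le> sz G ^ e)"

lemma polybI: "(\<And>G. is_struc L (fst G) \<Longrightarrow> 2 \<le> sz G \<Longrightarrow> f G \<le> sz G ^ e) \<Longrightarrow> polyb L f"
  unfolding polyb_def by blast

lemma polyb_mono: "polyb L g \<Longrightarrow> (\<And>G. is_struc L (fst G) \<Longrightarrow> 2 \<le> sz G \<Longrightarrow> f G \<le> g G) \<Longrightarrow> polyb L f"
  unfolding polyb_def by (meson le_trans)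

lemma polyb_sz: "polyb L (\<lambda>G. sz G)"
  by (rule polybI[of _ _ 1]) simp

lemma polyb_const: "polyb L (\<lambda>G. k)"
proof (rule polybI)
  fix G :: ctx assume "2 \<le> sz G"
  then have "2 ^ k \<le> sz G ^ k" by (rule power_mono) simp
  moreover have "k < 2 ^ k" by (rule less_exp)
  ultimately show "k \<le> sz G ^ k" by linarith
qed

lemma polyb_mult: assumes "polyb L f" "polyb L g" shows "polyb L (\<lambda>G. f G * g G)"
proof -
  obtain d where d: "\<And>G. is_struc L (fst G) \<Longrightarrow> 2 \<le> sz G \<Longrightarrow> f G \<le> sz G ^ d" using assms unfolding polyb_def by blast
  obtain e where e: "\<And>G. is_struc L (fst G) \<Longrightarrow> 2 \<le> sz G \<Longrightarrow> g G \<le> sz G ^ e" using assms unfolding polyb_def by blast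
  show ?thesis by (rule polybI[of _ _ "d + e"]) (simp add: power_add mult_le_mono d e)
qed

lemma polyb_add: assumes "polyb L f" "polyb L g" shows "polyb L (\<lambda>G. f G + g G)"
proof -
  obtain d where d: "\<And>G. is_struc L (fst G) \<Longrightarrow> 2 \<le> sz G \<Longrightarrow> f G \<le> sz G ^ d" using assms unfolding polyb_def by blast
  obtain e where e: "\<And>G. is_struc L (fst G) \<Longrightarrow> 2 \<le> sz G \<Longrightarrow> g G \<le> sz G ^ e" using assms unfolding polyb_def by blast
  show ?thesis
  proof (rule polybI[of _ _ "Suc (max d e)"])
    fix G :: ctx assume G: "is_struc L (fst G)" "2 \<le> sz G"
    have "sz G ^ d \<le> sz G ^ max d e" "sz G ^ e \<le> sz G ^ max d e" using G by (auto intro!: power_increasing)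
    then have "f G + g G \<le> 2 * sz G ^ max d e" using d[OF G] e[OF G] by linarith
    also have "\<dots> \<le> sz G * sz G ^ max d e" using G by (intro mult_le_mono) auto
    finally show "f G + g G \<le> sz G ^ Suc (max d e)" by simp
  qed
qed

lemma polyb_Suc: "polyb L f \<Longrightarrow> polyb L (\<lambda>G. Suc (f G))"
  using polyb_add[of L f "\<lambda>_. 1"] polyb_const by simp

lemma polyb_power: "polyb L f \<Longrightarrow> polyb L (\<lambda>G. f G ^ k)"
  by (induction k) (auto intro: polyb_const polyb_mult)

lemma polyb_sum_list: "(\<And>r. r \<in> set rs \<Longrightarrow> polyb L (f r)) \<Longrightarrow> polyb L (\<lambda>G. \<Sum>r\<leftarrow>rs. f r G)"
  by (induction rs) (auto intro: polyb_const polyb_add)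

lemma length_tuples: "length (tuples n k) = n ^ k"
  by (induction k) (auto simp: length_concat comp_def sum_list_triv)

lemma polyb_bitlen: "polyb L (\<lambda>G. bitlen (sz G))"
proof (rule polyb_mono[of L "\<lambda>G. sz G + 1"])
  show "polyb L (\<lambda>G. sz G + 1)" by (intro polyb_add polyb_sz polyb_const)
  show "bitlen (sz G) \<le> sz G + 1" for G :: ctx
    unfolding bitlen_def using less_exp[of "sz G + 1"] by (intro Least_le) auto
qed

lemma polyb_enc: "polyb L (\<lambda>G. length (enc L (fst G) (snd G)))"
  unfolding enc_def Let_def
  by (simp add: length_concat comp_def bin_def length_tuples sum_list_triv)
    (intro polyb_add polyb_Suc polyb_sum_list polyb_sz polyb_const polyb_mult polyb_power polyb_bitlen)

section \<open>The interpretation\<close>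

context definability
begin

section \<open>From tuples of elements to tuples of numbers\<close>

fun decode :: "ctx \<Rightarrow> nat \<Rightarrow> nat list \<Rightarrow> nat list" where
  "decode G 0 xs = []"
| "decode G (Suc k) xs = val (sz G) (map (rank (snd G)) (take K xs)) # decode G k (drop K xs)"

definition elems :: "ctx \<Rightarrow> nat \<Rightarrow> nat list set" where
  "elems G k = {xs. length xs = K * k \<and> set xs \<subseteq> {..<sz G}}"

lemma length_decode: "length (decode G k xs) = k"
  by (induction k arbitrary: xs) auto

lemma elems_Suc: assumes "xs \<in> elems G (Suc k)" shows "take K xs \<in> elems G 1" "drop K xs \<in> elems G k"
  using assms set_take_subset[of K xs] set_drop_subset[of K xs] unfolding elems_def by auto

lemma decode_append:
  "length xs = K * k \<Longrightarrow> decode G (k + l) (xs @ ys) = decode G k xs @ decode G l ys"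
  by (induction k arbitrary: xs) auto

lemma rank_block:
  assumes "ok G" "xs \<in> elems G 1" shows "length (map (rank (snd G)) xs) = K" "set (map (rank (snd G)) xs) \<subseteq> {..<sz G}"
  using assms nth_rank(2)[OF ok_order[OF assms(1)]] unfolding elems_def by auto

lemma decode_T: assumes "ok G" shows "xs \<in> elems G k \<Longrightarrow> decode G k xs \<in> T G k"
proof (induction k arbitrary: xs)
  case 0
  then show ?case by (simp add: T_def)
next
  case (Suc k)
  have "val (sz G) (map (rank (snd G)) (take K xs)) < big G"
    using val_less[OF rank_block(2)[OF assms elems_Suc(1)[OF Suc.prems]]]
      rank_block(1)[OF assms elems_Suc(1)[OF Suc.prems]] unfolding big_def by simp
  then show ?case using Suc.IH[OF elems_Suc(2)[OF Suc.prems]] by (simp add: T_def)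
qed

lemma decode_inj:
  assumes G: "ok G" shows "xs \<in> elems G k \<Longrightarrow> ys \<in> elems G k \<Longrightarrow> decode G k xs = decode G k ys \<Longrightarrow> xs = ys"
proof (induction k arbitrary: xs ys)
  case 0
  then show ?case by (simp add: elems_def)
next
  case (Suc k)
  note x = elems_Suc[OF Suc.prems(1)] and y = elems_Suc[OF Suc.prems(2)]
  have "map (rank (snd G)) (take K xs) = map (rank (snd G)) (take K ys)"
    using val_inj[of "map (rank (snd G)) (take K xs)" "map (rank (snd G)) (take K ys)" "sz G"]
      rank_block[OF G x(1)] rank_block[OF G y(1)] Suc.prems(3) by simp
  moreover have "inj_on (rank (snd G)) {..<sz G}"
    by (rule inj_on_inverseI[of _ "\<lambda>i. snd G ! i"]) (use nth_rank(1)[OF ok_order[OF G]] in auto)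
  then have "inj_on (rank (snd G)) (set (take K xs) \<union> set (take K ys))"
    by (rule inj_on_subset) (use x(1) y(1) in \<open>auto simp: elems_def\<close>)
  ultimately have "take K xs = take K ys" by (rule map_inj_on)
  moreover have "drop K xs = drop K ys" using Suc.IH[OF x(2) y(2)] Suc.prems(3) by simp
  ultimately show ?case by (metis append_take_drop_id)
qed

lemma decode_surj: assumes G: "ok G" shows "u \<in> T G k \<Longrightarrow> \<exists>xs\<in>elems G k. decode G k xs = u"
proof (induction k arbitrary: u)
  case 0
  then show ?case by (intro bexI[of _ "[]"]) (auto simp: T_def elems_def)
next
  case (Suc k)
  then obtain y us where u: "u = y # us" "y < big G" "us \<in> T G k" by (auto simp: T_def length_Suc_conv)
  obtain xs where xs: "xs \<in> elems G k" "decode G k xs = us" using Suc.IH u(3) by blast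
  obtain ds where ds: "length ds = K" "set ds \<subseteq> {..<sz G}" "val (sz G) ds = y"
    using val_surj[of y "sz G" K] u(2) unfolding big_def by blast
  define bs where "bs = map (\<lambda>i. snd G ! i) ds"
  have "map (rank (snd G)) bs = ds"
    unfolding bs_def using ds(2) rank_nth is_orderD[OF ok_order[OF G]] by (auto intro!: map_idI)
  moreover have "bs @ xs \<in> elems G (Suc k)"
    using ds xs nth_order_less[OF ok_order[OF G]] unfolding bs_def elems_def by auto
  ultimately show ?case using xs ds u by (intro bexI[of _ "bs @ xs"]) (auto simp: bs_def)
qed

lemma decode_nth:
  "length xs = K * k \<Longrightarrow> i < k \<Longrightarrow> decode G k xs ! i = val (sz G) (map (\<lambda>j. rank (snd G) (xs ! (i * K + j))) [0..<K])"
proof (induction k arbitrary: xs i)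
  case (Suc k)
  show ?case
  proof (cases i)
    case 0
    have "map (rank (snd G)) (take K xs) = map (\<lambda>j. rank (snd G) (xs ! j)) [0..<K]"
      using Suc.prems by (auto simp: list_eq_iff_nth_eq)
    then show ?thesis using 0 by simp
  next
    case (Suc i')
    have "decode G k (drop K xs) ! i' = val (sz G) (map (\<lambda>j. rank (snd G) (drop K xs ! (i' * K + j))) [0..<K])"
      using Suc.IH[of "drop K xs" i'] Suc.prems Suc by simp
    also have "\<dots> = val (sz G) (map (\<lambda>j. rank (snd G) (xs ! (i * K + j))) [0..<K])"
      using Suc Suc.prems by (simp add: add.assoc)
    finally show ?thesis using Suc by simp
  qed
qed simp

text \<open>The formula may use only the \<open>K * k\<close> variables of the tuple. All others are
  replaced by the minimum, so the predicate reads 0 beyond the \<open>k\<close> decoded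
  numbers.\<close>

lemma Qf_formula:
  assumes "Qf P"
  shows "\<exists>p. wf_fm L (K * k) p \<and> (\<forall>G xs. ok G \<longrightarrow> xs \<in> elems G k \<longrightarrow>
     (holds (fst G) (snd G) (ival xs) p \<longleftrightarrow> P G (cat (decode G k xs) (\<lambda>_. 0))))"
proof -
  obtain l q where q: "wf_fm L l q" "\<And>G v. ok G \<Longrightarrow> (\<forall>i. v i < sz G) \<Longrightarrow>
      holds (fst G) (snd G) (\<lambda>i. snd G ! v i) q \<longleftrightarrow> P G (num G v)"
    using assms unfolding Qf_def Qr_def by blast
  define \<sigma> where "\<sigma> i = (if i < K * k then TVar i else TMin)" for i
  have "wf_fm L (K * k) (subst_fm \<sigma> q)"
    by (rule wf_fm_subst[OF q(1)]) (simp add: \<sigma>_def)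
  moreover have "holds (fst G) (snd G) (ival xs) (subst_fm \<sigma> q) \<longleftrightarrow> P G (cat (decode G k xs) (\<lambda>_. 0))"
    if G: "ok G" and xs: "xs \<in> elems G k" for G xs
  proof -
    define v where "v i = (if i < K * k then rank (snd G) (xs ! i) else 0)" for i
    have len: "length xs = K * k" using xs unfolding elems_def by simp
    have x: "xs ! i < sz G" if "i < K * k" for i
      using subsetD[of "set xs" "{..<sz G}" "xs ! i"] xs that nth_mem[of i xs] unfolding elems_def by simp
    have 1: "(\<lambda>i. ev (fst G) (snd G) (ival xs) (\<sigma> i)) = (\<lambda>i. snd G ! v i)"
      using x nth_rank(1)[OF ok_order[OF G]] hd_order[OF G]
      by (auto simp: \<sigma>_def v_def ival_def)
    have 2: "\<forall>i. v i < sz G"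
      using x nth_rank(2)[OF ok_order[OF G]] ok_sz[OF G] by (auto simp: v_def)
    have "num G v i = cat (decode G k xs) (\<lambda>_. 0) i" for i
    proof (cases "i < k")
      case True
      have "i * K + j < K * k" if "j < K" for j
      proof -
        have "i * K + j < Suc i * K" using that by simp
        also have "\<dots> \<le> k * K" using True by (intro mult_le_mono1) simp
        finally show ?thesis by (simp add: mult.commute)
      qed
      then have eq: "map (\<lambda>j. v (i * K + j)) [0..<K] = map (\<lambda>j. rank (snd G) (xs ! (i * K + j))) [0..<K]"
        by (simp add: v_def)
      show ?thesis unfolding num_def eq cat_def length_decode using True decode_nth[OF len True] by simp
    next
      case False
      then have "\<not> i * K + j < K * k" for j by (metis mult.commute mult_le_mono1 not_less trans_le_add1)
      then have "map (\<lambda>j. v (i * K + j)) [0..<K] = replicate K 0" by (simp add: v_def map_replicate_const)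
      then show ?thesis using False by (simp add: cat_def length_decode num_def val_replicate_0)
    qed
    then have "num G v = cat (decode G k xs) (\<lambda>_. 0)" by (rule ext)
    then show ?thesis using q(2)[OF G 2] by (simp add: holds_subst 1)
  qed
  ultimately show ?thesis by blast
qed

text \<open>Closed terms for the only numbers that the six constants need: \<open>Some k\<close> is
  a small number with zero higher digits, and \<open>None\<close> is the largest number, all of
  whose digits are maximal.\<close>

definition block_tms :: "nat option \<Rightarrow> tm list" where
  "block_tms o' = (case o' of Some k \<Rightarrow> numeral_tm k # replicate (K - 1) TMin | None \<Rightarrow> replicate K TMax)"

definition block_num :: "ctx \<Rightarrow> nat option \<Rightarrow> nat" where
  "block_num G o' = (case o' of Some k \<Rightarrow> k | None \<Rightarrow> big G - 1)"

lemma block_tms: "length (block_tms o') = K" "t \<in> set (block_tms o') \<Longrightarrow> wf_tm L 0 t"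
  using K by (auto simp: block_tms_def wf_numeral_tm split: option.splits)

lemma ev_block:
  assumes G: "ok G" and o: "\<And>k. o' = Some k \<Longrightarrow> k < 3"
  shows "map (ev (fst G) (snd G) v) (block_tms o') \<in> elems G 1"
    "val (sz G) (map (rank (snd G)) (map (ev (fst G) (snd G) v) (block_tms o'))) = block_num G o'"
proof -
  note os = is_orderD[OF ok_order[OF G]] and n = ok_sz[OF G]
  have "ev (fst G) (snd G) v TMin = snd G ! 0" "ev (fst G) (snd G) v TMax = snd G ! (sz G - 1)"
    using hd_order[OF G] last_order[OF G] by auto
  then have min: "ev (fst G) (snd G) v TMin < sz G" "rank (snd G) (ev (fst G) (snd G) v TMin) = 0"
    and max: "ev (fst G) (snd G) v TMax < sz G" "rank (snd G) (ev (fst G) (snd G) v TMax) = sz G - 1"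
    using nth_order_less[OF ok_order[OF G]] rank_nth[OF os(1)] os(3) n by auto
  have num: "ev (fst G) (snd G) v (numeral_tm k) < sz G" "rank (snd G) (ev (fst G) (snd G) v (numeral_tm k)) = k"
    if "k < 3" for k
    using nth_order_less[OF ok_order[OF G]] rank_nth[OF os(1)] os(3) n that ev_numeral_tm[OF G, of k v] by auto
  show "map (ev (fst G) (snd G) v) (block_tms o') \<in> elems G 1"
    using K min max num o by (auto simp: elems_def block_tms_def split: option.splits)
  show "val (sz G) (map (rank (snd G)) (map (ev (fst G) (snd G) v) (block_tms o'))) = block_num G o'"
  proof (cases o')
    case None
    have "Suc (val (sz G) (replicate K (sz G - 1))) = big G"
      unfolding big_def using n by (intro val_replicate_max) simp
    then show ?thesis using None max(2) by (simp add: block_tms_def block_num_def)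
  next
    case (Some k)
    then show ?thesis using o[OF Some] num(2)[of k] min(2)
      by (simp add: block_tms_def block_num_def val_replicate_0)
  qed
qed

lemma decode_blocks:
  assumes G: "ok G" and "\<And>k. Some k \<in> set bs \<Longrightarrow> k < 3"
  shows "map (ev (fst G) (snd G) v) (concat (map block_tms bs)) \<in> elems G (length bs)
    \<and> decode G (length bs) (map (ev (fst G) (snd G) v) (concat (map block_tms bs))) = map (block_num G) bs"
  using assms(2)
proof (induction bs)
  case Nil
  show ?case by (simp add: elems_def)
next
  case (Cons b bs)
  have b: "k < 3" if "b = Some k" for k using Cons.prems that by auto
  note e = ev_block[OF G b, where v = v]
  have IH: "map (ev (fst G) (snd G) v) (concat (map block_tms bs)) \<in> elems G (length bs)"
    "decode G (length bs) (map (ev (fst G) (snd G) v) (concat (map block_tms bs))) = map (block_num G) bs"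
    using Cons by auto
  show ?case using e IH block_tms(1)[of b] by (auto simp: elems_def)
qed

definition decides :: "interp \<Rightarrow> (ctx \<Rightarrow> bool) \<Rightarrow> bool" where
  "decides g P \<longleftrightarrow> (\<forall>A os. ok (A, os) \<longrightarrow> interp_graph_ok g A os \<and>
     (\<forall>vs. bft (idomain g A os) (iE g A os) vs \<longrightarrow> (P (A, os) \<longleftrightarrow> psi vs (iE g A os) (iconst g A os))))"

lemma finite_T: "finite (T G k)" and card_T: "card (T G k) = big G ^ k"
  unfolding T_def using finite_lists_length_eq[of "{..<big G}" k] card_lists_length_eq[of "{..<big G}" k]
  by (simp_all add: conj_commute)

end

text \<open>The first entry of a configuration is a phase: 0 before the initial state of the run has
  been guessed, 1 during the run and 2 after its final state has been checked.\<close>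

locale run_graph = definability +
  fixes m :: nat and I \<phi> F :: "ctx \<Rightarrow> (nat \<Rightarrow> nat) \<Rightarrow> bool"
  assumes Qf: "Qf I" "Qf \<phi>" "Qf F"
begin

abbreviation zeros :: "nat \<Rightarrow> nat" where "zeros \<equiv> \<lambda>_. 0"

text \<open>The initial and final conditions may admit many tuples. Leaving a single start by a
  guess and clearing the registers at the end produces one start and one goal, which closed terms
  can name.\<close>

definition next_conf :: "ctx \<Rightarrow> nat list \<Rightarrow> nat list \<Rightarrow> bool" where
  "next_conf G x y \<longleftrightarrow>
     (x ! 0 = 0 \<and> y ! 0 = 1 \<and> I G (cat (tl y) zeros))
   \<or> (x ! 0 = 1 \<and> y ! 0 = 1 \<and> \<phi> G (cat (tl x) (cat (tl y) zeros)))
   \<or> (x ! 0 = 1 \<and> y ! 0 = 2 \<and> F G (cat (tl x) zeros) \<and> tl y = replicate m 0)"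

abbreviation "conf_start \<equiv> 0 # replicate m (0::nat)"
abbreviation "conf_goal \<equiv> 2 # replicate m (0::nat)"

lemma conf_in: assumes "ok G" "k < 3" shows "k # replicate m 0 \<in> T G (Suc m)"
  using big_gt[OF assms(1), of k] big_pos[OF assms(1)] ok_sz[OF assms(1)] assms(2) unfolding T_def by auto

lemma next_conf_reach:
  assumes G: "ok G"
  defines "R \<equiv> \<lambda>x y. x \<in> T G (Suc m) \<and> y \<in> T G (Suc m) \<and> next_conf G x y"
  shows "R\<^sup>*\<^sup>* conf_start conf_goal \<longleftrightarrow> runs G m I \<phi> F zeros"
    (is "_ \<longleftrightarrow> ?P")
proof
  have tlT: "tl x \<in> T G m" if "x \<in> T G (Suc m)" for x using that by (cases x) (auto simp: T_def)
  assume "R\<^sup>*\<^sup>* conf_start conf_goal"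
  \<comment> \<open>The alternative \<open>?P\<close> takes over as soon as a final state is
    accepted, so nothing has to be recorded about phase 2. At the goal the phase is 2, and only
    \<open>?P\<close> remains.\<close>
  moreover have "x ! 0 = 0 \<or> (x ! 0 = 1 \<and> (\<exists>a. a \<in> T G m \<and> I G (cat a zeros) \<and> (path G \<phi> m zeros)\<^sup>*\<^sup>* a (tl x))) \<or> ?P"
    if "R\<^sup>*\<^sup>* conf_start x" for x
    using that
  proof induction
    case base
    then show ?case by simp
  next
    case (step x y)
    then have T: "x \<in> T G (Suc m)" "y \<in> T G (Suc m)" and n: "next_conf G x y" unfolding R_def by auto
    show ?case
    proof (cases ?P)
      case False
      from n consider "x ! 0 = 0" "y ! 0 = 1" "I G (cat (tl y) zeros)"
        | "x ! 0 = 1" "y ! 0 = 1" "\<phi> G (cat (tl x) (cat (tl y) zeros))"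
        | "x ! 0 = 1" "F G (cat (tl x) zeros)" unfolding next_conf_def by metis
      then show ?thesis
      proof cases
        case 1
        then show ?thesis using tlT[OF T(2)] by blast
      next
        case 2
        then obtain a where a: "a \<in> T G m" "I G (cat a zeros)" "(path G \<phi> m zeros)\<^sup>*\<^sup>* a (tl x)"
          using step.IH False by auto
        have "path G \<phi> m zeros (tl x) (tl y)" unfolding path_def using 2 T tlT by blast
        then have "(path G \<phi> m zeros)\<^sup>*\<^sup>* a (tl y)" by (rule rtranclp.rtrancl_into_rtrancl[OF a(3)])
        then show ?thesis using a 2 by blast
      next
        case 3
        then obtain a where a: "a \<in> T G m" "I G (cat a zeros)" "(path G \<phi> m zeros)\<^sup>*\<^sup>* a (tl x)"
          using step.IH False by auto
        then have ?P unfolding runs_def using 3 tlT[OF T(1)] by blast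
        then show ?thesis by blast
      qed
    qed blast
  qed
  ultimately show ?P by force
next
  have big: "1 < big G" using big_gt[OF G, of 1] ok_sz[OF G] by simp
  have T1: "1 # a \<in> T G (Suc m)" if "a \<in> T G m" for a using that big by (simp add: T_def)
  assume ?P
  then obtain a b where ab: "a \<in> T G m" "b \<in> T G m" "I G (cat a zeros)" "(path G \<phi> m zeros)\<^sup>*\<^sup>* a b" "F G (cat b zeros)"
    unfolding runs_def by blast
  have "R conf_start (1 # a)" unfolding R_def next_conf_def using T1 ab conf_in[OF G, of 0] by simp
  moreover have "R\<^sup>*\<^sup>* (1 # a) (1 # b)"
    using ab(4)
  proof induction
    case (step x y)
    then have "R (1 # x) (1 # y)" unfolding R_def next_conf_def path_def using T1 by simp
    then show ?case by (rule rtranclp.rtrancl_into_rtrancl[OF step.IH])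
  qed simp
  moreover have "R (1 # b) conf_goal" unfolding R_def next_conf_def using T1 ab conf_in[OF G, of 2] by simp
  ultimately show "R\<^sup>*\<^sup>* conf_start conf_goal"
    by (meson converse_rtranclp_into_rtranclp rtranclp.rtrancl_into_rtrancl)
qed

text \<open>A vertex is a tuple b # ts @ cs: a bit selecting the copy, a time of clock digits and a
  configuration.  There are more times than pairs of configurations.\<close>

definition clock :: nat where "clock = 2 * Suc m + 1"

definition dim :: nat where "dim = Suc (clock + Suc m)"

definition top_time :: "ctx \<Rightarrow> nat" where "top_time G = big G ^ clock - 1"

text \<open>Here \<open>p\<close> and \<open>p'\<close> are the positions of the two phase entries.
  The variables from \<open>2 * dim\<close> on lie behind both vertices and will be 0; they play the
  parameters of the run.\<close>

definition next_fm :: "ctx \<Rightarrow> nat \<Rightarrow> nat \<Rightarrow> (nat \<Rightarrow> nat) \<Rightarrow> bool" where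
  "next_fm G p p' w \<longleftrightarrow>
     (w p = 0 \<and> w p' = 1 \<and> I G (\<lambda>i. w (if i < m then Suc p' + i else 2 * dim + i)))
   \<or> (w p = 1 \<and> w p' = 1 \<and> \<phi> G (\<lambda>i. w (if i < m then Suc p + i else if i < 2 * m then Suc p' + (i - m) else 2 * dim + i)))
   \<or> (w p = 1 \<and> w p' = 2 \<and> F G (\<lambda>i. w (if i < m then Suc p + i else 2 * dim + i)) \<and> (\<forall>i<m. w (Suc p' + i) = 0))"

definition descend_fm :: "ctx \<Rightarrow> nat \<Rightarrow> nat \<Rightarrow> (nat \<Rightarrow> nat) \<Rightarrow> bool" where
  "descend_fm G p p' w \<longleftrightarrow>
     val (big G) (map w [Suc p..<Suc p + clock]) = Suc (val (big G) (map w [Suc p'..<Suc p' + clock]))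
   \<and> ((\<forall>i<clock. w (Suc p' + i) = 0)
      \<or> (\<forall>i<Suc m. w (Suc p + clock + i) = w (Suc p' + clock + i))
      \<or> next_fm G (Suc p + clock) (Suc p' + clock) w)"

text \<open>The vertex x of a copy: maximal clock digits mean the time \<open>top_time\<close>, and
  zero phase and registers form \<open>conf_start\<close>.\<close>

definition source_fm :: "ctx \<Rightarrow> nat \<Rightarrow> (nat \<Rightarrow> nat) \<Rightarrow> bool" where
  "source_fm G p w \<longleftrightarrow> (\<forall>i<clock. Suc (w (Suc p + i)) = big G) \<and> (\<forall>i<Suc m. w (Suc p + clock + i) = 0)"

definition edge_fm :: "ctx \<Rightarrow> (nat \<Rightarrow> nat) \<Rightarrow> bool" where
  "edge_fm G w \<longleftrightarrow> (w 0 = w dim \<and> (descend_fm G 0 dim w \<or> descend_fm G dim 0 w))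
     \<or> (w 0 \<noteq> w dim \<and> source_fm G 0 w \<and> source_fm G dim w)"

lemma Qf_next_fm: "Qf (\<lambda>G w. next_fm G p p' w)"
  unfolding next_fm_def using n0
  by (intro Qf_disj Qf_conj Qf_all_less Qf_num Qf_ren[OF Qf(1)] Qf_ren[OF Qf(2)] Qf_ren[OF Qf(3)]) auto

lemma Qf_descend_fm: "Qf (\<lambda>G w. descend_fm G p p' w)"
  unfolding descend_fm_def using n0
  by (intro Qf_disj Qf_conj Qf_all_less Qf_num Qf_eq Qf_val_Suc Qf_next_fm) auto

lemma Qf_source_fm: "Qf (\<lambda>G w. source_fm G p w)"
  unfolding source_fm_def using n0 by (intro Qf_conj Qf_all_less Qf_num Qf_max) auto

lemma Qf_edge_fm: "Qf edge_fm"
  unfolding edge_fm_def[abs_def]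
  by (intro Qf_disj Qf_conj Qf_not Qf_eq Qf_descend_fm Qf_source_fm)

definition at_block :: "(nat \<Rightarrow> nat) \<Rightarrow> nat \<Rightarrow> nat list \<Rightarrow> nat list \<Rightarrow> bool" where
  "at_block w p ts cs \<longleftrightarrow> length ts = clock \<and> length cs = Suc m
     \<and> (\<forall>i<clock. w (Suc p + i) = ts ! i) \<and> (\<forall>i<Suc m. w (Suc p + clock + i) = cs ! i)"

lemma next_fm_iff:
  assumes "at_block w p ts cs" "at_block w p' ts' cs'" "\<And>i. w (2 * dim + i) = 0"
  shows "next_fm G (Suc p + clock) (Suc p' + clock) w \<longleftrightarrow> next_conf G cs cs'"
proof -
  have len: "length cs = Suc m" "length cs' = Suc m" using assms unfolding at_block_def by auto
  have c: "w (Suc p + clock) = cs ! 0" "w (Suc p' + clock) = cs' ! 0"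
    using assms(1,2) unfolding at_block_def by (metis add_0_right zero_less_Suc)+
  have t: "w (Suc (Suc p + clock) + i) = tl cs ! i" "w (Suc (Suc p' + clock) + i) = tl cs' ! i" if "i < m" for i
  proof -
    have "w (Suc p + clock + Suc i) = cs ! Suc i" "w (Suc p' + clock + Suc i) = cs' ! Suc i"
      using assms(1,2) that unfolding at_block_def by (meson Suc_mono)+
    then show "w (Suc (Suc p + clock) + i) = tl cs ! i" "w (Suc (Suc p' + clock) + i) = tl cs' ! i"
      using len that by (simp_all add: nth_tl)
  qed
  have 1: "(\<lambda>i. w (if i < m then Suc (Suc p' + clock) + i else 2 * dim + i)) = cat (tl cs') zeros"
    and 2: "(\<lambda>i. w (if i < m then Suc (Suc p + clock) + i else 2 * dim + i)) = cat (tl cs) zeros"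
    and 3: "(\<lambda>i. w (if i < m then Suc (Suc p + clock) + i else if i < 2 * m then Suc (Suc p' + clock) + (i - m)
       else 2 * dim + i)) = cat (tl cs) (cat (tl cs') zeros)"
    and 4: "(\<forall>i<m. w (Suc (Suc p' + clock) + i) = 0) \<longleftrightarrow> tl cs' = replicate m 0"
  proof -
    show "(\<lambda>i. w (if i < m then Suc (Suc p' + clock) + i else 2 * dim + i)) = cat (tl cs') zeros"
      by (rule ext) (simp only: if_distrib[of w] cat_def t assms(3) len length_tl diff_Suc_1 cong: if_cong)
    show "(\<lambda>i. w (if i < m then Suc (Suc p + clock) + i else 2 * dim + i)) = cat (tl cs) zeros"
      by (rule ext) (simp only: if_distrib[of w] cat_def t assms(3) len length_tl diff_Suc_1 cong: if_cong)
    show "(\<lambda>i. w (if i < m then Suc (Suc p + clock) + i else if i < 2 * m then Suc (Suc p' + clock) + (i - m)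
       else 2 * dim + i)) = cat (tl cs) (cat (tl cs') zeros)"
    proof
      fix i
      consider "i < m" | k where "i = m + k" "k < m" | "2 * m \<le> i"
        by (metis add_less_cancel_left le_Suc_ex mult_2 not_less)
      then show "w (if i < m then Suc (Suc p + clock) + i else if i < 2 * m then Suc (Suc p' + clock) + (i - m)
         else 2 * dim + i) = cat (tl cs) (cat (tl cs') zeros) i"
      proof cases
        case 1
        then show ?thesis using t(1)[of i] len by (simp add: cat_def)
      next
        case (2 k)
        then show ?thesis using t(2)[of k] len by (simp add: cat_def)
      next
        case 3
        then have "\<not> i - m < m" "\<not> i < m \<or> m = 0" by linarith+
        then show ?thesis using 3 assms(3)[of i] len by (auto simp: cat_def)
      qed
    qed
    show "(\<forall>i<m. w (Suc (Suc p' + clock) + i) = 0) \<longleftrightarrow> tl cs' = replicate m 0"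
      using t(2) len by (auto simp: list_eq_iff_nth_eq simp del: add_Suc)
  qed
  show ?thesis unfolding next_fm_def next_conf_def c 1 2 3 4 by (rule refl)
qed

lemma val_eq_0: "set ts \<subseteq> {..<b} \<Longrightarrow> val b ts = 0 \<longleftrightarrow> (\<forall>i<length ts. ts ! i = 0)"
  by (induction ts) (auto simp: All_less_Suc2)

lemma descend_fm_iff:
  assumes G: "ok G" and b: "at_block w p ts cs" "at_block w p' ts' cs'" and z: "\<And>i. w (2 * dim + i) = 0"
    and T: "ts \<in> T G clock" "ts' \<in> T G clock" "cs \<in> T G (Suc m)" "cs' \<in> T G (Suc m)"
  shows "descend_fm G p p' w \<longleftrightarrow>
    descend (T G (Suc m)) (next_conf G) (top_time G) (val (big G) ts, cs) (val (big G) ts', cs')"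
proof -
  have len: "length ts = clock" "length ts' = clock" "length cs = Suc m" "length cs' = Suc m"
    using T by (auto simp: T_def)
  have m: "map w [Suc p..<Suc p + clock] = ts" "map w [Suc p'..<Suc p' + clock] = ts'"
    using upt_map_eq_iff[OF len(1), of w "Suc p"] upt_map_eq_iff[OF len(2), of w "Suc p'"] b
    unfolding at_block_def by metis+
  have "val (big G) ts < big G ^ clock" using val_less[of ts "big G"] T len by (auto simp: T_def)
  \<comment> \<open>The largest value of the clock digits is \<open>top_time\<close>, so every
    encoded time meets the bound in \<open>descend\<close>.\<close>
  then have le: "val (big G) ts \<le> top_time G" unfolding top_time_def by simp
  have 0: "(\<forall>i<clock. w (Suc p' + i) = 0) \<longleftrightarrow> val (big G) ts' = 0"
    using val_eq_0[of ts' "big G"] T len b(2) unfolding at_block_def by (auto simp: T_def)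
  have eq: "(\<forall>i<Suc m. w (Suc p + clock + i) = w (Suc p' + clock + i)) \<longleftrightarrow> cs = cs'"
    using b len unfolding at_block_def by (auto simp: list_eq_iff_nth_eq)
  show ?thesis
    unfolding descend_fm_def descend_def m 0 eq next_fm_iff[OF b z] using T le by auto
qed

lemma source_fm_iff:
  assumes G: "ok G" and b: "at_block w p ts cs" and T: "ts \<in> T G clock" "cs \<in> T G (Suc m)"
  shows "source_fm G p w \<longleftrightarrow> (val (big G) ts, cs) = (top_time G, conf_start)"
proof -
  have len: "length ts = clock" "length cs = Suc m" using T by (auto simp: T_def)
  have pos: "0 < big G" using big_pos[OF G] .
  have top: "top_time G = val (big G) (replicate clock (big G - 1))"
    unfolding top_time_def using val_replicate_max[OF pos, of clock] by simp
  have "val (big G) ts = top_time G \<longleftrightarrow> ts = replicate clock (big G - 1)"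
    unfolding top by (rule val_inj) (use T len pos in \<open>auto simp: T_def set_replicate_conv_if\<close>)
  also have "\<dots> \<longleftrightarrow> (\<forall>i<clock. Suc (w (Suc p + i)) = big G)"
    using b len pos unfolding at_block_def by (auto simp: list_eq_iff_nth_eq)
  finally have 1: "(\<forall>i<clock. Suc (w (Suc p + i)) = big G) \<longleftrightarrow> val (big G) ts = top_time G" by simp
  have "cs = conf_start \<longleftrightarrow> cs = replicate (Suc m) 0" by simp
  also have "\<dots> \<longleftrightarrow> (\<forall>i<Suc m. w (Suc p + clock + i) = 0)"
    using b len unfolding at_block_def by (auto simp: list_eq_iff_nth_eq simp del: replicate_Suc)
  finally show ?thesis unfolding source_fm_def 1 by auto
qed

lemma at_block_append:
  assumes "length x = p" "length ts = clock" "length cs = Suc m"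
  shows "at_block (cat (x @ (b # ts @ cs) @ z) v) p ts cs" "cat (x @ (b # ts @ cs) @ z) v p = b"
  using assms unfolding at_block_def by (auto simp: cat_def nth_append)

text \<open>There are at most \<open>big G ^ (2 * Suc m)\<close> pairs; the extra clock digit
  multiplies this by at least 3, which survives the subtraction of 1 in
  \<open>top_time\<close>.\<close>

lemma conf_pairs_less_top_time:
  assumes "ok G"
  shows "card {(a, b). a \<in> T G (Suc m) \<and> b \<in> T G (Suc m) \<and> next_conf G a b} < top_time G"
proof -
  let ?C = "T G (Suc m)"
  have "card {(a, b). a \<in> ?C \<and> b \<in> ?C \<and> next_conf G a b} \<le> card (?C \<times> ?C)"
    by (rule card_mono) (auto simp: finite_T)
  also have "\<dots> = big G ^ (2 * Suc m)"
    by (simp add: card_cartesian_product card_T power_add mult_2)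
  also have "\<dots> < top_time G"
  proof -
    have "3 \<le> big G" using big_gt[OF assms, of 2] ok_sz[OF assms] by simp
    then have "3 * big G ^ (2 * Suc m) \<le> big G ^ clock" "1 \<le> big G ^ (2 * Suc m)"
      unfolding clock_def by simp_all
    then show ?thesis unfolding top_time_def by linarith
  qed
  finally show ?thesis .
qed

text \<open>In the order x1, y1, z1, x2, y2, z2, the test \<open>i < 3\<close> decides the copy and
  \<open>i mod 3\<close> the role. The vertex x sits at the top time, y and z at time 1, whose digit
  1 leads because the least significant digit comes first; phase 2 makes z the goal.\<close>

definition cst_blocks :: "nat \<Rightarrow> nat option list" where
  "cst_blocks i = Some (if i < 3 then 0 else 1) #
     (if i mod 3 = 0 then replicate clock None else Some 1 # replicate (clock - 1) (Some 0)) @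
     Some (if i mod 3 = 2 then 2 else 0) # replicate m (Some 0)"

lemma length_cst_blocks: "length (cst_blocks i) = dim"
  unfolding cst_blocks_def dim_def by (auto simp: clock_def)

lemma length_concat_blocks: "length (concat (map block_tms bs)) = K * length bs"
  by (induction bs) (auto simp: block_tms)

lemma map_block_num_cst:
  "map (block_num G) (cst_blocks i) = (if i < 3 then 0 else 1) #
     (if i mod 3 = 0 then replicate clock (big G - 1) else 1 # replicate (clock - 1) 0) @
     ((if i mod 3 = 2 then 2 else 0) # replicate m 0)"
  unfolding cst_blocks_def by (simp add: block_num_def)

text \<open>The formulas and closed terms enter only through their meaning on decoded tuples.
  Decoding is a bijection onto bits, times and configurations, and under it the results on joined
  copies and on layered graphs apply.\<close>

lemma graph_correct:
  assumes G: "ok (A, os)"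
    and dom: "\<And>xs. xs \<in> elems (A, os) dim \<Longrightarrow>
      holds A os (ival xs) (idom g) \<longleftrightarrow> decode (A, os) dim xs ! 0 \<in> {0, 1}"
    and edge: "\<And>xs. xs \<in> elems (A, os) (dim + dim) \<Longrightarrow>
      holds A os (ival xs) (iedge g) \<longleftrightarrow> edge_fm (A, os) (cat (decode (A, os) (dim + dim) xs) zeros)"
    and cst: "\<And>i. icst g i = [(FTrue, concat (map block_tms (cst_blocks i)))]"
    and dim: "idim g = K * dim"
  shows "interp_graph_ok g A os"
    and "bft (idomain g A os) (iE g A os) vs \<Longrightarrow> psi vs (iE g A os) (iconst g A os) \<longleftrightarrow>
      runs (A, os) m I \<phi> F zeros"
proof -
  define G where "G = (A, os)"
  note G' = G[folded G_def]
  let ?V = "idomain g A os" and ?E = "iE g A os"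
  let ?C = "T G (Suc m)" and ?Tm = "top_time G"
  let ?H = "layered ?C (next_conf G) ?Tm"
  define u where "u xs = decode G dim xs" for xs
  define \<beta> where "\<beta> xs \<longleftrightarrow> u xs ! 0 = 1" for xs
  define ts where "ts xs = take clock (tl (u xs))" for xs
  define cs where "cs xs = drop clock (tl (u xs))" for xs
  define \<eta> where "\<eta> xs = (val (big G) (ts xs), cs xs)" for xs
  have V: "xs \<in> ?V \<longleftrightarrow> xs \<in> elems G dim \<and> u xs ! 0 \<in> {0, 1}" for xs
    using dom[of xs] unfolding idomain_def elems_def dim u_def G_def by auto
  have uV: "u xs = u xs ! 0 # ts xs @ cs xs" "u xs \<in> T G dim" "ts xs \<in> T G clock" "cs xs \<in> ?C"
    if "xs \<in> elems G dim" for xs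
  proof -
    show uT: "u xs \<in> T G dim" unfolding u_def by (rule decode_T[OF G' that])
    then obtain y ys where y: "u xs = y # ys" "ys \<in> T G (clock + Suc m)" unfolding dim_def
      by (auto simp: T_def length_Suc_conv)
    obtain a b where ab: "ys = a @ b" "a \<in> T G clock" "b \<in> ?C" using T_split[OF y(2)] .
    then have "ts xs = a" "cs xs = b" using y ab T_length[OF ab(2)] unfolding ts_def cs_def by auto
    then show "u xs = u xs ! 0 # ts xs @ cs xs" "ts xs \<in> T G clock" "cs xs \<in> ?C" using y ab by auto
  qed
  have start: "conf_start \<in> ?C" "conf_goal \<in> ?C" using conf_in[OF G'] by auto
  have E: "?E xs ys \<longleftrightarrow> (\<beta> xs = \<beta> ys \<and> ?H (\<eta> xs) (\<eta> ys)) \<or>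
      (\<beta> xs \<noteq> \<beta> ys \<and> \<eta> xs = (?Tm, conf_start) \<and> \<eta> ys = (?Tm, conf_start))"
    if xy: "xs \<in> ?V" "ys \<in> ?V" for xs ys
  proof -
    have x: "xs \<in> elems G dim" "u xs ! 0 \<in> {0, 1}" and y: "ys \<in> elems G dim" "u ys ! 0 \<in> {0, 1}"
      using xy V by auto
    have len: "length (ts xs) = clock" "length (cs xs) = Suc m" "length (ts ys) = clock" "length (cs ys) = Suc m"
      "length (u xs) = dim" "length (u ys) = dim"
      using uV[OF x(1)] uV[OF y(1)] by (auto simp: T_def)
    have xsys: "xs @ ys \<in> elems G (dim + dim)" using x y unfolding elems_def by (auto simp: algebra_simps)
    define w where "w = cat (u xs @ u ys) zeros"
    have "?E xs ys \<longleftrightarrow> edge_fm G w"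
      unfolding iE_def w_def u_def using edge[of "xs @ ys"] xsys decode_append[where xs = xs and k = dim and G = G and l = dim and ys = ys] x(1)
      unfolding G_def elems_def by simp
    moreover have b: "at_block w 0 (ts xs) (cs xs)" "at_block w dim (ts ys) (cs ys)" "w 0 = u xs ! 0" "w dim = u ys ! 0"
    proof -
      have w1: "w = cat ([] @ (u xs ! 0 # ts xs @ cs xs) @ u ys) zeros"
        unfolding w_def using uV(1)[OF x(1)] by simp
      show "at_block w 0 (ts xs) (cs xs)" "w 0 = u xs ! 0"
        unfolding w1 by (rule at_block_append; simp add: len)+
      have w2: "w = cat (u xs @ (u ys ! 0 # ts ys @ cs ys) @ []) zeros"
        unfolding w_def using uV(1)[OF y(1)] by simp
      show "at_block w dim (ts ys) (cs ys)" "w dim = u ys ! 0"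
        unfolding w2 by (rule at_block_append; simp add: len)+
    qed
    moreover have z: "w (2 * dim + i) = 0" for i unfolding w_def cat_def using len by simp
    moreover have "u xs ! 0 = u ys ! 0 \<longleftrightarrow> \<beta> xs = \<beta> ys" unfolding \<beta>_def using x(2) y(2) by auto
    ultimately show ?thesis
      unfolding edge_fm_def layered_def \<eta>_def
      using descend_fm_iff[OF G' b(1,2) z] descend_fm_iff[OF G' b(2,1) z] source_fm_iff[OF G' b(1)]
        source_fm_iff[OF G' b(2)] uV(3,4)[OF x(1)] uV(3,4)[OF y(1)] by simp
  qed
  have ic: "iconst g A os i = map (ev A os (\<lambda>_. 0)) (concat (map block_tms (cst_blocks i)))" for i
    unfolding iconst_def cases_holding_def cst by simp
  have small: "k < 3" if "Some k \<in> set (cst_blocks i)" for k i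
    using that unfolding cst_blocks_def by (auto split: if_splits)
  have ce: "iconst g A os i \<in> elems G dim" and cu: "u (iconst g A os i) = map (block_num G) (cst_blocks i)" for i
    using decode_blocks[OF G', of "cst_blocks i" "\<lambda>_. 0", OF small] unfolding ic u_def length_cst_blocks by (simp_all add: G_def)
  have cV: "iconst g A os i \<in> ?V" for i
    using ce unfolding V cu map_block_num_cst by simp
  have cb: "\<beta> (iconst g A os i) \<longleftrightarrow> i \<ge> 3" for i
    unfolding \<beta>_def cu map_block_num_cst by simp
  have clock1: "clock = Suc (clock - 1)" unfolding clock_def by simp
  have len_t: "length (if i mod 3 = 0 then replicate clock (big G - 1) else 1 # replicate (clock - 1) 0) = clock" for i :: nat
    using clock1 by simp
  have c\<eta>: "\<eta> (iconst g A os i) = (if i mod 3 = 0 then ?Tm else 1, (if i mod 3 = 2 then 2 else 0) # replicate m 0)" for i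
  proof -
    have "ts (iconst g A os i) = (if i mod 3 = 0 then replicate clock (big G - 1) else 1 # replicate (clock - 1) 0)"
      "cs (iconst g A os i) = (if i mod 3 = 2 then 2 else 0) # replicate m 0"
      unfolding ts_def cs_def cu map_block_num_cst list.sel using len_t[of i] by simp_all
    moreover have "val (big G) (replicate clock (big G - 1)) = ?Tm"
      unfolding top_time_def using val_replicate_max[OF big_pos[OF G'], of clock] by simp
    ultimately show ?thesis unfolding \<eta>_def by (simp add: val_replicate_0)
  qed
  show "interp_graph_ok g A os"
    unfolding interp_graph_ok_def
  proof (intro conjI allI impI ballI)
    fix i show "length (cases_holding g A os i) = 1" unfolding cases_holding_def cst by simp
    show "iconst g A os i \<in> ?V" by (rule cV)
  next
    fix xs ys assume "xs \<in> ?V" "ys \<in> ?V"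
    then show "?E xs ys \<longleftrightarrow> ?E ys xs" unfolding E[OF \<open>xs \<in> ?V\<close> \<open>ys \<in> ?V\<close>] E[OF \<open>ys \<in> ?V\<close> \<open>xs \<in> ?V\<close>]
      using sympD[OF symp_layered, of ?C "next_conf G" ?Tm] by metis
  next
    fix xs assume "xs \<in> ?V"
    then show "\<not> ?E xs xs" unfolding E[OF \<open>xs \<in> ?V\<close> \<open>xs \<in> ?V\<close>] by (auto simp: layered_def descend_def split: prod.splits)
  qed
  \<comment> \<open>Every time up to \<open>top_time\<close> and every tuple of registers arises
    from digits, so the domain formula has to restrict only the copy bit.\<close>
  have bij: "bij_betw (\<lambda>v. (\<beta> v, \<eta> v)) ?V (UNIV \<times> ({..?Tm} \<times> ?C))"
  proof (rule bij_betw_imageI)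
    show "inj_on (\<lambda>v. (\<beta> v, \<eta> v)) ?V"
    proof (rule inj_onI)
      fix xs ys assume xy: "xs \<in> ?V" "ys \<in> ?V" and eq: "(\<beta> xs, \<eta> xs) = (\<beta> ys, \<eta> ys)"
      have x: "xs \<in> elems G dim" "u xs ! 0 \<in> {0, 1}" and y: "ys \<in> elems G dim" "u ys ! 0 \<in> {0, 1}"
        using xy V by auto
      have "u xs ! 0 = u ys ! 0" using eq x(2) y(2) unfolding \<beta>_def by auto
      moreover have "ts xs = ts ys"
        using eq val_inj[of "ts xs" "ts ys" "big G"] uV(3)[OF x(1)] uV(3)[OF y(1)] unfolding \<eta>_def T_def by simp
      moreover have "cs xs = cs ys" using eq unfolding \<eta>_def by simp
      ultimately have "u xs = u ys" using uV(1)[OF x(1)] uV(1)[OF y(1)] by metis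
      then show "xs = ys" unfolding u_def by (rule decode_inj[OF G' x(1) y(1)])
    qed
    show "(\<lambda>v. (\<beta> v, \<eta> v)) ` ?V = UNIV \<times> ({..?Tm} \<times> ?C)"
    proof
      show "(\<lambda>v. (\<beta> v, \<eta> v)) ` ?V \<subseteq> UNIV \<times> ({..?Tm} \<times> ?C)"
      proof
        fix e assume "e \<in> (\<lambda>v. (\<beta> v, \<eta> v)) ` ?V"
        then obtain xs where xs: "xs \<in> ?V" "e = (\<beta> xs, \<eta> xs)" by blast
        then have x: "xs \<in> elems G dim" using V by blast
        have "val (big G) (ts xs) < big G ^ clock" using val_less[of "ts xs" "big G"] uV(3)[OF x] by (auto simp: T_def)
        then show "e \<in> UNIV \<times> ({..?Tm} \<times> ?C)" using xs(2) uV(4)[OF x] unfolding \<eta>_def top_time_def by auto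
      qed
      show "UNIV \<times> ({..?Tm} \<times> ?C) \<subseteq> (\<lambda>v. (\<beta> v, \<eta> v)) ` ?V"
      proof
        fix e assume "e \<in> (UNIV :: bool set) \<times> ({..?Tm} \<times> ?C)"
        then obtain b t k where e: "e = (b, t, k)" "t \<le> ?Tm" "k \<in> ?C" by auto
        have "0 < big G ^ clock" using big_pos[OF G'] by simp
        then have "t < big G ^ clock" using e(2) unfolding top_time_def by linarith
        then obtain ds where ds: "length ds = clock" "set ds \<subseteq> {..<big G}" "val (big G) ds = t" using val_surj by blast
        let ?u = "(if b then 1 else 0) # ds @ k"
        have "?u \<in> T G dim" unfolding dim_def using ds e(3) big_gt[OF G', of 1] ok_sz[OF G'] big_pos[OF G']
          by (auto simp: T_def)
        then obtain xs where xs: "xs \<in> elems G dim" "u xs = ?u" using decode_surj[OF G'] unfolding u_def by blast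
        have "xs \<in> ?V" unfolding V using xs by auto
        moreover have "(\<beta> xs, \<eta> xs) = e"
          unfolding e \<beta>_def \<eta>_def ts_def cs_def xs(2) using ds by simp
        ultimately show "e \<in> (\<lambda>v. (\<beta> v, \<eta> v)) ` ?V" by blast
      qed
    qed
  qed
  assume bft: "bft ?V ?E vs"
  let ?R = "\<lambda>a b. a \<in> ?C \<and> b \<in> ?C \<and> next_conf G a b"
  have card: "card {(a, b). a \<in> ?C \<and> b \<in> ?C \<and> next_conf G a b} < ?Tm"
    by (rule conf_pairs_less_top_time[OF G'])
  then have T1: "1 \<le> ?Tm" by simp
  \<comment> \<open>The start is reachable from itself by no step at all, so pure idling realises
    the short distance.\<close>
  have dy: "gdist ?H (?Tm, conf_start) (1, conf_start) = ?Tm - 1"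
    using layered_gdist[OF finite_T start(1,1) card] by simp
  have dz: "gdist ?H (?Tm, conf_start) (1, conf_goal) = (if ?R\<^sup>*\<^sup>* conf_start conf_goal then ?Tm - 1 else ?Tm + 1)"
    using layered_gdist[OF finite_T start card] .
  have "psi vs ?E (iconst g A os) \<longleftrightarrow>
      gdist ?H (?Tm, conf_start) (1, conf_start) = gdist ?H (?Tm, conf_start) (1, conf_goal)"
  proof (rule psi_two_copies[OF bft bij])
    show "symp ?H" by (rule symp_layered)
    show "?E xs ys \<longleftrightarrow> (\<beta> xs = \<beta> ys \<and> ?H (\<eta> xs) (\<eta> ys)) \<or>
      (\<beta> xs \<noteq> \<beta> ys \<and> \<eta> xs = (?Tm, conf_start) \<and> \<eta> ys = (?Tm, conf_start))"
      if "xs \<in> ?V" "ys \<in> ?V" for xs ys using E[OF that] .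
    show "h \<in> {..?Tm} \<times> ?C \<and> h' \<in> {..?Tm} \<times> ?C" if "?H h h'" for h h' using layered_in[OF that] .
    show "?H\<^sup>*\<^sup>* (?Tm, conf_start) h" if "h \<in> {..?Tm} \<times> ?C" for h
      using that layered_connected[OF start(1) _ _ T1] by auto
    show "gdist ?H (?Tm, conf_start) (1, conf_goal) = gdist ?H (?Tm, conf_start) (1, conf_start) \<or>
      gdist ?H (?Tm, conf_start) (1, conf_goal) = gdist ?H (?Tm, conf_start) (1, conf_start) + 2"
      unfolding dy dz using T1 by simp
  qed (use cV cb c\<eta> in simp_all)
  also have "\<dots> \<longleftrightarrow> ?R\<^sup>*\<^sup>* conf_start conf_goal" unfolding dy dz by (simp, arith)
  also have "\<dots> \<longleftrightarrow> runs G m I \<phi> F zeros"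
    by (rule next_conf_reach[OF G'])
  finally show "psi vs ?E (iconst g A os) \<longleftrightarrow> runs (A, os) m I \<phi> F zeros" unfolding G_def .
qed

lemma ex_interp: "\<exists>g. qf_interp L g \<and> decides g (\<lambda>G. runs G m I \<phi> F zeros)"
proof -
  have "Qf (\<lambda>G w. w 0 = 0 \<or> w 0 = 1)" using n0 by (intro Qf_disj Qf_num) auto
  from Qf_formula[OF this, of dim] obtain p where p: "wf_fm L (K * dim) p"
    "\<And>G xs. ok G \<Longrightarrow> xs \<in> elems G dim \<Longrightarrow> holds (fst G) (snd G) (ival xs) p \<longleftrightarrow>
      cat (decode G dim xs) zeros 0 = 0 \<or> cat (decode G dim xs) zeros 0 = 1" by blast
  from Qf_formula[OF Qf_edge_fm, of "dim + dim"] obtain q where q: "wf_fm L (K * (dim + dim)) q"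
    "\<And>G xs. ok G \<Longrightarrow> xs \<in> elems G (dim + dim) \<Longrightarrow> holds (fst G) (snd G) (ival xs) q \<longleftrightarrow>
      edge_fm G (cat (decode G (dim + dim) xs) zeros)" by blast
  define g where "g = \<lparr>idim = K * dim, idom = p, iedge = q, icst = \<lambda>i. [(FTrue, concat (map block_tms (cst_blocks i)))]\<rparr>"
  have "qf_interp L g"
    unfolding qf_interp_def g_def using p(1) q(1) block_tms(2)
    by (auto simp: length_concat_blocks length_cst_blocks mult_2 distrib_left)
  moreover have "decides g (\<lambda>G. runs G m I \<phi> F zeros)"
    unfolding decides_def
  proof (intro allI impI)
    fix A os assume ok: "ok (A, os)"
    have 1: "holds A os (ival xs) (idom g) \<longleftrightarrow> decode (A, os) dim xs ! 0 \<in> {0, 1}"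
      if "xs \<in> elems (A, os) dim" for xs
      using p(2)[OF ok that] unfolding g_def by (simp add: cat_def length_decode dim_def)
    have 2: "holds A os (ival xs) (iedge g) \<longleftrightarrow> edge_fm (A, os) (cat (decode (A, os) (dim + dim) xs) zeros)"
      if "xs \<in> elems (A, os) (dim + dim)" for xs
      using q(2)[OF ok that] unfolding g_def by simp
    have 3: "icst g i = [(FTrue, concat (map block_tms (cst_blocks i)))]" "idim g = K * dim" for i
      unfolding g_def by simp_all
    show "interp_graph_ok g A os \<and> (\<forall>vs. bft (idomain g A os) (iE g A os) vs \<longrightarrow>
        (runs (A, os) m I \<phi> F zeros \<longleftrightarrow> psi vs (iE g A os) (iconst g A os)))"
      using graph_correct[OF ok 1 2 3] by blast
  qed
  ultimately show ?thesis by blast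
qed

end

text \<open>The predicate does not look at its parameters, so they may all be 0, which is what the
  padding of the formulas supplies.\<close>

lemma (in definability) Def_interp:
  assumes "Def (\<lambda>G v. P G)" shows "\<exists>g. qf_interp L g \<and> decides g P"
proof -
  obtain m I \<phi> F where Q: "Qf I" "Qf \<phi>" "Qf F" and r: "represents m I \<phi> F (\<lambda>G v. P G)"
    using assms unfolding Def_def by blast
  interpret run_graph L K n0 m I \<phi> F by unfold_locales (rule Q)+
  have P: "P G \<longleftrightarrow> runs G m I \<phi> F zeros" if "ok G" for G
    using representsD[OF r that, of zeros] big_pos[OF that] unfolding runs_def by simp
  obtain g where "qf_interp L g" "decides g (\<lambda>G. runs G m I \<phi> F zeros)" using ex_interp by blast
  then show ?thesis using P unfolding decides_def by (intro exI[of _ g]) simp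
qed

text \<open>The constants depend on each other in one direction: \<open>B\<close> and
  \<open>n0\<close> come from the machine alone, the exponent \<open>e\<close> from polynomial
  bounds that involve \<open>B\<close>, and the block length K from \<open>e\<close>. The size
  threshold is \<open>n0\<close>.\<close>

theorem theorem5:
  fixes L :: sig and Q :: "struc \<Rightarrow> bool"
  assumes "is_query L Q" and "NL_query L Q"
  shows "\<exists>g. qf_interp L g \<and>
           (\<exists>N. \<forall>A os. is_struc L A \<and> size A \<ge> N \<and> is_order A os \<longrightarrow>
              interp_graph_ok g A os \<and>
              (\<forall>vs. bft (idomain g A os) (iE g A os) vs \<longrightarrow>
                 (Q A \<longleftrightarrow> psi vs (iE g A os) (iconst g A os))))"
proof -
  obtain M c where fin: "finite (delta M)"
    and acc: "\<And>A os. is_struc L A \<Longrightarrow> is_order A os \<Longrightarrow> accepts M c (enc L A os) \<longleftrightarrow> Q A"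
    using assms(2) unfolding NL_query_def by blast
  \<comment> \<open>Bounding the sum of all states and letters of a transition bounds each of
    them.\<close>
  let ?s = "\<lambda>(q, a, b, q', b', di::int, dj::int). q + a + b + q' + b' :: nat"
  have "finite (?s ` delta M)" using fin by (rule finite_imageI)
  then obtain N where N: "\<forall>k\<in>?s ` delta M. k < N" unfolding finite_nat_set_iff_bounded by blast
  \<comment> \<open>Larger than every letter, and a power of two, so that
    \<open>B ^ (sp + 2)\<close> is a fixed power of \<open>4 * 2 ^ sp\<close> and therefore
    polynomial.\<close>
  define B where "B = (2::nat) ^ Suc N"
  \<comment> \<open>Exceeds everything that has to be named by a closed term: states, letters,
    \<open>B\<close>, \<open>c\<close> and the endmarker 4.\<close>
  define n0 where "n0 = B + N + c + start M + accept M + 5"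
  let ?w = "\<lambda>G. enc L (fst G) (snd G)"
  let ?m = "\<lambda>G. length (?w G) + 2"
  let ?sp = "\<lambda>G. nat (space c (length (?w G)))"
  have "polyb L ?m" by (intro polyb_add polyb_enc polyb_const)
  then have mc: "polyb L (\<lambda>G. ?m G ^ c)" by (rule polyb_power)
  \<comment> \<open>Rounding the logarithm up costs at most a factor 2; the witness \<open>h\<close>
    is half of \<open>2 ^ sp\<close>.\<close>
  have sp_le: "2 ^ ?sp G \<le> 2 * ?m G ^ c" for G
  proof -
    consider "?sp G = 0" | h where "h + h = 2 ^ ?sp G" "h < ?m G ^ c"
      using space_eq_iff[of "?sp G" c "length (?w G)"] by auto
    then show ?thesis
    proof cases
      case 1
      have "1 \<le> ?m G ^ c" by simp
      then show ?thesis using 1 by simp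
    qed linarith
  qed
  have sp: "polyb L (\<lambda>G. 2 ^ ?sp G)"
    by (rule polyb_mono[OF polyb_mult[OF polyb_const mc] sp_le])
  have four: "4 * 2 ^ k = (2::nat) ^ (k + 2)" for k by (simp add: power_add)
  have "B ^ (?sp G + 2) = (4 * 2 ^ ?sp G) ^ Suc N" for G
    unfolding B_def four power_mult[symmetric] by (simp only: mult.commute)
  then have Bp: "polyb L (\<lambda>G. B ^ (?sp G + 2))"
    using polyb_power[OF polyb_mult[OF polyb_const[of L 4] sp], of "Suc N"] by simp
  have "polyb L (\<lambda>G. ?m G + ?m G ^ c + 2 ^ ?sp G + B ^ (?sp G + 2))"
    by (intro polyb_add \<open>polyb L ?m\<close> mc sp Bp)
  then obtain e where e: "\<And>G. is_struc L (fst G) \<Longrightarrow> 2 \<le> sz G \<Longrightarrow>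
      ?m G + ?m G ^ c + 2 ^ ?sp G + B ^ (?sp G + 2) \<le> sz G ^ e" unfolding polyb_def by blast
  \<comment> \<open>The power with exponent \<open>e\<close> bounds all relevant numbers weakly;
    three more digits make the bound strict and give \<open>3 \<le> K\<close>.\<close>
  interpret d: definability L "e + 3" n0
    by unfold_locales (auto simp: n0_def)
  interpret simulation L "e + 3" n0 M c B
  proof
    show "finite (delta M)" by (rule fin)
    have "(2::nat) ^ 1 \<le> 2 ^ Suc N" by (rule power_increasing) auto
    then show "2 \<le> B" unfolding B_def by simp
    show "B < n0" "c < n0" "4 < n0" "start M < n0" "accept M < n0" unfolding n0_def by auto
    have NB: "N < B" unfolding B_def using less_exp[of "Suc N"] by linarith
    show "q < n0 \<and> a < n0 \<and> b < B \<and> q' < n0 \<and> b' < B" if "(q, a, b, q', b', di, dj) \<in> delta M"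
      for q a b q' b' di dj using N[rule_format, OF imageI[OF that]] NB unfolding n0_def by auto
    fix G assume G: "d.ok G"
    then have s: "is_struc L (fst G)" "3 \<le> sz G" using d.ok_sz unfolding d.ok_def by auto
    have "sz G ^ e < d.big G" unfolding d.big_def using s(2) by (intro power_strict_increasing) auto
    moreover have "?m G + ?m G ^ c + 2 ^ ?sp G + B ^ (?sp G + 2) \<le> sz G ^ e" using e s by simp
    ultimately show "?m G < d.big G \<and> ?m G ^ c < d.big G \<and> 2 ^ ?sp G < d.big G \<and> B ^ (?sp G + 2) < d.big G"
      by linarith
  qed
  obtain g where g: "qf_interp L g" "d.decides g simacc"
    using d.Def_interp[OF Def_simacc] by blast
  have "Q A \<longleftrightarrow> simacc (A, os)" if "d.ok (A, os)" for A os
    using simacc_iff[OF that] acc that unfolding inword_def d.ok_def by simp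
  then show ?thesis
    using g unfolding d.ok_def d.decides_def by (intro exI[of _ g] conjI exI[of _ n0]) auto
qed

end
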